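(* Let $u={\bf u}(t,{\bf x})$ be a smooth time-dependent vector field on $\mathbb R^3$ and let $P,\rho$ (with $\rho>0$) be smooth functions on $\mathbb R\times\mathbb R^3$ such that the incompressible Euler equations $$\frac{\partial {\bf u}}{\partial t}+{\bf u}\cdot\nabla{\bf u}=-\nabla\Big(\frac1\rho P\Big),\qquad \nabla\cdot{\bf u}=0$$ hold. Let ${\bf w}=\nabla\times{\bf u}$ be the vorticity, and let $h$ be a smooth function on $\mathbb R\times\mathbb R^3$ with $$\frac{\partial h}{\partial t}+{\bf u}\cdot\nabla h=0,\qquad {\bf w}\cdot\nabla h\neq 0 \text{ everywhere}.$$ Then: (1) The two-form $$\Omega_e=-(\nabla h+{\bf u}\times{\bf w})\cdot d{\bf x}\wedge dt+{\bf w}\cdot(d{\bf x}\wedge d{\bf x})$$ on $\mathbb R\times\mathbb R^3$ is symplectic, and the suspended vector field $\partial_t+u$, $u={\bf u}\cdot\nabla$, is a Hamiltonian vector field for $\Omega_e$ with Hamiltonian function $h$, i.e. $i(\partial_t+u)(\Omega_e)=dh$. (2) The potential vorticity $\rho_h:=-{\bf w}\cdot\nabla h$ is the invariant Liouville volume density of the symplectic structure, i.e. $\frac12\Omega_e\wedge\Omega_e=\rho_h\,dx\wedge dy\wedge dz\wedge dt$ and $\frac{\partial\rho_h}{\partial t}+\nabla\cdot(\rho_h{\bf u})=0$. (3) $\Omega_e$ is exact: $\Omega_e=-d\theta_e$ with $$-\theta_e=\psi_e\,dt+{\bf u}\cdot d{\bf x},\qquad -\psi_e=h+\frac1\rho P+\frac12|{\bf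 u}|^2 .$$ (4) Around every point of $\mathbb R\times\mathbb R^3$ there are Darboux coordinates $(q,p,t,h_{can})$, in which $\Omega_e=dp\wedge dq+dh_{can}\wedge dt$, and in any such coordinates (on a simply connected neighbourhood) the velocity field has the Clebsch representation $${\bf u}=\nabla s+p\,\nabla q,$$ where $s$ is the generating function of the canonical transformation.
   Context: Coordinates on $\mathbb R\times\mathbb R^3$ are $(t,{\bf x})=(t,x,y,z)$; $\nabla$, $\nabla\cdot$, $\nabla\times$ act on the spatial variables only, while $d$ is the exterior derivative on the four-dimensional space $\mathbb R\times\mathbb R^3$. For a vector ${\bf V}=(V_1,V_2,V_3)$: ${\bf V}\cdot d{\bf x}=V_1dx+V_2dy+V_3dz$ and ${\bf V}\cdot(d{\bf x}\wedge d{\bf x})=V_1\,dy\wedge dz+V_2\,dz\wedge dx+V_3\,dx\wedge dy$. A symplectic form is a closed nondegenerate two-form. $i(X)$ denotes the inner product (contraction) with the vector field $X$, and $X$ is Hamiltonian with Hamiltonian function $h$ if $i(X)(\Omega)=dh$. The generating function $s$ of the canonical transformation to the coordinates $(q,p,t,h_{can})$ is a (local) function with $ds=\theta_{can}-\theta_e$, where $-\theta_{can}=p\,dq+h_{can}\,dt$. *)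

theory Defs
  imports "HOL-Analysis.Analysis" "HOL-Combinatorics.Permutations"
begin

section \<open>Smooth functions\<close>

text \<open>\<open>C\<^sup>n\<close> and \<open>C\<^sup>\<infinity>\<close> functions on an open set; the definitions are only meaningful for open \<open>S\<close>.\<close>

primrec Ck_on :: "nat \<Rightarrow> 'a::real_normed_vector set \<Rightarrow> ('a \<Rightarrow> 'b::real_normed_vector) \<Rightarrow> bool" where
  "Ck_on 0 S f \<longleftrightarrow> continuous_on S f"
| "Ck_on (Suc n) S f \<longleftrightarrow> (\<forall>x\<in>S. f differentiable (at x)) \<and>
     (\<forall>v. Ck_on n S (\<lambda>x. frechet_derivative f (at x) v))"

definition smooth_on :: "'a::real_normed_vector set \<Rightarrow> ('a \<Rightarrow> 'b::real_normed_vector) \<Rightarrow> bool" where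
  "smooth_on S f \<longleftrightarrow> (\<forall>n. Ck_on n S f)"


section \<open>Differential forms on a Euclidean space\<close>

text \<open>A \<open>k\<close>-form assigns to a point \<open>x\<close> and to tangent vectors \<open>v 0, \<dots>, v (k - 1)\<close> a real number.
  The vectors are passed as a sequence, of which a \<open>k\<close>-form (see \<open>is_form\<close>) reads only the first
  \<open>k\<close> entries; hence two \<open>k\<close>-forms agree iff they are equal as functions. The degree is an explicit
  argument of the operations that depend on it.\<close>

type_synonym 'a dform = "'a \<Rightarrow> (nat \<Rightarrow> 'a) \<Rightarrow> real"

definition is_form :: "nat \<Rightarrow> 'a::euclidean_space dform \<Rightarrow> bool" where
  "is_form k \<omega> \<longleftrightarrow>
     (\<forall>v. smooth_on UNIV (\<lambda>x. \<omega> x v)) \<and>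
     (\<forall>x v w. (\<forall>i<k. v i = w i) \<longrightarrow> \<omega> x v = \<omega> x w) \<and>
     (\<forall>x v. \<forall>i<k. linear (\<lambda>a. \<omega> x (v(i := a)))) \<and>
     (\<forall>x v i j. i < j \<and> j < k \<and> v i = v j \<longrightarrow> \<omega> x v = 0)"

definition form0 :: "('a \<Rightarrow> real) \<Rightarrow> 'a dform" where
  "form0 f = (\<lambda>x v. f x)"

text \<open>The exterior product of a \<open>k\<close>-form and an \<open>l\<close>-form, normalised such that
  \<open>(dx \<and> dy)(a, b) = dx(a) dy(b) - dx(b) dy(a)\<close>.\<close>

definition wedge :: "nat \<Rightarrow> nat \<Rightarrow> 'a dform \<Rightarrow> 'a dform \<Rightarrow> 'a dform" where
  "wedge k l \<alpha> \<beta> = (\<lambda>x v.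
     (\<Sum>\<sigma> | \<sigma> permutes {..<k + l}.
        of_int (sign \<sigma>) * \<alpha> x (\<lambda>i. v (\<sigma> i)) * \<beta> x (\<lambda>i. v (\<sigma> (k + i)))) / (fact k * fact l))"

text \<open>The exterior derivative of a \<open>k\<close>-form:
  \<open>d\<omega>(v\<^sub>0, \<dots>, v\<^sub>k) = \<Sum>\<^sub>i (-1)\<^sup>i D\<omega>(v\<^sub>0, \<dots>, v\<^sub>k without v\<^sub>i)[v\<^sub>i]\<close>.\<close>

definition ext_d :: "nat \<Rightarrow> 'a::euclidean_space dform \<Rightarrow> 'a dform" where
  "ext_d k \<omega> = (\<lambda>x v. \<Sum>i\<le>k. (-1) ^ i *
     frechet_derivative (\<lambda>y. \<omega> y (\<lambda>j. if j < i then v j else v (Suc j))) (at x) (v i))"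

definition contract :: "('a \<Rightarrow> 'a) \<Rightarrow> 'a dform \<Rightarrow> 'a dform" where
  "contract X \<omega> = (\<lambda>x v. \<omega> x (case_nat (X x) v))"

definition nondegenerate :: "'a::euclidean_space dform \<Rightarrow> bool" where
  "nondegenerate \<omega> \<longleftrightarrow> (\<forall>x a. (\<forall>v. \<omega> x (case_nat a v) = 0) \<longrightarrow> a = 0)"

definition symplectic_form :: "'a::euclidean_space dform \<Rightarrow> bool" where
  "symplectic_form \<Omega> \<longleftrightarrow>
     is_form 2 \<Omega> \<and> ext_d 2 \<Omega> = (\<lambda>x v. 0) \<and> nondegenerate \<Omega>"

definition hamiltonian_vf :: "'a::euclidean_space dform \<Rightarrow> ('a \<Rightarrow> 'a) \<Rightarrow> ('a \<Rightarrow> real) \<Rightarrow> bool" where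
  "hamiltonian_vf \<Omega> X h \<longleftrightarrow> contract X \<Omega> = ext_d 0 (form0 h)"

text \<open>A smooth coordinate system on \<open>U\<close>: a diffeomorphism of \<open>U\<close> onto an open set.\<close>

definition coordinates_on ::
    "'a::euclidean_space set \<Rightarrow> ('a \<Rightarrow> 'b::euclidean_space) \<Rightarrow> bool" where
  "coordinates_on U \<phi> \<longleftrightarrow> open U \<and> open (\<phi> ` U) \<and> inj_on \<phi> U \<and>
     smooth_on U \<phi> \<and> smooth_on (\<phi> ` U) (inv_into U \<phi>)"


section \<open>Vector calculus on space-time\<close>

text \<open>Without the parentheses, \<open>real^3\<close> would bind weaker than the product.\<close>

type_synonym spacetime = "real \<times> (real^3)"

definition partial_t :: "(spacetime \<Rightarrow> 'b::real_normed_vector) \<Rightarrow> spacetime \<Rightarrow> 'b" where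
  "partial_t f x = frechet_derivative f (at x) (1, 0)"

definition partial_x :: "3 \<Rightarrow> (spacetime \<Rightarrow> 'b::real_normed_vector) \<Rightarrow> spacetime \<Rightarrow> 'b" where
  "partial_x i f x = frechet_derivative f (at x) (0, axis i 1)"

definition grad :: "(spacetime \<Rightarrow> real) \<Rightarrow> spacetime \<Rightarrow> real^3" where
  "grad f x = (\<chi> i. partial_x i f x)"

definition divergence :: "(spacetime \<Rightarrow> real^3) \<Rightarrow> spacetime \<Rightarrow> real" where
  "divergence V x = (\<Sum>i\<in>UNIV. partial_x i (\<lambda>y. V y $ i) x)"

definition curl :: "(spacetime \<Rightarrow> real^3) \<Rightarrow> spacetime \<Rightarrow> real^3" where
  "curl V x = vector
     [partial_x 2 (\<lambda>y. V y $ 3) x - partial_x 3 (\<lambda>y. V y $ 2) x,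
      partial_x 3 (\<lambda>y. V y $ 1) x - partial_x 1 (\<lambda>y. V y $ 3) x,
      partial_x 1 (\<lambda>y. V y $ 2) x - partial_x 2 (\<lambda>y. V y $ 1) x]"

text \<open>\<open>convect u f\<close> is \<open>(u \<sqdot> \<nabla>) f\<close>, for scalar and for vector-valued \<open>f\<close>.\<close>

definition convect ::
    "(spacetime \<Rightarrow> real^3) \<Rightarrow> (spacetime \<Rightarrow> 'b::real_normed_vector) \<Rightarrow> spacetime \<Rightarrow> 'b" where
  "convect u f x = (\<Sum>i\<in>UNIV. (u x $ i) *\<^sub>R partial_x i f x)"

definition dt :: "spacetime dform" where
  "dt = ext_d 0 (form0 fst)"

definition dx :: "3 \<Rightarrow> spacetime dform" where
  "dx i = ext_d 0 (form0 (\<lambda>x. snd x $ i))"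

definition dot_dx :: "(spacetime \<Rightarrow> real^3) \<Rightarrow> spacetime dform" where
  "dot_dx V = (\<lambda>x v. V x $ 1 * dx 1 x v + V x $ 2 * dx 2 x v + V x $ 3 * dx 3 x v)"

definition dot_dxdx :: "(spacetime \<Rightarrow> real^3) \<Rightarrow> spacetime dform" where
  "dot_dxdx V = (\<lambda>x v. V x $ 1 * wedge 1 1 (dx 2) (dx 3) x v
                     + V x $ 2 * wedge 1 1 (dx 3) (dx 1) x v
                     + V x $ 3 * wedge 1 1 (dx 1) (dx 2) x v)"

text \<open>\<open>dx \<and> dy \<and> dz \<and> dt\<close>\<close>

definition volume_form :: "spacetime dform" where
  "volume_form = wedge 3 1 (wedge 2 1 (wedge 1 1 (dx 1) (dx 2)) (dx 3)) dt"

text \<open>The vector field \<open>\<partial>\<^sub>t + u \<sqdot> \<nabla>\<close>.\<close>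

definition suspension :: "(spacetime \<Rightarrow> real^3) \<Rightarrow> spacetime \<Rightarrow> spacetime" where
  "suspension u x = (1, u x)"


section \<open>The symplectic structure of the Euler flow\<close>

definition euler_incompressible ::
    "(spacetime \<Rightarrow> real^3) \<Rightarrow> (spacetime \<Rightarrow> real) \<Rightarrow> (spacetime \<Rightarrow> real) \<Rightarrow> bool" where
  "euler_incompressible u P \<rho> \<longleftrightarrow>
     (\<forall>x. partial_t u x + convect u u x = - grad (\<lambda>y. (1 / \<rho> y) * P y) x \<and> divergence u x = 0)"

definition Omega_e :: "(spacetime \<Rightarrow> real^3) \<Rightarrow> (spacetime \<Rightarrow> real) \<Rightarrow> spacetime dform" where
  "Omega_e u h = (\<lambda>x v.
     - wedge 1 1 (dot_dx (\<lambda>y. grad h y + cross3 (u y) (curl u y))) dt x v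
     + dot_dxdx (curl u) x v)"

definition potential_vorticity ::
    "(spacetime \<Rightarrow> real^3) \<Rightarrow> (spacetime \<Rightarrow> real) \<Rightarrow> spacetime \<Rightarrow> real" where
  "potential_vorticity u h x = - (curl u x \<bullet> grad h x)"

definition psi_e ::
    "(spacetime \<Rightarrow> real^3) \<Rightarrow> (spacetime \<Rightarrow> real) \<Rightarrow> (spacetime \<Rightarrow> real) \<Rightarrow> (spacetime \<Rightarrow> real)
      \<Rightarrow> spacetime \<Rightarrow> real" where
  "psi_e u P \<rho> h x = - (h x + (1 / \<rho> x) * P x + 1/2 * (norm (u x))\<^sup>2)"

definition theta_e ::
    "(spacetime \<Rightarrow> real^3) \<Rightarrow> (spacetime \<Rightarrow> real) \<Rightarrow> (spacetime \<Rightarrow> real) \<Rightarrow> (spacetime \<Rightarrow> real)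
      \<Rightarrow> spacetime dform" where
  "theta_e u P \<rho> h = (\<lambda>x v. - (psi_e u P \<rho> h x * dt x v + dot_dx u x v))"

text \<open>Darboux coordinates \<open>(q, p, t, h\<^sub>c\<^sub>a\<^sub>n)\<close> on \<open>U\<close>; the coordinate \<open>t\<close> is the given time.\<close>

definition darboux_coordinates ::
    "spacetime dform \<Rightarrow> spacetime set \<Rightarrow> (spacetime \<Rightarrow> real) \<Rightarrow> (spacetime \<Rightarrow> real)
      \<Rightarrow> (spacetime \<Rightarrow> real) \<Rightarrow> bool" where
  "darboux_coordinates \<Omega> U q p hcan \<longleftrightarrow>
     coordinates_on U (\<lambda>x. (q x, p x, fst x, hcan x)) \<and>
     (\<forall>x\<in>U. \<forall>v. \<Omega> x v = wedge 1 1 (ext_d 0 (form0 p)) (ext_d 0 (form0 q)) x v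
                        + wedge 1 1 (ext_d 0 (form0 hcan)) dt x v)"

definition theta_can ::
    "(spacetime \<Rightarrow> real) \<Rightarrow> (spacetime \<Rightarrow> real) \<Rightarrow> (spacetime \<Rightarrow> real) \<Rightarrow> spacetime dform" where
  "theta_can q p hcan = (\<lambda>x v. - (p x * ext_d 0 (form0 q) x v + hcan x * dt x v))"

definition generating_function ::
    "spacetime set \<Rightarrow> spacetime dform \<Rightarrow> spacetime dform \<Rightarrow> (spacetime \<Rightarrow> real) \<Rightarrow> bool" where
  "generating_function U \<theta>' \<theta> s \<longleftrightarrow>
     smooth_on U s \<and> (\<forall>x\<in>U. \<forall>v. ext_d 0 (form0 s) x v = \<theta>' x v - \<theta> x v)"

end

theory Submission
  imports Defs
begin

text \<open>
  The Euler equation in the form \<open>\<partial>\<^sub>t u - u \<times> w = - \<nabla>(P/\<rho> + |u|\<^sup>2/2)\<close> says that \<open>\<Omega>\<^sub>e\<close> is the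
  exterior derivative of \<open>\<psi>\<^sub>e dt + u \<sqdot> dx\<close>; closedness follows, and nondegeneracy, the contraction
  with \<open>\<partial>\<^sub>t + u\<close> and the Liouville density are vector algebra.

  For Darboux coordinates take \<open>h\<^sub>c\<^sub>a\<^sub>n = -h\<close>. The closed form \<open>\<Omega>\<^sub>e + dh \<and> dt\<close> is annihilated by
  \<open>\<partial>\<^sub>t + u\<close> and by \<open>w\<close>, hence invariant under both flows. Applying the two flows to a surface transversal
  to them gives local coordinates \<open>(s, r, y)\<close> in which the form is \<open>g(y) dy\<^sub>1 \<and> dy\<^sub>2\<close>; with
  \<open>\<partial>p/\<partial>y\<^sub>1 = g\<close> and \<open>q = y\<^sub>2\<close> it becomes \<open>dp \<and> dq\<close>. Commutation of the two flows is not needed, since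
  a tangent vector to a flow line is always in the kernel of the form. Nondegeneracy of \<open>\<Omega>\<^sub>e\<close> makes
  \<open>(q, p, t, -h)\<close> a local diffeomorphism.

  In Darboux coordinates \<open>\<theta>\<^sub>c\<^sub>a\<^sub>n - \<theta>\<^sub>e\<close> is closed, so it has a potential \<open>s\<close> on a simply connected
  domain, and the spatial components of \<open>ds = \<theta>\<^sub>c\<^sub>a\<^sub>n - \<theta>\<^sub>e\<close> are the Clebsch representation.
\<close>

section \<open>Parametric smoothness and symmetry of second derivatives\<close>

text \<open>\<open>Ck_on\<close> differentiates in one fixed direction at a time, and every
  smoothness claim has to be brought to that form. Chain rules are therefore expanded in a basis,
  and a flow, an inverse map or a parameter integral is shown smooth by induction on the order, its
  derivative being given by data of the same kind. For flows this is the linearised integral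
  equation, which keeps the contraction constant of the original one, so that no estimate
  deteriorates with the order. The kernel field pair leaves a plane of transversal coordinates in
  the four-dimensional space-time, and on a plane every two-form is a multiple of the area form. The
  condition that \<open>w\<close> is transversal to the level sets of \<open>h\<close> makes
  \<open>dt\<close> and \<open>dh\<close> independent on that kernel; the number in question is, up
  to sign, the Pfaffian of \<open>Omega_e\<close>. For the generating function the domain is merely
  simply connected. The paths and homotopies it provides are only continuous, so line integrals are
  replaced by sums over fine inscribed polygons, evaluated through primitives on small
  balls.\<close>

abbreviation fderiv ("\<D>") where "\<D> f x \<equiv> frechet_derivative f (at x)"

text \<open>\<open>k p\<close> is \<open>C\<^sup>n\<close> on \<open>S\<close> for each parameter \<open>p \<in> I\<close>, with derivatives jointly continuous in
  parameter and argument; the parameter is the time of an ODE, in which no derivatives are taken.\<close>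

primrec Ck_param :: "nat \<Rightarrow> 'p::topological_space set \<Rightarrow> 'a::real_normed_vector set \<Rightarrow>
    ('p \<Rightarrow> 'a \<Rightarrow> 'b::real_normed_vector) \<Rightarrow> bool" where
  "Ck_param 0 I S k \<longleftrightarrow> continuous_on (I \<times> S) (\<lambda>z. k (fst z) (snd z))"
| "Ck_param (Suc n) I S k \<longleftrightarrow> continuous_on (I \<times> S) (\<lambda>z. k (fst z) (snd z)) \<and>
     (\<forall>p\<in>I. \<forall>x\<in>S. k p differentiable (at x)) \<and>
     (\<forall>v. Ck_param n I S (\<lambda>p x. \<D> (k p) x v))"

lemma Ck_param_continuous: "Ck_param n I S k \<Longrightarrow> continuous_on (I \<times> S) (\<lambda>z. k (fst z) (snd z))"
  by (cases n) auto

lemma frechet_derivative_cong_open: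
  assumes "open S" "x \<in> S" "\<And>y. y \<in> S \<Longrightarrow> f y = g y"
  shows "\<D> f x = \<D> g x"
proof -
  \<comment> \<open>\<open>frechet_derivative\<close> is a choice among the derivatives, so
    equivalent \<open>has_derivative\<close> predicates yield the same choice, even where no
    derivative exists.\<close>
  have "\<And>D. (f has_derivative D) (at x) \<longleftrightarrow> (g has_derivative D) (at x)"
    using assms has_derivative_transform_within_open[of f _ x UNIV S g]
      has_derivative_transform_within_open[of g _ x UNIV S f] by auto
  then show ?thesis
    unfolding frechet_derivative_def by simp
qed

lemma differentiable_cong_open:
  assumes "open S" "x \<in> S" "\<And>y. y \<in> S \<Longrightarrow> f y = g y" "f differentiable (at x)"
  shows "g differentiable (at x)"
  using assms has_derivative_transform_within_open[of f _ x UNIV S g]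
  unfolding differentiable_def by blast

lemma Ck_param_cong:
  assumes "open S" "\<And>p x. p \<in> I \<Longrightarrow> x \<in> S \<Longrightarrow> k p x = l p x" "Ck_param n I S k"
  shows "Ck_param n I S l"
  using assms(2,3)
proof (induction n arbitrary: k l)
  case 0
  then show ?case
    by (auto elim!: continuous_on_eq)
next
  case (Suc n)
  have "continuous_on (I \<times> S) (\<lambda>z. l (fst z) (snd z))"
    using Suc.prems by (auto elim!: continuous_on_eq)
  moreover have "l p differentiable (at x)" if "p \<in> I" "x \<in> S" for p x
    using Suc.prems that differentiable_cong_open[OF assms(1) that(2), of "k p" "l p"] by auto
  moreover have "Ck_param n I S (\<lambda>p x. \<D> (l p) x v)" for v
    apply (rule Suc.IH[of "\<lambda>p x. \<D> (k p) x v"])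
    subgoal for p x
      using frechet_derivative_cong_open[OF assms(1), of x "k p" "l p"] Suc.prems(1) by simp
    subgoal using Suc.prems by auto
    done
  ultimately show ?case by auto
qed

lemma Ck_param_Suc_imp: "Ck_param (Suc n) I S k \<Longrightarrow> Ck_param n I S k"
proof (induction n arbitrary: k)
  case (Suc n)
  show ?case
    unfolding Ck_param.simps(2)[of n]
    using Suc.prems Suc.IH unfolding Ck_param.simps(2)[of "Suc n"] by blast
qed simp

text \<open>Inductions can exhibit the derivative by a formula \<open>D\<close>: uniqueness
  identifies it with \<open>\<D>\<close> on \<open>S\<close>, and openness of \<open>S\<close>
  carries the agreement to the higher derivatives.\<close>

lemma Ck_param_SucI:
  assumes "open S" and "continuous_on (I \<times> S) (\<lambda>z. k (fst z) (snd z))"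
    and D: "\<And>p x. p \<in> I \<Longrightarrow> x \<in> S \<Longrightarrow> (k p has_derivative D p x) (at x)"
    and "\<And>v. Ck_param n I S (\<lambda>p x. D p x v)"
  shows "Ck_param (Suc n) I S k"
proof -
  have "Ck_param n I S (\<lambda>p x. \<D> (k p) x v)" for v
  proof (rule Ck_param_cong[OF assms(1)])
    show "D p x v = \<D> (k p) x v" if "p \<in> I" "x \<in> S" for p x
      using frechet_derivative_at[OF D[OF that]] by simp
  qed (rule assms(4))
  then show ?thesis
    using assms(2) D by (auto simp: differentiable_def)
qed

lemma Ck_param_SucD:
  assumes "Ck_param (Suc n) I S k"
  shows "\<And>p x. p \<in> I \<Longrightarrow> x \<in> S \<Longrightarrow>
      (k p has_derivative \<D> (k p) x) (at x)"
    and "\<And>v. Ck_param n I S (\<lambda>p x. \<D> (k p) x v)"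
  using assms by (auto simp: frechet_derivative_works)

lemma Ck_param_const:
  assumes "open S" "continuous_on I c"
  shows "Ck_param n I S (\<lambda>p x. c p)"
  using assms(2)
proof (induction n arbitrary: c)
  case 0
  then show ?case
    by (auto intro!: continuous_intros continuous_on_compose2[of I c])
next
  case (Suc n)
  show ?case
    by (rule Ck_param_SucI[OF assms(1), where D = "\<lambda>p x v. 0"])
       (use Suc in \<open>auto intro!: continuous_on_compose2[of I c] continuous_intros\<close>)
qed

lemma Ck_param_bounded_linear:
  assumes S: "open S" and "bounded_linear L" and "Ck_param n I S k"
  shows "Ck_param n I S (\<lambda>p x. L (k p x))"
  using assms(3)
proof (induction n arbitrary: k)
  case 0
  then show ?case
    by (auto intro!: bounded_linear.continuous_on[OF assms(2)])
next
  case (Suc n)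
  note D = Ck_param_SucD[OF Suc.prems]
  show ?case
    by (rule Ck_param_SucI[OF S, where D = "\<lambda>p x v. L (\<D> (k p) x v)"])
      (auto intro!: bounded_linear.continuous_on[OF assms(2)] Ck_param_continuous[OF Suc.prems]
        bounded_linear.has_derivative[OF assms(2)] D(1) Suc.IH D(2))
qed

lemma Ck_param_add:
  assumes S: "open S" and "Ck_param n I S k" "Ck_param n I S l"
  shows "Ck_param n I S (\<lambda>p x. k p x + l p x)"
  using assms(2,3)
proof (induction n arbitrary: k l)
  case 0
  then show ?case
    by (auto intro!: continuous_intros)
next
  case (Suc n)
  note D = Ck_param_SucD[OF Suc.prems(1)] and E = Ck_param_SucD[OF Suc.prems(2)]
  show ?case
    by (rule Ck_param_SucI[OF S, where D = "\<lambda>p x v. \<D> (k p) x v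
          + \<D> (l p) x v"])
      (auto intro!: continuous_on_add Ck_param_continuous[OF Suc.prems(1)] Ck_param_continuous[OF Suc.prems(2)]
        has_derivative_add D E Suc.IH)
qed

lemma Ck_param_bilinear:
  assumes S: "open S" and B: "bounded_bilinear B" and "Ck_param n I S k" "Ck_param n I S l"
  shows "Ck_param n I S (\<lambda>p x. B (k p x) (l p x))"
  using assms(3,4)
proof (induction n arbitrary: k l)
  case 0
  then show ?case
    by (auto intro!: bounded_bilinear.continuous_on[OF B])
next
  case (Suc n)
  note D = Ck_param_SucD[OF Suc.prems(1)] and E = Ck_param_SucD[OF Suc.prems(2)]
  show ?case
  proof (rule Ck_param_SucI[OF S, where D = "\<lambda>p x v. B (k p x) (\<D> (l p) x v)
          + B (\<D> (k p) x v) (l p x)"])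
    show "continuous_on (I \<times> S) (\<lambda>z. B (k (fst z) (snd z)) (l (fst z) (snd z)))"
      by (intro bounded_bilinear.continuous_on[OF B] Ck_param_continuous[OF Suc.prems(1)]
          Ck_param_continuous[OF Suc.prems(2)])
    show "((\<lambda>x. B (k p x) (l p x)) has_derivative (\<lambda>v. B (k p x) (\<D> (l p) x v)
          + B (\<D> (k p) x v) (l p x))) (at x)" if "p \<in> I" "x \<in> S" for p x
      by (rule bounded_bilinear.FDERIV[OF B D(1)[OF that] E(1)[OF that]])
    show "Ck_param n I S (\<lambda>p x. B (k p x) (\<D> (l p) x v)
          + B (\<D> (k p) x v) (l p x))" for v
      by (intro Ck_param_add[OF S] Suc.IH Ck_param_Suc_imp[OF Suc.prems(1)] Ck_param_Suc_imp[OF Suc.prems(2)] D E)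
  qed
qed

lemma Ck_param_sum:
  assumes S: "open S" and "\<And>i. i \<in> J \<Longrightarrow> Ck_param n I S (k i)"
  shows "Ck_param n I S (\<lambda>p x. \<Sum>i\<in>J. k i p x)"
  using assms(2)
proof (induction J rule: infinite_finite_induct)
  case (insert i J)
  then show ?case by (auto intro!: Ck_param_add[OF S])
qed (auto intro!: Ck_param_const[OF S])

lemma Ck_param_Pair:
  assumes S: "open S" and "Ck_param n I S k" "Ck_param n I S l"
  shows "Ck_param n I S (\<lambda>p x. (k p x, l p x))"
proof -
  have "Ck_param n I S (\<lambda>p x. (k p x, 0) + (0, l p x))"
    by (intro Ck_param_add[OF S] Ck_param_bounded_linear[OF S, of "\<lambda>y. (y, 0)"] assms
        Ck_param_bounded_linear[OF S, of "\<lambda>y. (0, y)"] bounded_linear_intros)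
  then show ?thesis by simp
qed

lemma continuous_on_param_compose:
  assumes "continuous_on (I \<times> T) (\<lambda>z. F (fst z) (snd z))"
    and "continuous_on (I \<times> S) (\<lambda>z. k (fst z) (snd z))"
    and "\<And>p x. p \<in> I \<Longrightarrow> x \<in> S \<Longrightarrow> k p x \<in> T"
  shows "continuous_on (I \<times> S) (\<lambda>z. F (fst z) (k (fst z) (snd z)))"
proof -
  have "continuous_on (I \<times> S) (\<lambda>z. (fst z, k (fst z) (snd z)))"
    by (intro continuous_intros assms(2))
  from continuous_on_compose2[OF assms(1) this] assms(3) show ?thesis by fastforce
qed

lemma linear_eq_sum_Basis:
  assumes "linear f"
  shows "f w = (\<Sum>i\<in>Basis. (w \<bullet> i) *\<^sub>R f i)"
proof -
  have "f w = f (\<Sum>i\<in>Basis. (w \<bullet> i) *\<^sub>R i)" by (simp add: euclidean_representation)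
  then show ?thesis by (simp add: linear_sum[OF assms] linear_cmul[OF assms])
qed

text \<open>The chain rule evaluates \<open>\<D> (F p)\<close> in a direction that moves with the
  point, whereas \<open>Ck_param\<close> controls fixed directions. Expanding the moving direction
  in a basis reduces the step to products of functions covered by the induction hypothesis.\<close>

lemma Ck_param_compose:
  fixes F :: "'p::topological_space \<Rightarrow> 'b::euclidean_space \<Rightarrow> 'c::real_normed_vector"
  assumes S: "open S" and T: "open T"
    and "Ck_param n I T F" "Ck_param n I S k" and kT: "\<And>p x. p \<in> I \<Longrightarrow> x \<in> S \<Longrightarrow> k p x \<in> T"
  shows "Ck_param n I S (\<lambda>p x. F p (k p x))"
  using assms(3,4)
proof (induction n arbitrary: F)
  case 0
  then show ?case
    using continuous_on_param_compose[of I T F S k] kT by simp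
next
  case (Suc n)
  note D = Ck_param_SucD[OF Suc.prems(1)] and E = Ck_param_SucD[OF Suc.prems(2)]
  show ?case
  proof (rule Ck_param_SucI[OF S, where D = "\<lambda>p x v. \<Sum>i\<in>Basis.
        (\<D> (k p) x v \<bullet> i) *\<^sub>R \<D> (F p) (k p x) i"])
    show "continuous_on (I \<times> S) (\<lambda>z. F (fst z) (k (fst z) (snd z)))"
      using kT Ck_param_continuous[OF Suc.prems(1)] Ck_param_continuous[OF Suc.prems(2)]
      by (intro continuous_on_param_compose[of I T F S k])
    show "((\<lambda>x. F p (k p x)) has_derivative (\<lambda>v. \<Sum>i\<in>Basis.
        (\<D> (k p) x v \<bullet> i) *\<^sub>R \<D> (F p) (k p x) i)) (at x)"
      if "p \<in> I" "x \<in> S" for p x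
    proof -
      have d: "(F p has_derivative \<D> (F p) (k p x)) (at (k p x))"
        by (rule D(1)[OF that(1) kT[OF that]])
      have "linear (\<D> (F p) (k p x))"
        using d by (rule has_derivative_linear)
      then have "\<D> (F p) (k p x) = (\<lambda>w.
          \<Sum>i\<in>Basis. (w \<bullet> i) *\<^sub>R \<D> (F p) (k p x) i)"
        by (intro ext linear_eq_sum_Basis)
      with d have "(F p has_derivative (\<lambda>w.
          \<Sum>i\<in>Basis. (w \<bullet> i) *\<^sub>R \<D> (F p) (k p x) i)) (at (k p x))"
        by metis
      from has_derivative_compose[OF E(1)[OF that] this] show ?thesis .
    qed
    show "Ck_param n I S (\<lambda>p x. \<Sum>i\<in>Basis.
        (\<D> (k p) x v \<bullet> i) *\<^sub>R \<D> (F p) (k p x) i)" for v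
      by (intro Ck_param_sum[OF S] Ck_param_bilinear[OF S bounded_bilinear_scaleR]
           Ck_param_bounded_linear[OF S bounded_linear_inner_left] E(2)
           Suc.IH[OF D(2) Ck_param_Suc_imp[OF Suc.prems(2)]])
  qed
qed

lemma Ck_param_linear_id:
  assumes S: "open S" and "bounded_linear L"
  shows "Ck_param n I S (\<lambda>p. L)"
proof (cases n)
  case 0
  then show ?thesis
    by (auto intro!: bounded_linear.continuous_on[OF assms(2)] continuous_intros)
next
  case (Suc m)
  show ?thesis unfolding Suc
    by (rule Ck_param_SucI[OF S, where D = "\<lambda>p x. L"])
      (auto intro!: bounded_linear.continuous_on[OF assms(2)] continuous_intros
         bounded_linear.has_derivative[OF assms(2)] has_derivative_ident Ck_param_const[OF S]
         bounded_linear_imp_has_derivative assms)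
qed

lemma continuous_on_snd_param:
  assumes "continuous_on S f"
  shows "continuous_on (I \<times> S) (\<lambda>z. f (snd z))"
  by (rule continuous_on_compose2[OF assms]) (auto intro!: continuous_intros)

lemma Ck_on_imp_Ck_param: "Ck_on n S f \<Longrightarrow> Ck_param n I S (\<lambda>p. f)"
proof (induction n arbitrary: f)
  case 0
  then show ?case by (simp add: continuous_on_snd_param)
next
  case (Suc n)
  have "continuous_on S f"
    using Suc.prems by (intro differentiable_imp_continuous_on)
      (simp add: differentiable_on_def differentiable_at_withinI)
  with Suc show ?case
    unfolding Ck_param.simps Ck_on.simps by (blast intro: continuous_on_snd_param)
qed

lemma Ck_param_imp_Ck_on: "Ck_param n I S k \<Longrightarrow> p \<in> I \<Longrightarrow> Ck_on n S (k p)"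
proof (induction n arbitrary: k)
  case 0
  have "continuous_on S (\<lambda>x. (\<lambda>z. k (fst z) (snd z)) (p, x))"
    by (rule continuous_on_compose2[OF 0(1)[unfolded Ck_param.simps]])
      (use 0(2) in \<open>auto intro!: continuous_intros\<close>)
  then show ?case by simp
next
  case (Suc n)
  have "Ck_on n S (\<lambda>x. \<D> (k p) x v)" for v
    using Suc.IH[of "\<lambda>p x. \<D> (k p) x v"] Suc.prems by simp
  then show ?case
    using Suc.prems by simp
qed

text \<open>A one-point parameter set specialises the closure properties of \<open>Ck_param\<close>
  to smooth functions; the point \<open>0::real\<close> is arbitrary.\<close>

lemma smooth_on_iff: "smooth_on S f \<longleftrightarrow> (\<forall>n. Ck_param n {0::real} S (\<lambda>p. f))"
  unfolding smooth_on_def using Ck_on_imp_Ck_param[of _ S f] Ck_param_imp_Ck_on[of _ "{0::real}" S "\<lambda>p. f" 0] by auto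

lemma smooth_on_imp_Ck_param: "smooth_on S f \<Longrightarrow> Ck_param n I S (\<lambda>p. f)"
  unfolding smooth_on_def using Ck_on_imp_Ck_param[of n S f] by auto

lemma smooth_on_cong:
  "open S \<Longrightarrow> smooth_on S f \<Longrightarrow> (\<And>x. x \<in> S \<Longrightarrow> f x = g x) \<Longrightarrow> smooth_on S g"
  unfolding smooth_on_iff using Ck_param_cong[of S "{0}" "\<lambda>p. f" "\<lambda>p. g"] by auto

lemma Ck_on_subset: "Ck_on n S f \<Longrightarrow> T \<subseteq> S \<Longrightarrow> Ck_on n T f"
proof (induction n arbitrary: f)
  case (Suc n)
  then show ?case unfolding Ck_on.simps by blast
qed (auto intro: continuous_on_subset)

lemma smooth_on_subset: "smooth_on S f \<Longrightarrow> T \<subseteq> S \<Longrightarrow> smooth_on T f"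
  unfolding smooth_on_def using Ck_on_subset by blast

lemma smooth_on_const: "open S \<Longrightarrow> smooth_on S (\<lambda>x. c)"
  unfolding smooth_on_iff by (simp add: Ck_param_const)

lemma smooth_on_bounded_linear: "open S \<Longrightarrow> bounded_linear L \<Longrightarrow> smooth_on S f \<Longrightarrow> smooth_on S (\<lambda>x. L (f x))"
  unfolding smooth_on_iff by (simp add: Ck_param_bounded_linear[where k = "\<lambda>p. f"])

lemma smooth_on_ident: "open S \<Longrightarrow> smooth_on S (\<lambda>x. x)"
  unfolding smooth_on_iff by (simp add: Ck_param_linear_id)

lemma smooth_on_bilinear:
  "open S \<Longrightarrow> bounded_bilinear B \<Longrightarrow> smooth_on S f \<Longrightarrow> smooth_on S g \<Longrightarrow> smooth_on S (\<lambda>x. B (f x) (g x))"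
  unfolding smooth_on_iff by (simp add: Ck_param_bilinear[where k = "\<lambda>p. f" and l = "\<lambda>p. g"])

lemma smooth_on_add: "open S \<Longrightarrow> smooth_on S f \<Longrightarrow> smooth_on S g \<Longrightarrow> smooth_on S (\<lambda>x. f x + g x)"
  unfolding smooth_on_iff by (simp add: Ck_param_add[where k = "\<lambda>p. f" and l = "\<lambda>p. g"])

lemma smooth_on_minus: "open S \<Longrightarrow> smooth_on S f \<Longrightarrow> smooth_on S (\<lambda>x. - f x)"
  using smooth_on_bounded_linear[OF _ bounded_linear_minus[OF bounded_linear_ident]] by blast

lemma smooth_on_diff: "open S \<Longrightarrow> smooth_on S f \<Longrightarrow> smooth_on S g \<Longrightarrow> smooth_on S (\<lambda>x. f x - g x)"
  using smooth_on_add[of S f "\<lambda>x. - g x"] smooth_on_minus[of S g] by simp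

lemma smooth_on_sum:
  "open S \<Longrightarrow> (\<And>i. i \<in> J \<Longrightarrow> smooth_on S (f i)) \<Longrightarrow> smooth_on S (\<lambda>x. \<Sum>i\<in>J. f i x)"
  unfolding smooth_on_iff by (simp add: Ck_param_sum[where k = "\<lambda>i p. f i"])

lemma smooth_on_Pair: "open S \<Longrightarrow> smooth_on S f \<Longrightarrow> smooth_on S g \<Longrightarrow> smooth_on S (\<lambda>x. (f x, g x))"
  unfolding smooth_on_iff by (simp add: Ck_param_Pair[where k = "\<lambda>p. f" and l = "\<lambda>p. g"])

lemma smooth_on_compose:
  fixes f :: "'b::euclidean_space \<Rightarrow> 'c::real_normed_vector"
  assumes "open S" "open T" "smooth_on T f" "smooth_on S g" "\<And>x. x \<in> S \<Longrightarrow> g x \<in> T"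
  shows "smooth_on S (\<lambda>x. f (g x))"
  using assms unfolding smooth_on_iff by (simp add: Ck_param_compose[where F = "\<lambda>p. f" and k = "\<lambda>p. g"])

lemma smooth_on_scaleR:
  "open S \<Longrightarrow> smooth_on S f \<Longrightarrow> smooth_on S g \<Longrightarrow> smooth_on S (\<lambda>x. f x *\<^sub>R g x)"
  by (rule smooth_on_bilinear[OF _ bounded_bilinear_scaleR])

lemma smooth_on_mult:
  fixes f g :: "_ \<Rightarrow> real"
  shows "open S \<Longrightarrow> smooth_on S f \<Longrightarrow> smooth_on S g \<Longrightarrow> smooth_on S (\<lambda>x. f x * g x)"
  by (rule smooth_on_bilinear[OF _ bounded_bilinear_mult])

lemma smooth_on_inner:
  "open S \<Longrightarrow> smooth_on S f \<Longrightarrow> smooth_on S g \<Longrightarrow> smooth_on S (\<lambda>x. f x \<bullet> g x)"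
  by (rule smooth_on_bilinear[OF _ bounded_bilinear_inner])

lemma smooth_on_fst: "open S \<Longrightarrow> smooth_on S f \<Longrightarrow> smooth_on S (\<lambda>x. fst (f x))"
  by (rule smooth_on_bounded_linear[OF _ bounded_linear_fst])

lemma smooth_on_snd: "open S \<Longrightarrow> smooth_on S f \<Longrightarrow> smooth_on S (\<lambda>x. snd (f x))"
  by (rule smooth_on_bounded_linear[OF _ bounded_linear_snd])

lemma smooth_on_vec_nth: "open S \<Longrightarrow> smooth_on S f \<Longrightarrow> smooth_on S (\<lambda>x. f x $ i)"
  by (rule smooth_on_bounded_linear[OF _ bounded_linear_vec_nth])

lemma smooth_on_frechet_derivative:
  "smooth_on S f \<Longrightarrow> smooth_on S (\<lambda>x. \<D> f x v)"
  using Ck_on.simps(2)[of _ S f] unfolding smooth_on_def by blast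

lemma smooth_on_has_derivative:
  "smooth_on S f \<Longrightarrow> x \<in> S \<Longrightarrow> (f has_derivative \<D> f x) (at x)"
  using Ck_on.simps(2)[of 0 S f] unfolding smooth_on_def frechet_derivative_works by blast

lemma smooth_on_continuous: "smooth_on S f \<Longrightarrow> continuous_on S f"
  using Ck_on.simps(1)[of S f] unfolding smooth_on_def by blast

lemma smooth_onI:
  assumes "open S" and D: "\<And>x. x \<in> S \<Longrightarrow> (f has_derivative D x) (at x)"
    and sm: "\<And>v. smooth_on S (\<lambda>x. D x v)"
  shows "smooth_on S f"
proof -
  have "continuous_on S f"
    by (rule has_derivative_continuous_on[where f' = D]) (rule has_derivative_at_withinI[OF D])
  then have c: "continuous_on ({0::real} \<times> S) (\<lambda>z. f (snd z))"
    by (rule continuous_on_snd_param)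
  have "Ck_param (Suc n) {0::real} S (\<lambda>p. f)" for n
    by (rule Ck_param_SucI[OF assms(1) c, where D = "\<lambda>p. D"])
      (use D sm in \<open>simp_all add: smooth_on_iff\<close>)
  then show ?thesis
    unfolding smooth_on_iff using Ck_param_Suc_imp[of _ "{0::real}" S "\<lambda>p. f"] by simp
qed

text \<open>The derivative is a product of copies of \<open>inverse\<close> and a constant, so class
  \<open>n\<close> of the function gives class \<open>n\<close> of its derivative.\<close>

lemma smooth_on_inverse: "smooth_on (- {0::real}) inverse"
proof -
  have op: "open (- {0::real})" by (simp add: open_Compl)
  have "Ck_param n {0::real} (- {0}) (\<lambda>_. inverse :: real \<Rightarrow> real)" for n
  proof (induction n)
    case 0
    have "continuous_on (- {0}) (inverse :: real \<Rightarrow> real)"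
      by (auto intro: continuous_intros)
    then show ?case by (simp add: continuous_on_snd_param)
  next
    case (Suc n)
    show ?case
    proof (rule Ck_param_SucI[OF op, where D = "\<lambda>p x v. - (inverse x * v * inverse x)"])
      show "continuous_on ({0::real} \<times> - {0}) (\<lambda>z. inverse (snd z :: real))"
        by (intro continuous_on_snd_param) (auto intro: continuous_intros)
      show "Ck_param n {0::real} (- {0}) (\<lambda>p x. - (inverse x * v * inverse x))" for v :: real
      proof -
        have c: "Ck_param n {0::real} (- {0::real}) (\<lambda>p x. v)"
          by (rule Ck_param_const[OF op]) simp
        note m = Ck_param_bilinear[OF op bounded_bilinear_mult]
        show ?thesis
          using Ck_param_bounded_linear[OF op bounded_linear_minus[OF bounded_linear_ident] m[OF m[OF Suc c] Suc]] .
      qed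
    qed (auto intro!: has_derivative_inverse')
  qed
  then show ?thesis unfolding smooth_on_iff by blast
qed

text \<open>Both second derivatives are limits of the same second difference quotient.\<close>

lemma second_difference:
  fixes f :: "'a::real_normed_vector \<Rightarrow> real"
  assumes U: "open U" and f: "\<And>y. y \<in> U \<Longrightarrow> (f has_derivative f' y) (at y)"
    and f': "\<And>y. y \<in> U \<Longrightarrow> ((\<lambda>y. f' y a) has_derivative f'' y) (at y)"
    and h: "h > 0" and sub: "\<And>s t. 0 \<le> s \<Longrightarrow> s \<le> h \<Longrightarrow> 0 \<le> t \<Longrightarrow> t \<le> h \<Longrightarrow> x + s *\<^sub>R a + t *\<^sub>R b \<in> U"
  shows "\<exists>s t. 0 \<le> s \<and> s \<le> h \<and> 0 \<le> t \<and> t \<le> h \<and>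
    f (x + h *\<^sub>R a + h *\<^sub>R b) - f (x + h *\<^sub>R a) - f (x + h *\<^sub>R b) + f x = h * h * f'' (x + s *\<^sub>R a + t *\<^sub>R b) b"
proof -
  have l: "((\<lambda>s. x + s *\<^sub>R a + t *\<^sub>R b) has_derivative (\<lambda>k. k *\<^sub>R a)) (at s)" for s t
    by (auto intro!: derivative_eq_intros)
  have 1: "((\<lambda>s. f (x + s *\<^sub>R a + t *\<^sub>R b)) has_derivative (\<lambda>k. f' (x + s *\<^sub>R a + t *\<^sub>R b) (k *\<^sub>R a))) (at s)"
    if "0 \<le> s" "s \<le> h" "0 \<le> t" "t \<le> h" for s t
    by (rule has_derivative_compose[OF l f[OF sub[OF that]]])
  \<comment> \<open>Mean value theorem in direction \<open>a\<close> for the increment in direction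
    \<open>b\<close>. The second use, below, treats the derivative along \<open>a\<close> as a
    function of the step in direction \<open>b\<close>.\<close>
  have "\<exists>s\<in>{0<..<h}. (f (x + h *\<^sub>R a + h *\<^sub>R b) - f (x + h *\<^sub>R a + 0 *\<^sub>R b)) -
     (f (x + 0 *\<^sub>R a + h *\<^sub>R b) - f (x + 0 *\<^sub>R a + 0 *\<^sub>R b))
      = (\<lambda>k. f' (x + s *\<^sub>R a + h *\<^sub>R b) (k *\<^sub>R a) - f' (x + s *\<^sub>R a + 0 *\<^sub>R b) (k *\<^sub>R a)) (h - 0)"
  proof (rule mvt_simple[OF h])
    fix s assume "0 \<le> s" "s \<le> h"
    then show "((\<lambda>s. f (x + s *\<^sub>R a + h *\<^sub>R b) - f (x + s *\<^sub>R a + 0 *\<^sub>R b)) has_derivative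
        (\<lambda>k. f' (x + s *\<^sub>R a + h *\<^sub>R b) (k *\<^sub>R a) - f' (x + s *\<^sub>R a + 0 *\<^sub>R b) (k *\<^sub>R a)))
        (at s within {0..h})"
      using h by (intro has_derivative_at_withinI[OF has_derivative_diff[OF 1 1]]) simp_all
  qed
  then obtain s where s: "0 < s" "s < h" and
    e1: "f (x + h *\<^sub>R a + h *\<^sub>R b) - f (x + h *\<^sub>R a) - f (x + h *\<^sub>R b) + f x
      = f' (x + s *\<^sub>R a + h *\<^sub>R b) (h *\<^sub>R a) - f' (x + s *\<^sub>R a) (h *\<^sub>R a)" by auto
  have lin: "f' y (h *\<^sub>R a) = h * f' y a" if "y \<in> U" for y
    using bounded_linear.linear[OF has_derivative_bounded_linear[OF f[OF that]]]
    by (simp add: linear_cmul)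
  have l2: "((\<lambda>t. x + s *\<^sub>R a + t *\<^sub>R b) has_derivative (\<lambda>k. k *\<^sub>R b)) (at t)" for t
    by (auto intro!: derivative_eq_intros)
  have 2: "((\<lambda>t. f' (x + s *\<^sub>R a + t *\<^sub>R b) a) has_derivative (\<lambda>k. f'' (x + s *\<^sub>R a + t *\<^sub>R b) (k *\<^sub>R b))) (at t)"
    if "0 \<le> t" "t \<le> h" for t
    using has_derivative_compose[OF l2 f'[OF sub]] s that by simp
  have "\<exists>t\<in>{0<..<h}. f' (x + s *\<^sub>R a + h *\<^sub>R b) a - f' (x + s *\<^sub>R a + 0 *\<^sub>R b) a
      = (\<lambda>k. f'' (x + s *\<^sub>R a + t *\<^sub>R b) (k *\<^sub>R b)) (h - 0)"
    by (rule mvt_simple[OF h]) (rule has_derivative_at_withinI[OF 2])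
  then obtain t where t: "0 < t" "t < h" and
    e2: "f' (x + s *\<^sub>R a + h *\<^sub>R b) a - f' (x + s *\<^sub>R a) a = f'' (x + s *\<^sub>R a + t *\<^sub>R b) (h *\<^sub>R b)" by auto
  have "x + s *\<^sub>R a + t *\<^sub>R b \<in> U" using s t sub by auto
  then have lin2: "f'' (x + s *\<^sub>R a + t *\<^sub>R b) (h *\<^sub>R b) = h * f'' (x + s *\<^sub>R a + t *\<^sub>R b) b"
    using bounded_linear.linear[OF has_derivative_bounded_linear[OF f']]
    by (simp add: linear_cmul)
  have "x + s *\<^sub>R a + h *\<^sub>R b \<in> U" "x + s *\<^sub>R a \<in> U" using s h sub[of s h] sub[of s 0] by auto
  then have "f (x + h *\<^sub>R a + h *\<^sub>R b) - f (x + h *\<^sub>R a) - f (x + h *\<^sub>R b) + f x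
      = h * (f' (x + s *\<^sub>R a + h *\<^sub>R b) a - f' (x + s *\<^sub>R a) a)"
    unfolding e1 by (simp add: lin algebra_simps)
  also have "\<dots> = h * h * f'' (x + s *\<^sub>R a + t *\<^sub>R b) b" unfolding e2 lin2 by simp
  finally show ?thesis using s t by (intro exI[of _ s] exI[of _ t]) auto
qed

text \<open>If the mixed derivatives differed at \<open>x\<close> by \<open>2 * e\<close>,
  continuity would confine each to its own interval of radius \<open>e\<close> on a small ball.
  \<open>second_difference\<close>, used with \<open>a\<close> and \<open>b\<close> in both orders,
  equates a value of one with a value of the other inside that ball.\<close>

lemma frechet_derivative_commute:
  fixes f :: "'a::real_normed_vector \<Rightarrow> real"
  assumes S: "open S" "x \<in> S" and f: "smooth_on S f"
  shows "\<D> (\<lambda>y. \<D> f y a) x b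
       = \<D> (\<lambda>y. \<D> f y b) x a"
proof (rule ccontr)
  let ?A = "\<lambda>x. \<D> (\<lambda>y. \<D> f y a) x b"
  let ?B = "\<lambda>x. \<D> (\<lambda>y. \<D> f y b) x a"
  assume ne: "?A x \<noteq> ?B x"
  define e where "e = \<bar>?A x - ?B x\<bar> / 2"
  have e: "e > 0" using ne by (simp add: e_def)
  have cA: "continuous_on S ?A" and cB: "continuous_on S ?B"
    by (auto intro!: smooth_on_continuous smooth_on_frechet_derivative f)
  obtain d1 where d1: "d1 > 0" "\<And>y. y \<in> S \<Longrightarrow> dist y x < d1 \<Longrightarrow> dist (?A y) (?A x) < e"
    using cA S(2) e unfolding continuous_on_iff by metis
  obtain d2 where d2: "d2 > 0" "\<And>y. y \<in> S \<Longrightarrow> dist y x < d2 \<Longrightarrow> dist (?B y) (?B x) < e"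
    using cB S(2) e unfolding continuous_on_iff by metis
  obtain d3 where d3: "d3 > 0" "ball x d3 \<subseteq> S"
    using S open_contains_ball by blast
  \<comment> \<open>The parallelogram with sides \<open>h a\<close> and \<open>h b\<close> stays
    within half of the smallest radius; the summand \<open>1\<close> keeps the denominator positive
    when both vectors vanish.\<close>
  define h where "h = min d1 (min d2 d3) / (2 * (norm a + norm b + 1))"
  have pos: "norm a + norm b + 1 > 0" by (smt (verit) norm_ge_zero)
  have h: "h > 0" using d1 d2 d3 pos by (auto simp: h_def)
  have close: "dist (x + s *\<^sub>R a + t *\<^sub>R b) x < min d1 (min d2 d3)"
    if "0 \<le> s" "s \<le> h" "0 \<le> t" "t \<le> h" for s t
  proof -
    have "dist (x + s *\<^sub>R a + t *\<^sub>R b) x \<le> s * norm a + t * norm b"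
      using that norm_triangle_ineq[of "s *\<^sub>R a" "t *\<^sub>R b"] by (simp add: dist_norm add.assoc)
    also have "\<dots> \<le> h * norm a + h * norm b"
      using that by (intro add_mono mult_right_mono) auto
    also have "\<dots> \<le> h * (norm a + norm b + 1)" using h by (simp add: algebra_simps)
    also have "\<dots> = min d1 (min d2 d3) / 2" using pos unfolding h_def by (simp add: field_simps)
    also have "\<dots> < min d1 (min d2 d3)"
    proof -
      have "min d1 (min d2 d3) > 0" using d1(1) d2(1) d3(1) by simp
      then show ?thesis by linarith
    qed
    finally show ?thesis .
  qed
  have inS: "x + s *\<^sub>R a + t *\<^sub>R b \<in> S" if "0 \<le> s" "s \<le> h" "0 \<le> t" "t \<le> h" for s t
    using close[OF that] d3 by (auto simp: dist_commute subset_iff)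
  obtain s t where st: "0 \<le> s" "s \<le> h" "0 \<le> t" "t \<le> h" and
    e1: "f (x + h *\<^sub>R a + h *\<^sub>R b) - f (x + h *\<^sub>R a) - f (x + h *\<^sub>R b) + f x = h * h * ?A (x + s *\<^sub>R a + t *\<^sub>R b)"
    using second_difference[OF S(1) smooth_on_has_derivative[OF f]
        smooth_on_has_derivative[OF smooth_on_frechet_derivative[OF f]] h inS] by blast
  have inS': "x + t *\<^sub>R b + s *\<^sub>R a \<in> S" if "0 \<le> t" "t \<le> h" "0 \<le> s" "s \<le> h" for s t
    using inS[of s t] that by (simp add: algebra_simps)
  obtain t' s' where st': "0 \<le> s'" "s' \<le> h" "0 \<le> t'" "t' \<le> h" and
    e2: "f (x + h *\<^sub>R b + h *\<^sub>R a) - f (x + h *\<^sub>R b) - f (x + h *\<^sub>R a) + f x = h * h * ?B (x + t' *\<^sub>R b + s' *\<^sub>R a)"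
    using second_difference[OF S(1) smooth_on_has_derivative[OF f]
        smooth_on_has_derivative[OF smooth_on_frechet_derivative[OF f]] h inS'] by blast
  have e2': "x + t' *\<^sub>R b + s' *\<^sub>R a = x + s' *\<^sub>R a + t' *\<^sub>R b" "x + h *\<^sub>R b + h *\<^sub>R a = x + h *\<^sub>R a + h *\<^sub>R b"
    by (simp_all add: algebra_simps)
  have "h * h * ?A (x + s *\<^sub>R a + t *\<^sub>R b) = h * h * ?B (x + s' *\<^sub>R a + t' *\<^sub>R b)"
    using e1 e2 unfolding e2' by linarith
  then have "?A (x + s *\<^sub>R a + t *\<^sub>R b) = ?B (x + s' *\<^sub>R a + t' *\<^sub>R b)" using h by simp
  moreover have "dist (?A (x + s *\<^sub>R a + t *\<^sub>R b)) (?A x) < e"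
    using close[OF st] inS[OF st] d1(2) by simp
  moreover have "dist (?B (x + s' *\<^sub>R a + t' *\<^sub>R b)) (?B x) < e"
    using close[OF st'] inS[OF st'] d2(2) by simp
  ultimately have "\<bar>?A x - ?B x\<bar> < 2 * e" unfolding dist_real_def by linarith
  then show False unfolding e_def by simp
qed

section \<open>Smooth dependence of integral equations on parameters\<close>

text \<open>Tube lemma: compactness of the time interval makes one neighbourhood of
  \<open>x0\<close> serve all times.\<close>

lemma uniform_continuous_param:
  fixes G :: "real \<Rightarrow> 'a::metric_space \<Rightarrow> 'b::metric_space"
  assumes G: "continuous_on ({0..1} \<times> S) (\<lambda>z. G (fst z) (snd z))" and x0: "x0 \<in> S" and e: "e > 0"
  obtains d where "d > 0"
    "\<And>p x. p \<in> {0..1} \<Longrightarrow> x \<in> S \<Longrightarrow> dist x x0 < d \<Longrightarrow> dist (G p x) (G p x0) \<le> e"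
proof -
  have "continuous_on (S \<times> {0..1}) (\<lambda>z. (snd z, fst z))"
    by (intro continuous_intros)
  from continuous_on_compose2[OF G this]
  have c: "continuous_on (S \<times> {0..1}) (\<lambda>z. G (snd z) (fst z))" by fastforce
  obtain X0 where X0: "x0 \<in> X0" "open X0" "\<forall>x\<in>X0 \<inter> S. \<forall>t\<in>{0..1}. dist (G t x) (G t x0) \<le> e"
    by (rule continuous_on_prod_compactE[OF c compact_Icc x0 e]) (rule that, simp_all)
  obtain d where "d > 0" "ball x0 d \<subseteq> X0"
    using X0 open_contains_ball by blast
  with X0(3) show ?thesis by (intro that[of d]) (auto simp: dist_commute subset_iff)
qed

lemma norm_sum_Basis_le:
  fixes w :: "'a::euclidean_space" and f :: "'a \<Rightarrow> 'b::real_normed_vector"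
  assumes "\<And>i. i \<in> Basis \<Longrightarrow> norm (f i) \<le> C"
  shows "norm (\<Sum>i\<in>Basis. (w \<bullet> i) *\<^sub>R f i) \<le> (C * DIM('a)) * norm w"
proof -
  have "norm ((w \<bullet> i) *\<^sub>R f i) \<le> norm w * C" if "i \<in> Basis" for i
    using assms[OF that] Basis_le_norm[OF that, of w] by (simp add: mult_mono)
  then have "norm (\<Sum>i\<in>Basis. (w \<bullet> i) *\<^sub>R f i) \<le> real (card (Basis :: 'a set)) * (norm w * C)"
    by (rule sum_norm_bound)
  then show ?thesis by (simp add: mult_ac)
qed

text \<open>The mean value inequality for \<open>k p x - D p x0 x\<close> as a function of
  \<open>x\<close> bounds the remainder by the oscillation of \<open>D p\<close> near
  \<open>x0\<close>, which is small uniformly in \<open>p\<close> by compactness of the time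
  interval.\<close>

lemma uniform_derivative:
  fixes k :: "real \<Rightarrow> 'a::euclidean_space \<Rightarrow> 'b::real_normed_vector"
  assumes S: "open S" "x0 \<in> S"
    and D: "\<And>p x. p \<in> {0..1} \<Longrightarrow> x \<in> S \<Longrightarrow> (k p has_derivative D p x) (at x)"
    and cD: "\<And>v. continuous_on ({0..1} \<times> S) (\<lambda>z. D (fst z) (snd z) v)"
    and e: "e > 0"
  shows "\<exists>d>0. \<forall>p\<in>{0..1}. \<forall>x\<in>ball x0 d. norm (k p x - k p x0 - D p x0 (x - x0)) \<le> e * norm (x - x0)"
proof -
  \<comment> \<open>The oscillation is controlled on basis vectors only; summing over the basis
    costs the factor \<open>DIM('a)\<close>.\<close>
  define e' where "e' = e / DIM('a)"
  have e': "e' > 0" using e by (simp add: e'_def)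
  have "\<exists>d>0. \<forall>p x. p \<in> {0..1} \<longrightarrow> x \<in> S \<longrightarrow> dist x x0 < d \<longrightarrow> dist (D p x i) (D p x0 i) \<le> e'" for i
    by (rule uniform_continuous_param[OF cD S(2) e', of i]) blast
  then obtain r where r: "\<And>i. r i > 0"
    "\<And>i p x. p \<in> {0..1} \<Longrightarrow> x \<in> S \<Longrightarrow> dist x x0 < r i \<Longrightarrow> dist (D p x i) (D p x0 i) \<le> e'"
    by metis
  obtain d0 where d0: "d0 > 0" "ball x0 d0 \<subseteq> S" using S open_contains_ball by blast
  define d where "d = min d0 (Min (r ` Basis))"
  have d: "d > 0" using d0 r(1) by (simp add: d_def)
  have dr: "d \<le> r i" if "i \<in> Basis" for i
    using that by (simp add: d_def min.coboundedI2)
  have sub: "ball x0 d \<subseteq> S" using d0 by (auto simp: d_def)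
  have on: "onorm (\<lambda>v. D p x v - D p x0 v) \<le> e" if p: "p \<in> {0..1}" and x: "x \<in> ball x0 d" for p x
  proof (rule onorm_le)
    fix v
    have xS: "x \<in> S" using x sub by auto
    have l: "linear (\<lambda>v. D p x v - D p x0 v)"
      using D[OF p xS] D[OF p S(2)] by (intro linear_compose_sub has_derivative_linear)
    have "D p x v - D p x0 v = (\<Sum>i\<in>Basis. (v \<bullet> i) *\<^sub>R (D p x i - D p x0 i))"
      using linear_eq_sum_Basis[OF l] .
    also have "norm \<dots> \<le> (e' * DIM('a)) * norm v"
    proof (rule norm_sum_Basis_le)
      fix i :: 'a assume i: "i \<in> Basis"
      have "dist x x0 < r i" using x dr[OF i] by (simp add: dist_commute)
      from r(2)[OF p xS this] show "norm (D p x i - D p x0 i) \<le> e'" by (simp add: dist_norm)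
    qed
    finally show "norm (D p x v - D p x0 v) \<le> e * norm v" by (simp add: e'_def)
  qed
  have "norm (k p x - k p x0 - D p x0 (x - x0)) \<le> e * norm (x - x0)"
    if p: "p \<in> {0..1}" and x: "x \<in> ball x0 d" for p x
  proof -
    have l: "linear (D p x0)" using D[OF p S(2)] by (rule has_derivative_linear)
    have "norm ((k p x - D p x0 x) - (k p x0 - D p x0 x0)) \<le> e * norm (x - x0)"
    proof (rule differentiable_bound[of "ball x0 d" "\<lambda>x. k p x - D p x0 x" "\<lambda>x v. D p x v - D p x0 v"])
      fix z assume z: "z \<in> ball x0 d"
      have bl: "bounded_linear (D p x0)" using D[OF p S(2)] by (rule has_derivative_bounded_linear)
      have zS: "z \<in> S" using z sub by blast
      show "((\<lambda>x. k p x - D p x0 x) has_derivative (\<lambda>v. D p z v - D p x0 v)) (at z within ball x0 d)"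
        by (rule has_derivative_at_withinI[OF has_derivative_diff[OF D[OF p zS]
               bounded_linear_imp_has_derivative[OF bl]]])
      show "onorm (\<lambda>v. D p z v - D p x0 v) \<le> e" by (rule on[OF p z])
    qed (use x d in auto)
    then show ?thesis by (simp add: linear_diff[OF l] algebra_simps)
  qed
  with d show ?thesis by blast
qed

text \<open>Integral equations are posed on the unit time interval with Lipschitz constant \<open>q < 1\<close>:
  short times are obtained by scaling the vector field, so that a contraction estimate
  (\<open>contraction_bound\<close>) replaces Gronwall's inequality.\<close>

definition int_sol :: "(real \<Rightarrow> 'g::euclidean_space \<Rightarrow> 'g) \<Rightarrow> (real \<Rightarrow> 'g) \<Rightarrow> bool" where
  "int_sol F y \<longleftrightarrow> continuous_on {0..1} y \<and>
     (\<forall>t\<in>{0..1}. ((\<lambda>s. F s (y s)) has_integral y t) {0..t})"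

text \<open>At a time \<open>m\<close> where the norm of \<open>r\<close> is largest, integrating
  over an interval of length at most one gives \<open>norm (r m) \<le> q * norm (r m) + e\<close>,
  and the first term is absorbed because \<open>q < 1\<close>.\<close>

lemma contraction_bound:
  fixes r g :: "real \<Rightarrow> 'g::euclidean_space"
  assumes r: "continuous_on {0..1} r"
    and g: "\<And>t. t \<in> {0..1} \<Longrightarrow> (g has_integral r t) {0..t}"
    and le: "\<And>s. s \<in> {0..1} \<Longrightarrow> norm (g s) \<le> q * norm (r s) + e"
    and q: "0 \<le> q" "q < 1" and e: "0 \<le> e" and t: "t \<in> {0..1}"
  shows "norm (r t) \<le> e / (1 - q)"
proof -
  obtain m where m: "m \<in> {0..1}" "\<And>s. s \<in> {0..1} \<Longrightarrow> norm (r s) \<le> norm (r m)"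
    using continuous_attains_sup[OF compact_Icc _ continuous_on_norm[OF r]] by auto
  have "norm (r m) \<le> (q * norm (r m) + e) * measure lborel {0..m}"
  proof (rule has_integral_bound_real[OF _ finite.emptyI g[OF m(1)]])
    show "norm (g s) \<le> q * norm (r m) + e" if "s \<in> {0..m} - {}" for s
      using le[of s] m that q mult_left_mono[OF m(2)[of s] q(1)] by force
  qed (use q e in auto)
  also have "\<dots> \<le> (q * norm (r m) + e) * 1"
    using m q e by (intro mult_left_mono) auto
  finally have "norm (r m) * (1 - q) \<le> e" by (simp add: algebra_simps)
  then have "norm (r m) \<le> e / (1 - q)" using q by (simp add: pos_le_divide_eq)
  with m(2)[OF t] show ?thesis by linarith
qed

lemma int_sol_exists:
  fixes F :: "real \<Rightarrow> 'g::euclidean_space \<Rightarrow> 'g"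
  assumes F: "continuous_on ({0..1} \<times> UNIV) (\<lambda>z. F (fst z) (snd z))"
    and lip: "\<And>s a b. s \<in> {0..1} \<Longrightarrow> norm (F s a - F s b) \<le> q * norm (a - b)"
    and q: "0 \<le> q" "q < 1"
  shows "\<exists>y. int_sol F y"
proof -
  \<comment> \<open>Clamping the time to the unit interval makes the Picard operator act on bounded
    continuous functions on the whole line, a complete metric space in which the contraction
    principle applies.\<close>
  define c where "c t = max 0 (min 1 t)" for t :: real
  have c01: "c t \<in> {0..1}" for t by (auto simp: c_def)
  have cc: "continuous_on UNIV c" unfolding c_def by (intro continuous_intros)
  define T where "T y t = integral {0..c t} (\<lambda>s. F s (y s))" for y t
  have cF: "continuous_on {0..1} (\<lambda>s. F s (y s))" if "continuous_on {0..1} y" for y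
  proof -
    have "continuous_on {0..1} (\<lambda>s. (s, y s))"
      by (intro continuous_intros that)
    from continuous_on_compose2[OF F this] show ?thesis by fastforce
  qed
  have iF: "(\<lambda>s. F s (y s)) integrable_on {0..t}" if "continuous_on {0..1} y" "t \<in> {0..1}" for y t
    using that by (intro integrable_continuous_interval continuous_on_subset[OF cF]) auto
  have Tb: "T y \<in> bcontfun" if y: "continuous_on {0..1} y" for y
  proof -
    have ci: "continuous_on {0..1} (\<lambda>t. integral {0..t} (\<lambda>s. F s (y s)))"
      by (rule indefinite_integral_continuous_1) (use y iF[of y 1] in auto)
    have "continuous_on UNIV (T y)"
      unfolding T_def by (rule continuous_on_compose2[OF ci cc]) (use c01 in auto)
    moreover have "range (T y) \<subseteq> (\<lambda>t. integral {0..t} (\<lambda>s. F s (y s))) ` {0..1}"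
      using c01 by (auto simp: T_def)
    then have "bounded (range (T y))"
      using compact_continuous_image[OF ci compact_Icc] compact_imp_bounded bounded_subset by blast
    ultimately show ?thesis by (simp add: bcontfun_def)
  qed
  have ca: "continuous_on {0..1} (apply_bcontfun Y)" for Y :: "real \<Rightarrow>\<^sub>C 'g"
    using continuous_on_apply_bcontfun continuous_on_subset by blast
  define TT where "TT Y = Bcontfun (T (apply_bcontfun Y))" for Y :: "real \<Rightarrow>\<^sub>C 'g"
  have aT: "apply_bcontfun (TT Y) = T (apply_bcontfun Y)" for Y
    unfolding TT_def by (rule Bcontfun_inverse[OF Tb[OF ca]])
  have "\<exists>!Y. TT Y = Y"
  proof (rule banach_fix_type[OF q])
    show "\<forall>x y. dist (TT x) (TT y) \<le> q * dist x y"
    proof (intro allI)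
      fix X Y :: "real \<Rightarrow>\<^sub>C 'g"
      show "dist (TT X) (TT Y) \<le> q * dist X Y"
      proof (rule dist_bound)
        fix t
        have "T X t - T Y t = integral {0..c t} (\<lambda>s. F s (X s) - F s (Y s))"
          unfolding T_def by (subst integral_diff[OF iF iF]) (use c01 ca in auto)
        moreover have "norm (integral {0..c t} (\<lambda>s. F s (X s) - F s (Y s))) \<le> (q * dist X Y) * measure lborel {0..c t}"
        proof (rule has_integral_bound_real[OF _ finite.emptyI integrable_integral])
          show "(\<lambda>s. F s (X s) - F s (Y s)) integrable_on {0..c t}"
            by (intro integrable_diff iF ca c01)
          show "norm (F s (X s) - F s (Y s)) \<le> q * dist X Y" if "s \<in> {0..c t} - {}" for s
          proof -
            have "s \<in> {0..1}" using that c01[of t] by auto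
            then have "norm (F s (X s) - F s (Y s)) \<le> q * dist (X s) (Y s)"
              using lip[of s "X s" "Y s"] by (simp add: dist_norm)
            also have "\<dots> \<le> q * dist X Y" using q dist_bounded[of X s Y] by (intro mult_left_mono)
            finally show ?thesis .
          qed
        qed (use q in auto)
        moreover have "(q * dist X Y) * measure lborel {0..c t} \<le> (q * dist X Y) * 1"
          using c01[of t] q by (intro mult_left_mono) auto
        ultimately show "dist (TT X t) (TT Y t) \<le> q * dist X Y"
          by (simp add: aT dist_norm)
      qed
    qed
  qed
  then obtain Y where Y: "TT Y = Y" by auto
  have "((\<lambda>s. F s (Y s)) has_integral Y t) {0..t}" if t: "t \<in> {0..1}" for t
  proof -
    have "Y t = T Y t" using aT[of Y] Y by simp
    also have "\<dots> = integral {0..t} (\<lambda>s. F s (Y s))" using t by (simp add: T_def c_def)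
    finally show ?thesis using iF[OF ca t, of Y] by (simp add: has_integral_integral)
  qed
  with ca show ?thesis unfolding int_sol_def by blast
qed

text \<open>The difference of two solutions is split at \<open>F s (l, y s l0)\<close>: one part is
  Lipschitz in the difference of the solutions, the other is uniformly small because it only
  involves the single curve of \<open>l0\<close>. \<open>contraction_bound\<close> does the
  rest.\<close>

lemma int_sol_continuous:
  fixes F :: "real \<Rightarrow> 'l::euclidean_space \<times> 'g::euclidean_space \<Rightarrow> 'g"
    and y :: "real \<Rightarrow> 'l \<Rightarrow> 'g"
  assumes F: "continuous_on ({0..1} \<times> (\<Lambda> \<times> UNIV)) (\<lambda>z. F (fst z) (snd z))"
    and lip: "\<And>s l a b. s \<in> {0..1} \<Longrightarrow> l \<in> \<Lambda> \<Longrightarrow> norm (F s (l, a) - F s (l, b)) \<le> q * norm (a - b)"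
    and q: "0 \<le> q" "q < 1"
    and y: "\<And>l. l \<in> \<Lambda> \<Longrightarrow> int_sol (\<lambda>s a. F s (l, a)) (\<lambda>s. y s l)"
  shows "continuous_on ({0..1} \<times> \<Lambda>) (\<lambda>z. y (fst z) (snd z))"
  unfolding continuous_on_iff
proof (intro ballI allI impI)
  fix z :: "real \<times> 'l" and e :: real assume z: "z \<in> {0..1} \<times> \<Lambda>" and e: "e > 0"
  obtain t0 l0 where z0: "z = (t0, l0)" "t0 \<in> {0..1}" "l0 \<in> \<Lambda>" using z by auto
  have cy: "continuous_on {0..1} (\<lambda>s. y s l)" if "l \<in> \<Lambda>" for l
    using y[OF that] by (simp add: int_sol_def)
  have "continuous_on ({0..1} \<times> \<Lambda>) (\<lambda>z. F (fst z) (snd z, y (fst z) l0))"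
  proof -
    have 1: "continuous_on ({0..1} \<times> \<Lambda>) (\<lambda>z. y (fst z) l0)"
      by (rule continuous_on_compose2[OF cy[OF z0(3)] continuous_on_fst[OF continuous_on_id]]) auto
    have "continuous_on ({0..1} \<times> \<Lambda>) (\<lambda>z. (fst z, (snd z, y (fst z) l0)))"
      by (intro continuous_intros 1)
    from continuous_on_compose2[OF F this] show ?thesis by fastforce
  qed
  then have cG: "continuous_on ({0..1} \<times> \<Lambda>) (\<lambda>z. (\<lambda>p l. F p (l, y p l0)) (fst z) (snd z))" .
  \<comment> \<open>The factor \<open>1 - q\<close> cancels the loss in
    \<open>contraction_bound\<close>; the remaining half of \<open>e\<close> is spent on continuity
    in time.\<close>
  have e': "e * (1 - q) / 2 > 0" using e q by simp
  obtain d1 where d1: "d1 > 0" and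
    close: "\<And>p l. p \<in> {0..1} \<Longrightarrow> l \<in> \<Lambda> \<Longrightarrow> dist l l0 < d1 \<Longrightarrow>
        dist (F p (l, y p l0)) (F p (l0, y p l0)) \<le> e * (1 - q) / 2"
    by (rule uniform_continuous_param[OF cG z0(3) e']) (rule that)
  have est: "norm (y t l - y t l0) \<le> e / 2" if l: "l \<in> \<Lambda>" "dist l l0 < d1" and t: "t \<in> {0..1}" for l t
  proof -
    have "norm (y t l - y t l0) \<le> (e * (1 - q) / 2) / (1 - q)"
    proof (rule contraction_bound[OF _ _ _ q _ t])
      show "continuous_on {0..1} (\<lambda>s. y s l - y s l0)"
        by (intro continuous_on_diff cy l z0)
      show "((\<lambda>s. F s (l, y s l) - F s (l0, y s l0)) has_integral y t l - y t l0) {0..t}" if "t \<in> {0..1}" for t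
        using y[OF l(1)] y[OF z0(3)] that unfolding int_sol_def by (intro has_integral_diff) auto
      show "norm (F s (l, y s l) - F s (l0, y s l0)) \<le> q * norm (y s l - y s l0) + e * (1 - q) / 2"
        if s: "s \<in> {0..1}" for s
        using lip[OF s l(1), of "y s l" "y s l0"] close[OF s l]
          norm_triangle_ineq[of "F s (l, y s l) - F s (l, y s l0)" "F s (l, y s l0) - F s (l0, y s l0)"]
        by (simp add: dist_norm)
    qed (use e q in auto)
    also have "\<dots> = e / 2" using q by (simp add: field_simps)
    finally show ?thesis .
  qed
  obtain d2 where d2: "d2 > 0" "\<And>t. t \<in> {0..1} \<Longrightarrow> dist t t0 < d2 \<Longrightarrow> dist (y t l0) (y t0 l0) < e / 2"
    using cy[OF z0(3)] z0(2) e unfolding continuous_on_iff by (metis half_gt_zero)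
  show "\<exists>d>0. \<forall>x'\<in>{0..1} \<times> \<Lambda>. dist x' z < d \<longrightarrow> dist (y (fst x') (snd x')) (y (fst z) (snd z)) < e"
  proof (intro exI[of _ "min d1 d2"] conjI ballI impI)
    fix x' assume x': "x' \<in> {0..1} \<times> \<Lambda>" "dist x' z < min d1 d2"
    have "dist (fst x') t0 < d2" "dist (snd x') l0 < d1"
      using x'(2) dist_fst_le[of x' z] dist_snd_le[of x' z] by (auto simp: z0)
    then have "dist (y (fst x') (snd x')) (y (fst x') l0) \<le> e / 2" "dist (y (fst x') l0) (y t0 l0) < e / 2"
      using x'(1) est[of "snd x'" "fst x'"] d2(2)[of "fst x'"] by (auto simp: dist_norm)
    then show "dist (y (fst x') (snd x')) (y (fst z) (snd z)) < e"
      using dist_triangle[of "y (fst x') (snd x')" "y t0 l0" "y (fst x') l0"] by (simp add: z0)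
  qed (use d1 d2 in auto)
qed

lemma linear_Pair_split:
  assumes "linear L"
  shows "L (v, w) = L (v, 0) + L (0, w)"
  using linear_add[OF assms, of "(v, 0)" "(0, w)"] by simp

lemma int_sol_cong:
  assumes "\<And>s w. s \<in> {0..1} \<Longrightarrow> F s w = G s w" "\<And>s. s \<in> {0..1} \<Longrightarrow> y s = z s" "int_sol F y"
  shows "int_sol G z"
  unfolding int_sol_def
proof (intro conjI ballI)
  show "continuous_on {0..1} z"
    using assms(2,3) continuous_on_cong[of "{0..1}" "{0..1}" y z] by (simp add: int_sol_def)
  fix t :: real assume t: "t \<in> {0..1}"
  have "((\<lambda>s. F s (y s)) has_integral y t) {0..t}"
    using assms(3) t by (simp add: int_sol_def)
  moreover have "F s (y s) = G s (z s)" if "s \<in> {0..t}" for s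
    using that t assms(1,2) by simp
  ultimately show "((\<lambda>s. G s (z s)) has_integral z t) {0..t}"
    using has_integral_eq[of "{0..t}" "\<lambda>s. F s (y s)" "\<lambda>s. G s (z s)"] assms(2)[OF t] by simp
qed

lemma linear_family_bound:
  fixes D :: "'p::topological_space \<Rightarrow> 'a::euclidean_space \<Rightarrow> 'b::real_normed_vector"
  assumes K: "compact K" and lin: "\<And>p. p \<in> K \<Longrightarrow> linear (D p)"
    and cont: "\<And>i. continuous_on K (\<lambda>p. D p i)"
  obtains C where "C \<ge> 0" "\<And>p w. p \<in> K \<Longrightarrow> norm (D p w) \<le> C * norm w"
proof -
  have "\<exists>B. \<forall>p\<in>K. norm (D p i) \<le> B" for i
    using compact_imp_bounded[OF compact_continuous_image[OF cont[of i] K]] unfolding bounded_iff by blast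
  then obtain B where B: "\<And>i p. p \<in> K \<Longrightarrow> norm (D p i) \<le> B i" by metis
  define M where "M = (\<Sum>i\<in>Basis. \<bar>B i\<bar>)"
  show ?thesis
  proof (rule that[of "M * DIM('a)"])
    show "0 \<le> M * DIM('a)" by (simp add: M_def sum_nonneg)
    fix p w assume p: "p \<in> K"
    show "norm (D p w) \<le> (M * DIM('a)) * norm w"
      unfolding linear_eq_sum_Basis[OF lin[OF p], of w]
    proof (rule norm_sum_Basis_le)
      fix i :: 'a assume i: "i \<in> Basis"
      have "\<bar>B i\<bar> \<le> M" unfolding M_def by (rule member_le_sum) (use i in auto)
      then show "norm (D p i) \<le> M" using B[OF p, of i] by linarith
    qed
  qed
qed

text \<open>\<open>Z\<close> solves the linearised equation along the curve of \<open>l0\<close>.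
  The remainder of the expansion of \<open>y\<close> satisfies an integral inequality with the same
  constant \<open>q\<close> and an error of order smaller than \<open>norm (l - l0)\<close>, so
  \<open>contraction_bound\<close> makes it negligible.\<close>

lemma int_sol_has_derivative:
  fixes F :: "real \<Rightarrow> 'l::euclidean_space \<times> 'g::euclidean_space \<Rightarrow> 'g"
    and y :: "real \<Rightarrow> 'l \<Rightarrow> 'g"
  assumes \<Lambda>: "open \<Lambda>" "l0 \<in> \<Lambda>"
    and F: "Ck_param (Suc 0) {0..1} (\<Lambda> \<times> UNIV) F"
    and cy: "continuous_on ({0..1} \<times> \<Lambda>) (\<lambda>z. y (fst z) (snd z))"
    and y: "\<And>l. l \<in> \<Lambda> \<Longrightarrow> int_sol (\<lambda>s a. F s (l, a)) (\<lambda>s. y s l)"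
    and q: "0 \<le> q" "q < 1"
    and bound: "\<And>s w. s \<in> {0..1} \<Longrightarrow> norm (\<D> (F s) (l0, y s l0) (0, w)) \<le> q * norm w"
    and Z: "\<And>v. int_sol (\<lambda>s w. \<D> (F s) (l0, y s l0) (v, w)) (\<lambda>s. Z s v)"
    and t: "t \<in> {0..1}"
  shows "(y t has_derivative Z t) (at l0)"
proof -
  define DF where "DF s = \<D> (F s) (l0, y s l0)" for s
  have op: "open (\<Lambda> \<times> (UNIV :: 'g set))" using \<Lambda> by (intro open_Times) auto
  note dF = Ck_param_SucD(1)[OF F] and cdF = Ck_param_continuous[OF Ck_param_SucD(2)[OF F]]
  have lin: "linear (DF s)" if "s \<in> {0..1}" for s
    unfolding DF_def using dF[OF that] \<Lambda>(2) by (intro has_derivative_linear) auto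
  have cZ: "continuous_on {0..1} (\<lambda>s. Z s v)" for v
    using Z by (simp add: int_sol_def)
  have iZ: "((\<lambda>s. DF s (v, Z s v)) has_integral Z t v) {0..t}" if "t \<in> {0..1}" for v t
    using Z[of v] that by (simp add: int_sol_def DF_def)
  have cyl: "continuous_on {0..1} (\<lambda>s. y s l)" if "l \<in> \<Lambda>" for l
    using y[OF that] by (simp add: int_sol_def)
  have iy: "((\<lambda>s. F s (l, y s l)) has_integral y t l) {0..t}" if "l \<in> \<Lambda>" "t \<in> {0..1}" for l t
    using y[OF that(1)] that(2) by (simp add: int_sol_def)
  have bd: "norm (DF s (0, w)) \<le> q * norm w" if "s \<in> {0..1}" for s w
    using bound[OF that] by (simp add: DF_def)
  \<comment> \<open>Uniqueness for the linearised equation: the defect of additivity or homogeneity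
    solves the homogeneous equation, so \<open>contraction_bound\<close> with error zero annihilates
    it.\<close>
  have linZ: "linear (Z t)"
  proof (rule linearI)
    fix v w
    have "norm (Z t (v + w) - (Z t v + Z t w)) \<le> 0 / (1 - q)"
    proof (rule contraction_bound[OF _ _ _ q order_refl t])
      show "continuous_on {0..1} (\<lambda>s. Z s (v + w) - (Z s v + Z s w))"
        by (intro continuous_intros cZ)
      show "((\<lambda>s. DF s (v + w, Z s (v + w)) - (DF s (v, Z s v) + DF s (w, Z s w)))
          has_integral Z t (v + w) - (Z t v + Z t w)) {0..t}" if "t \<in> {0..1}" for t
        by (intro has_integral_diff has_integral_add iZ that)
      show "norm (DF s (v + w, Z s (v + w)) - (DF s (v, Z s v) + DF s (w, Z s w)))
          \<le> q * norm (Z s (v + w) - (Z s v + Z s w)) + 0" if s: "s \<in> {0..1}" for s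
      proof -
        have "DF s (v + w, Z s (v + w)) - (DF s (v, Z s v) + DF s (w, Z s w))
          = DF s ((v + w, Z s (v + w)) - ((v, Z s v) + (w, Z s w)))"
          by (simp only: linear_diff[OF lin[OF s]] linear_add[OF lin[OF s]])
        then show ?thesis using bd[OF s, of "Z s (v + w) - (Z s v + Z s w)"] by simp
      qed
    qed
    then show "Z t (v + w) = Z t v + Z t w" by simp
  next
    fix c :: real and v
    have "norm (Z t (c *\<^sub>R v) - c *\<^sub>R Z t v) \<le> 0 / (1 - q)"
    proof (rule contraction_bound[OF _ _ _ q order_refl t])
      show "continuous_on {0..1} (\<lambda>s. Z s (c *\<^sub>R v) - c *\<^sub>R Z s v)"
        by (intro continuous_intros cZ)
      show "((\<lambda>s. DF s (c *\<^sub>R v, Z s (c *\<^sub>R v)) - c *\<^sub>R DF s (v, Z s v))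
          has_integral Z t (c *\<^sub>R v) - c *\<^sub>R Z t v) {0..t}" if "t \<in> {0..1}" for t
        by (intro has_integral_diff has_integral_cmul iZ that)
      show "norm (DF s (c *\<^sub>R v, Z s (c *\<^sub>R v)) - c *\<^sub>R DF s (v, Z s v))
          \<le> q * norm (Z s (c *\<^sub>R v) - c *\<^sub>R Z s v) + 0" if s: "s \<in> {0..1}" for s
      proof -
        have "DF s (c *\<^sub>R v, Z s (c *\<^sub>R v)) - c *\<^sub>R DF s (v, Z s v)
          = DF s ((c *\<^sub>R v, Z s (c *\<^sub>R v)) - c *\<^sub>R (v, Z s v))"
          by (simp only: linear_diff[OF lin[OF s]] linear_cmul[OF lin[OF s]])
        then show ?thesis using bd[OF s, of "Z s (c *\<^sub>R v) - c *\<^sub>R Z s v"] by simp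
      qed
    qed
    then show "Z t (c *\<^sub>R v) = c *\<^sub>R Z t v" by simp
  qed
  obtain C where C: "C \<ge> 0" "\<And>s v. s \<in> {0..1} \<Longrightarrow> norm (DF s (v, 0)) \<le> C * norm v"
  proof (rule linear_family_bound[of "{0..1::real}" "\<lambda>s v. DF s (v, 0)"])
    show "linear (\<lambda>v. DF s (v, 0))" if "s \<in> {0..1}" for s
      using linear_compose[OF _ lin[OF that], of "\<lambda>v. (v, 0)"]
      by (simp add: o_def bounded_linear.linear[OF bounded_linear_Pair[OF bounded_linear_ident bounded_linear_zero]])
    have "continuous_on {0..1} (\<lambda>s. (s, l0, y s l0))"
      by (intro continuous_intros cyl \<Lambda>)
    from continuous_on_compose2[OF cdF this] \<Lambda>(2)
    show "continuous_on {0..1} (\<lambda>s. DF s (i, 0))" for i unfolding DF_def by fastforce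
  qed (use that in auto)
  have rem: "\<exists>d>0. \<forall>l\<in>ball l0 d. l \<in> \<Lambda> \<and> (\<forall>s\<in>{0..1}.
      norm (F s (l, y s l) - F s (l0, y s l0) - DF s (l - l0, y s l - y s l0))
        \<le> e * (norm (l - l0) + norm (y s l - y s l0)))" if e: "e > 0" for e
  proof -
    \<comment> \<open>Translating by the curve moves the base point \<open>(l0, y s l0)\<close>,
      which depends on time, to the fixed point \<open>(l0, 0)\<close>, where
      \<open>uniform_derivative\<close> applies.\<close>
    have tr: "((\<lambda>x. (fst x, y s l0 + snd x)) has_derivative (\<lambda>x. x)) (at x)" for s x
      by (auto intro!: derivative_eq_intros)
    have d: "((\<lambda>x. F s (fst x, y s l0 + snd x)) has_derivative
        \<D> (F s) (fst x, y s l0 + snd x)) (at x)"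
      if "s \<in> {0..1}" "x \<in> \<Lambda> \<times> UNIV" for s x
      using has_derivative_compose[OF tr dF[OF that(1)]] that(2) by auto
    have 1: "continuous_on ({0..1} \<times> (\<Lambda> \<times> (UNIV :: 'g set))) (\<lambda>z. y (fst z) l0)"
      by (rule continuous_on_compose2[OF cyl[OF \<Lambda>(2)] continuous_on_fst[OF continuous_on_id]]) auto
    have cd: "continuous_on ({0..1} \<times> (\<Lambda> \<times> UNIV))
        (\<lambda>z. \<D> (F (fst z)) (fst (snd z), y (fst z) l0 + snd (snd z)) v)" for v
      by (rule continuous_on_param_compose[where k = "\<lambda>p x. (fst x, y p l0 + snd x)", OF cdF])
        (auto intro!: continuous_intros 1)
    have in0: "(l0, 0) \<in> \<Lambda> \<times> (UNIV :: 'g set)" using \<Lambda> by simp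
    have "\<exists>d>0. \<forall>s\<in>{0..1}. \<forall>x\<in>ball (l0, 0) d.
        norm (F s (fst x, y s l0 + snd x) - F s (l0, y s l0) - DF s (x - (l0, 0))) \<le> e * norm (x - (l0, 0))"
      using uniform_derivative[where k = "\<lambda>s x. F s (fst x, y s l0 + snd x)"
          and D = "\<lambda>s x. \<D> (F s) (fst x, y s l0 + snd x)", OF op in0 d cd e]
      by (simp add: DF_def)
    then obtain d where d: "d > 0" "\<And>s x. s \<in> {0..1} \<Longrightarrow> x \<in> ball (l0, 0) d \<Longrightarrow>
        norm (F s (fst x, y s l0 + snd x) - F s (l0, y s l0) - DF s (x - (l0, 0))) \<le> e * norm (x - (l0, 0))"
      by blast
    obtain d1 where d1: "d1 > 0" "\<And>s l. s \<in> {0..1} \<Longrightarrow> l \<in> \<Lambda> \<Longrightarrow> dist l l0 < d1 \<Longrightarrow> dist (y s l) (y s l0) \<le> d / 4"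
      by (rule uniform_continuous_param[OF cy \<Lambda>(2), of "d / 4"]) (use d(1) in simp, rule that)
    obtain d2 where d2: "d2 > 0" "ball l0 d2 \<subseteq> \<Lambda>" using \<Lambda> open_contains_ball by blast
    show ?thesis
    proof (intro exI[of _ "min d2 (min d1 (d / 2))"] conjI ballI)
      fix l assume l: "l \<in> ball l0 (min d2 (min d1 (d / 2)))"
      then show l\<Lambda>: "l \<in> \<Lambda>" using d2 by auto
      fix s :: real assume s: "s \<in> {0..1}"
      let ?x = "(l, y s l - y s l0)"
      have le: "norm (?x - (l0, 0)) \<le> norm (l - l0) + norm (y s l - y s l0)"
        using norm_Pair_le[of "l - l0" "y s l - y s l0"] by simp
      have a: "norm (l - l0) < d / 2" "norm (y s l - y s l0) \<le> d / 4"
        using l d1(2)[OF s l\<Lambda>] by (auto simp: dist_norm norm_minus_commute)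
      have "?x \<in> ball (l0, 0) d"
        unfolding mem_ball dist_norm using le a d(1) by (subst norm_minus_commute) linarith
      from d(2)[OF s this]
      have "norm (F s (l, y s l) - F s (l0, y s l0) - DF s (l - l0, y s l - y s l0)) \<le> e * norm (?x - (l0, 0))"
        by simp
      also have "\<dots> \<le> e * (norm (l - l0) + norm (y s l - y s l0))"
        using le e by (intro mult_left_mono) auto
      finally show "norm (F s (l, y s l) - F s (l0, y s l0) - DF s (l - l0, y s l - y s l0))
        \<le> e * (norm (l - l0) + norm (y s l - y s l0))" .
    qed (use d d1 d2 in auto)
  qed
  \<comment> \<open>A rough remainder suffices here: half of the gap \<open>1 - q\<close> keeps the
    constant \<open>q + e1\<close> below one, and the outcome is Lipschitz dependence on the
    parameter with constant \<open>K\<close>.\<close>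
  define e1 where "e1 = (1 - q) / 2"
  have e1: "e1 > 0" "q + e1 < 1" using q by (auto simp: e1_def field_simps)
  define K where "K = (C + e1) / (1 - (q + e1))"
  have K: "K \<ge> 0" using C e1 by (simp add: K_def)
  obtain d1 where d1: "d1 > 0" and rem1: "\<And>l s. l \<in> ball l0 d1 \<Longrightarrow> l \<in> \<Lambda> \<and> (s \<in> {0..1} \<longrightarrow> 
      norm (F s (l, y s l) - F s (l0, y s l0) - DF s (l - l0, y s l - y s l0))
        \<le> e1 * (norm (l - l0) + norm (y s l - y s l0)))"
    using rem[OF e1(1)] by blast
  have lips: "norm (y s l - y s l0) \<le> K * norm (l - l0)" if l: "l \<in> ball l0 d1" and s: "s \<in> {0..1}" for l s
  proof -
    have l\<Lambda>: "l \<in> \<Lambda>" using rem1[OF l] by simp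
    have "norm (y s l - y s l0) \<le> ((C + e1) * norm (l - l0)) / (1 - (q + e1))"
    proof (rule contraction_bound[OF _ _ _ _ e1(2) _ s])
      show "continuous_on {0..1} (\<lambda>s. y s l - y s l0)" by (intro continuous_intros cyl l\<Lambda> \<Lambda>)
      show "((\<lambda>s. F s (l, y s l) - F s (l0, y s l0)) has_integral y t l - y t l0) {0..t}" if "t \<in> {0..1}" for t
        by (intro has_integral_diff iy that l\<Lambda> \<Lambda>)
      show "norm (F s (l, y s l) - F s (l0, y s l0)) \<le> (q + e1) * norm (y s l - y s l0) + (C + e1) * norm (l - l0)"
        if s: "s \<in> {0..1}" for s
      proof -
        have split: "DF s (l - l0, y s l - y s l0) = DF s (l - l0, 0) + DF s (0, y s l - y s l0)"
          by (rule linear_Pair_split[OF lin[OF s]])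
        have "norm (DF s (l - l0, y s l - y s l0)) \<le> C * norm (l - l0) + q * norm (y s l - y s l0)"
          unfolding split using C(2)[OF s, of "l - l0"] bd[OF s, of "y s l - y s l0"] norm_triangle_ineq[of "DF s (l - l0, 0)" "DF s (0, y s l - y s l0)"]
          by linarith
        moreover have "norm (F s (l, y s l) - F s (l0, y s l0)) \<le>
            norm (F s (l, y s l) - F s (l0, y s l0) - DF s (l - l0, y s l - y s l0)) + norm (DF s (l - l0, y s l - y s l0))"
          using norm_triangle_sub by (metis add.commute)
        ultimately show ?thesis using rem1[OF l, of s] s by (simp add: algebra_simps)
      qed
    qed (use q e1 C in auto)
    then show ?thesis by (simp add: K_def)
  qed
  show ?thesis unfolding has_derivative_at_alt
  proof (intro conjI allI impI)
    show "bounded_linear (Z t)" using linZ by (simp add: linear_conv_bounded_linear)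
    fix e :: real assume e: "e > 0"
    \<comment> \<open>The final error is \<open>e2 * (1 + K) / (1 - q)\<close> times
      \<open>norm (l - l0)\<close>; this choice makes the factor equal to \<open>e\<close>. The
      summand \<open>K\<close> stems from bounding the solution increment by the parameter
      increment.\<close>
    define e2 where "e2 = e * (1 - q) / (1 + K)"
    have e2: "e2 > 0" using e q K by (simp add: e2_def)
    obtain d2 where d2: "d2 > 0" and rem2: "\<And>l s. l \<in> ball l0 d2 \<Longrightarrow> s \<in> {0..1} \<Longrightarrow> 
      norm (F s (l, y s l) - F s (l0, y s l0) - DF s (l - l0, y s l - y s l0))
        \<le> e2 * (norm (l - l0) + norm (y s l - y s l0))"
      using rem[OF e2] by blast
    show "\<exists>d>0. \<forall>l. norm (l - l0) < d \<longrightarrow> norm (y t l - y t l0 - Z t (l - l0)) \<le> e * norm (l - l0)"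
    proof (intro exI[of _ "min d1 d2"] conjI allI impI)
      fix l assume "norm (l - l0) < min d1 d2"
      then have l: "l \<in> ball l0 d1" "l \<in> ball l0 d2" by (auto simp: dist_norm norm_minus_commute)
      have l\<Lambda>: "l \<in> \<Lambda>" using rem1[OF l(1)] by simp
      have "norm (y t l - y t l0 - Z t (l - l0)) \<le> (e2 * ((1 + K) * norm (l - l0))) / (1 - q)"
      proof (rule contraction_bound[OF _ _ _ q _ t])
        show "continuous_on {0..1} (\<lambda>s. y s l - y s l0 - Z s (l - l0))"
          by (intro continuous_intros cyl cZ l\<Lambda> \<Lambda>)
        show "((\<lambda>s. F s (l, y s l) - F s (l0, y s l0) - DF s (l - l0, Z s (l - l0))) has_integral
            y t l - y t l0 - Z t (l - l0)) {0..t}" if "t \<in> {0..1}" for t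
          by (intro has_integral_diff iy iZ that l\<Lambda> \<Lambda>)
        show "norm (F s (l, y s l) - F s (l0, y s l0) - DF s (l - l0, Z s (l - l0)))
            \<le> q * norm (y s l - y s l0 - Z s (l - l0)) + e2 * ((1 + K) * norm (l - l0))"
          if s: "s \<in> {0..1}" for s
        proof -
          have "DF s (l - l0, y s l - y s l0) - DF s (l - l0, Z s (l - l0)) = DF s (0, y s l - y s l0 - Z s (l - l0))"
            using linear_diff[OF lin[OF s], of "(l - l0, y s l - y s l0)" "(l - l0, Z s (l - l0))"] by simp
          then have eq: "F s (l, y s l) - F s (l0, y s l0) - DF s (l - l0, Z s (l - l0))
             = (F s (l, y s l) - F s (l0, y s l0) - DF s (l - l0, y s l - y s l0)) + DF s (0, y s l - y s l0 - Z s (l - l0))"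
            by (simp add: algebra_simps)
          have "e2 * (norm (l - l0) + norm (y s l - y s l0)) \<le> e2 * ((1 + K) * norm (l - l0))"
            using lips[OF l(1) s] e2 by (intro mult_left_mono) (auto simp: algebra_simps)
          then show ?thesis
            unfolding eq using rem2[OF l(2) s] bd[OF s, of "y s l - y s l0 - Z s (l - l0)"]
            by (smt (verit, best) norm_triangle_ineq)
        qed
      qed (use e2 K in auto)
      also have "\<dots> = e * norm (l - l0)" using q K by (simp add: e2_def)
      finally show "norm (y t l - y t l0 - Z t (l - l0)) \<le> e * norm (l - l0)" .
    qed (use d1 d2 in auto)
  qed
qed

lemma linear_int_sol_exists:
  fixes A :: "'g::euclidean_space \<Rightarrow> real \<Rightarrow> 'l::euclidean_space \<Rightarrow> 'g"
  assumes q: "0 \<le> q" "q < 1" and l: "l \<in> \<Lambda>"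
    and A: "\<And>i. i \<in> Basis \<Longrightarrow> Ck_param n {0..1} \<Lambda> (A i)" and B: "Ck_param n {0..1} \<Lambda> B"
    and bound: "\<And>s w. s \<in> {0..1} \<Longrightarrow> norm (\<Sum>i\<in>Basis. (w \<bullet> i) *\<^sub>R A i s l) \<le> q * norm w"
  shows "\<exists>W. int_sol (\<lambda>s w. (\<Sum>i\<in>Basis. (w \<bullet> i) *\<^sub>R A i s l) + B s l) W"
proof (rule int_sol_exists[OF _ _ q])
  have c: "continuous_on ({0..1} \<times> (UNIV :: 'g set)) (\<lambda>z. K (fst z) l)"
    if K: "Ck_param n {0..1} \<Lambda> K" for K :: "real \<Rightarrow> 'l \<Rightarrow> 'g"
  proof -
    have "continuous_on ({0..1} \<times> (UNIV :: 'g set)) (\<lambda>z. (fst z, l))" by (intro continuous_intros)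
    from continuous_on_compose2[OF Ck_param_continuous[OF K] this] l show ?thesis by fastforce
  qed
  show "continuous_on ({0..1} \<times> UNIV) (\<lambda>z. (\<Sum>i\<in>Basis. (snd z \<bullet> i) *\<^sub>R A i (fst z) l) + B (fst z) l)"
    by (intro continuous_intros c[OF A] c[OF B])
  show "norm ((\<Sum>i\<in>Basis. (a \<bullet> i) *\<^sub>R A i s l) + B s l - ((\<Sum>i\<in>Basis. (b \<bullet> i) *\<^sub>R A i s l) + B s l)) \<le> q * norm (a - b)"
    if "s \<in> {0..1}" for s a b
    using bound[OF that, of "a - b"] by (simp add: sum_subtractf inner_diff_left scaleR_diff_left)
qed

text \<open>Differentiating the equation in the parameter leaves the homogeneous part
  \<open>A\<close> and its bound \<open>q\<close> unchanged and only alters the inhomogeneity, which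
  now contains \<open>Z\<close> itself. The induction therefore runs over all \<open>B\<close> and
  \<open>Z\<close>: class \<open>n\<close> of \<open>Z\<close> gives class \<open>n\<close> of the
  new inhomogeneity and hence of the derivative of \<open>Z\<close>.\<close>

lemma linear_int_sol_Ck_param:
  fixes A :: "'g::euclidean_space \<Rightarrow> real \<Rightarrow> 'l::euclidean_space \<Rightarrow> 'g"
    and B Z :: "real \<Rightarrow> 'l \<Rightarrow> 'g"
  assumes \<Lambda>: "open \<Lambda>" and q: "0 \<le> q" "q < 1"
    and A: "\<And>i. i \<in> Basis \<Longrightarrow> Ck_param n {0..1} \<Lambda> (A i)"
    and bound: "\<And>s l w. s \<in> {0..1} \<Longrightarrow> l \<in> \<Lambda> \<Longrightarrow> norm (\<Sum>i\<in>Basis. (w \<bullet> i) *\<^sub>R A i s l) \<le> q * norm w"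
    and B: "Ck_param n {0..1} \<Lambda> B"
    and Z: "\<And>l. l \<in> \<Lambda> \<Longrightarrow> int_sol (\<lambda>s w. (\<Sum>i\<in>Basis. (w \<bullet> i) *\<^sub>R A i s l) + B s l) (\<lambda>s. Z s l)"
  shows "Ck_param n {0..1} \<Lambda> Z"
  using A B Z
proof (induction n arbitrary: B Z)
  case (0 B Z)
  have lip: "norm (((\<Sum>i\<in>Basis. (a \<bullet> i) *\<^sub>R A i s l) + B s l) - ((\<Sum>i\<in>Basis. (b \<bullet> i) *\<^sub>R A i s l) + B s l)) \<le> q * norm (a - b)"
    if "s \<in> {0..1}" "l \<in> \<Lambda>" for s l a b
    using bound[OF that, of "a - b"] by (simp add: sum_subtractf inner_diff_left scaleR_diff_left)
  have c1: "continuous_on ({0..1} \<times> (\<Lambda> \<times> (UNIV :: 'g set))) (\<lambda>z. K (fst z) (fst (snd z)))"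
    if "continuous_on ({0..1} \<times> \<Lambda>) (\<lambda>z. K (fst z) (snd z))" for K :: "real \<Rightarrow> 'l \<Rightarrow> 'g"
    by (rule continuous_on_param_compose[where k = "\<lambda>p x. fst x", OF that]) (auto intro!: continuous_intros)
  have "continuous_on ({0..1} \<times> \<Lambda>) (\<lambda>z. Z (fst z) (snd z))"
  proof (rule int_sol_continuous[where F = "\<lambda>s x. (\<Sum>i\<in>Basis. (snd x \<bullet> i) *\<^sub>R A i s (fst x)) + B s (fst x)", OF _ _ q])
    show "continuous_on ({0..1} \<times> \<Lambda> \<times> UNIV) (\<lambda>z. (\<Sum>i\<in>Basis. (snd (snd z) \<bullet> i) *\<^sub>R A i (fst z) (fst (snd z))) + B (fst z) (fst (snd z)))"
      using 0 by (intro continuous_intros c1) auto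
  qed (use lip 0 in auto)
  then show ?case by simp
next
  case (Suc n B Z)
  note dA = Ck_param_SucD[OF Suc.prems(1)] and dB = Ck_param_SucD[OF Suc.prems(2)]
  have Zn: "Ck_param n {0..1} \<Lambda> Z"
    by (rule Suc.IH[OF Ck_param_Suc_imp[OF Suc.prems(1)] Ck_param_Suc_imp[OF Suc.prems(2)] Suc.prems(3)])
  have op: "open (\<Lambda> \<times> (UNIV :: 'g set))" using \<Lambda> by (intro open_Times) auto
  define F where "F s x = (\<Sum>i\<in>Basis. (snd x \<bullet> i) *\<^sub>R A i s (fst x)) + B s (fst x)" for s x
  define B' where "B' v s l = (\<Sum>i\<in>Basis. (Z s l \<bullet> i) *\<^sub>R \<D> (A i s) l v)
      + \<D> (B s) l v" for v s l
  have B'n: "Ck_param n {0..1} \<Lambda> (B' v)" for v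
    unfolding B'_def
    by (intro Ck_param_add[OF \<Lambda>] Ck_param_sum[OF \<Lambda>] Ck_param_bilinear[OF \<Lambda> bounded_bilinear_scaleR]
        Ck_param_bounded_linear[OF \<Lambda> bounded_linear_inner_left Zn] dA(2) dB(2))
  have lf: "Ck_param (Suc n) {0..1} (\<Lambda> \<times> (UNIV :: 'g set)) (\<lambda>p x. K p (fst x))" if "Ck_param (Suc n) {0..1} \<Lambda> K" for K :: "real \<Rightarrow> 'l \<Rightarrow> 'g"
    by (rule Ck_param_compose[where F = K and k = "\<lambda>p. fst", OF op \<Lambda> that Ck_param_linear_id[OF op bounded_linear_fst]]) auto
  have Fn: "Ck_param (Suc n) {0..1} (\<Lambda> \<times> (UNIV :: 'g set)) F"
    unfolding F_def
    by (intro Ck_param_add[OF op] Ck_param_sum[OF op] Ck_param_bilinear[OF op bounded_bilinear_scaleR] lf Suc.prems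
        Ck_param_bounded_linear[OF op bounded_linear_inner_left Ck_param_linear_id[OF op bounded_linear_snd]])
  have F1: "Ck_param (Suc 0) {0..1} (\<Lambda> \<times> (UNIV :: 'g set)) F" 
    using Fn by (induction n) (auto intro: Ck_param_Suc_imp simp del: Ck_param.simps)
  have dF: "\<D> (F s) (l, Z s l) = (\<lambda>x. (\<Sum>i\<in>Basis. (snd x \<bullet> i) *\<^sub>R A i s l) + B' (fst x) s l)"
    if s: "s \<in> {0..1}" and l: "l \<in> \<Lambda>" for s l
  proof (rule frechet_derivative_at[symmetric])
    have f: "(fst has_derivative fst) (at (l, Z s l))"
      by (rule bounded_linear_imp_has_derivative[OF bounded_linear_fst])
    have a: "((\<lambda>x. A i s (fst x)) has_derivative (\<lambda>x. \<D> (A i s) l (fst x))) (at (l, Z s l))"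
      if "i \<in> Basis" for i
      using has_derivative_compose[OF f, of "A i s"] dA(1)[OF that s l] by simp
    have b: "((\<lambda>x. B s (fst x)) has_derivative (\<lambda>x. \<D> (B s) l (fst x))) (at (l, Z s l))"
      using has_derivative_compose[OF f, of "B s"] dB(1)[OF s l] by simp
    have i: "((\<lambda>x. snd x \<bullet> i) has_derivative (\<lambda>x. snd x \<bullet> i)) (at (l, Z s l))" for i
      by (intro bounded_linear_imp_has_derivative bounded_linear_compose[OF bounded_linear_inner_left bounded_linear_snd])
    have "((\<lambda>x. \<Sum>i\<in>Basis. (snd x \<bullet> i) *\<^sub>R A i s (fst x)) has_derivative
       (\<lambda>x. \<Sum>i\<in>Basis. (snd (l, Z s l) \<bullet> i) *\<^sub>R \<D> (A i s) l (fst x) + (snd x \<bullet> i) *\<^sub>R A i s (fst (l, Z s l)))) (at (l, Z s l))"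
      by (intro has_derivative_sum has_derivative_scaleR i a)
    from has_derivative_add[OF this b]
    show "(F s has_derivative (\<lambda>x. (\<Sum>i\<in>Basis. (snd x \<bullet> i) *\<^sub>R A i s l) + B' (fst x) s l)) (at (l, Z s l))"
      by (simp add: F_def[abs_def] B'_def sum.distrib add_ac)
  qed
  have "\<exists>W. int_sol (\<lambda>s w. (\<Sum>i\<in>Basis. (w \<bullet> i) *\<^sub>R A i s l) + B' v s l) W" if l: "l \<in> \<Lambda>" for l v
    by (rule linear_int_sol_exists[OF q l Ck_param_Suc_imp[OF Suc.prems(1)] B'n bound[OF _ l]])
  then have "\<forall>l v. \<exists>W. l \<in> \<Lambda> \<longrightarrow> int_sol (\<lambda>s w. (\<Sum>i\<in>Basis. (w \<bullet> i) *\<^sub>R A i s l) + B' v s l) W"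
    by simp
  then obtain W where W: "\<And>l v. l \<in> \<Lambda> \<Longrightarrow> int_sol (\<lambda>s w. (\<Sum>i\<in>Basis. (w \<bullet> i) *\<^sub>R A i s l) + B' v s l) (W l v)"
    unfolding choice_iff by blast
  have Wn: "Ck_param n {0..1} \<Lambda> (\<lambda>s l. W l v s)" for v
    by (rule Suc.IH[OF Ck_param_Suc_imp[OF Suc.prems(1)] B'n W])
  show ?case
  proof (rule Ck_param_SucI[OF \<Lambda> Ck_param_continuous[OF Zn] _ Wn])
    fix t :: real and l0 assume t: "t \<in> {0..1}" and l0: "l0 \<in> \<Lambda>"
    show "(Z t has_derivative (\<lambda>v. W l0 v t)) (at l0)"
    proof (rule int_sol_has_derivative[OF \<Lambda> l0 F1 Ck_param_continuous[OF Zn] _ q _ _ t])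
      show "int_sol (\<lambda>s a. F s (l, a)) (\<lambda>s. Z s l)" if "l \<in> \<Lambda>" for l
        using Suc.prems(3)[OF that] by (simp add: F_def)
      show "norm (\<D> (F s) (l0, Z s l0) (0, w)) \<le> q * norm w" if "s \<in> {0..1}" for s w
      proof -
        have "linear (\<D> (A i s) l0)" if i: "i \<in> Basis" for i
          using dA(1)[OF i \<open>s \<in> {0..1}\<close> l0] by (rule has_derivative_linear)
        moreover have "linear (\<D> (B s) l0)"
          using dB(1)[OF that l0] by (rule has_derivative_linear)
        ultimately have "B' 0 s l0 = 0" by (simp add: B'_def linear_0)
        then show ?thesis using bound[OF that l0, of w] by (simp add: dF[OF that l0])
      qed
      show "int_sol (\<lambda>s w. \<D> (F s) (l0, Z s l0) (v, w)) (\<lambda>s. W l0 v s)" for v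
        by (rule int_sol_cong[OF _ refl W[OF l0]]) (simp add: dF[OF _ l0])
    qed
  qed
qed

text \<open>Bootstrapping: the parameter derivative solves a linear equation whose coefficients are
  derivatives of \<open>F\<close> along \<open>y\<close>. If \<open>y\<close> is of class
  \<open>n\<close>, so are the coefficients, hence the derivative, and \<open>y\<close> is of class
  \<open>n + 1\<close>.\<close>

lemma int_sol_Ck_param:
  fixes F :: "real \<Rightarrow> 'l::euclidean_space \<times> 'g::euclidean_space \<Rightarrow> 'g"
    and y :: "real \<Rightarrow> 'l \<Rightarrow> 'g"
  assumes \<Lambda>: "open \<Lambda>" and q: "0 \<le> q" "q < 1"
    and F: "\<And>n. Ck_param n {0..1} (\<Lambda> \<times> UNIV) F"
    and cy: "continuous_on ({0..1} \<times> \<Lambda>) (\<lambda>z. y (fst z) (snd z))"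
    and y: "\<And>l. l \<in> \<Lambda> \<Longrightarrow> int_sol (\<lambda>s a. F s (l, a)) (\<lambda>s. y s l)"
    and bound: "\<And>s l w. s \<in> {0..1} \<Longrightarrow> l \<in> \<Lambda> \<Longrightarrow>
      norm (\<D> (F s) (l, y s l) (0, w)) \<le> q * norm w"
  shows "Ck_param n {0..1} \<Lambda> y"
    and "\<And>l v. l \<in> \<Lambda> \<Longrightarrow> int_sol (\<lambda>s w. \<D> (F s) (l, y s l) (v, w))
        (\<lambda>s. \<D> (y s) l v)"
proof -
  have op: "open (\<Lambda> \<times> (UNIV :: 'g set))" using \<Lambda> by (intro open_Times) auto
  define G where "G v s l = \<D> (F s) (l, y s l) v" for v s l
  have Gn: "Ck_param n {0..1} \<Lambda> (G v)" if "Ck_param n {0..1} \<Lambda> y" for n v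
  proof -
    have "Ck_param n {0..1} \<Lambda> (\<lambda>s l. (l, y s l))"
      by (intro Ck_param_Pair[OF \<Lambda>] that Ck_param_linear_id[OF \<Lambda>] bounded_linear_ident)
    from Ck_param_compose[OF \<Lambda> op Ck_param_SucD(2)[OF F] this] show ?thesis by (simp add: G_def[abs_def])
  qed
  have lin: "linear (\<lambda>v. G v s l)" if "s \<in> {0..1}" "l \<in> \<Lambda>" for s l
    unfolding G_def
    by (rule has_derivative_linear[OF Ck_param_SucD(1)[OF F that(1)]]) (use that in auto)
  have rep: "G (v, w) s l = (\<Sum>i\<in>Basis. (w \<bullet> i) *\<^sub>R G (0, i) s l) + G (v, 0) s l"
    if "s \<in> {0..1}" "l \<in> \<Lambda>" for s l v w
  proof -
    have lP: "linear (\<lambda>w. (0 :: 'l, w :: 'g))"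
      by (rule bounded_linear.linear[OF bounded_linear_Pair[OF bounded_linear_zero bounded_linear_ident]])
    have "linear (\<lambda>w. G (0, w) s l)"
      using linear_compose[OF lP lin[OF that]] by (simp add: o_def)
    from linear_eq_sum_Basis[OF this, of w]
    show ?thesis using linear_Pair_split[OF lin[OF that], of v w] by simp
  qed
  have bd: "norm (\<Sum>i\<in>Basis. (w \<bullet> i) *\<^sub>R G (0, i) s l) \<le> q * norm w"
    if "s \<in> {0..1}" "l \<in> \<Lambda>" for s l w
    using bound[OF that, of w] rep[OF that, of 0 w] linear_0[OF lin[OF that]]
    by (simp add: G_def zero_prod_def)
  have y0: "Ck_param 0 {0..1} \<Lambda> y" using cy by simp
  have "\<exists>W. int_sol (\<lambda>s w. (\<Sum>i\<in>Basis. (w \<bullet> i) *\<^sub>R G (0, i) s l) + G (v, 0) s l) W" if l: "l \<in> \<Lambda>" for l v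
    by (rule linear_int_sol_exists[OF q l Gn[OF y0] Gn[OF y0] bd[OF _ l]])
  then have "\<forall>l v. \<exists>W. l \<in> \<Lambda> \<longrightarrow> int_sol (\<lambda>s w. (\<Sum>i\<in>Basis. (w \<bullet> i) *\<^sub>R G (0, i) s l) + G (v, 0) s l) W"
    by simp
  then obtain W where W: "\<And>l v. l \<in> \<Lambda> \<Longrightarrow> int_sol (\<lambda>s w. (\<Sum>i\<in>Basis. (w \<bullet> i) *\<^sub>R G (0, i) s l) + G (v, 0) s l) (W l v)"
    unfolding choice_iff by blast
  have WG: "int_sol (\<lambda>s w. \<D> (F s) (l, y s l) (v, w)) (W l v)" if "l \<in> \<Lambda>" for l v
    by (rule int_sol_cong[OF rep[OF _ that, unfolded G_def, symmetric] refl W[OF that, unfolded G_def]])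
  have d: "(y t has_derivative (\<lambda>v. W l v t)) (at l)" if "t \<in> {0..1}" "l \<in> \<Lambda>" for t l
    by (rule int_sol_has_derivative[OF \<Lambda> that(2) F cy y q bound[OF _ that(2)] WG[OF that(2)] that(1)])
  have yn: "Ck_param n {0..1} \<Lambda> y" for n
  proof (induction n)
    case (Suc n)
    have "Ck_param n {0..1} \<Lambda> (\<lambda>s l. W l v s)" for v
      by (rule linear_int_sol_Ck_param[OF \<Lambda> q Gn[OF Suc] bd Gn[OF Suc] W])
    then show ?case
      by (intro Ck_param_SucI[OF \<Lambda> cy d])
  qed (use y0 in simp)
  then show "Ck_param n {0..1} \<Lambda> y" .
  show "int_sol (\<lambda>s w. \<D> (F s) (l, y s l) (v, w)) (\<lambda>s. \<D> (y s) l v)"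
    if l: "l \<in> \<Lambda>" for l v
  proof -
    have eq: "\<D> (y s) l v = W l v s" if "s \<in> {0..1}" for s
      using frechet_derivative_at[OF d[OF that l]] by metis
    show ?thesis
      by (rule int_sol_cong[OF refl eq[symmetric] WG[OF l]])
  qed
qed

section \<open>Local flows and closed two-forms\<close>

lemma int_sol_has_vector_derivative:
  assumes y: "int_sol F y" and c: "continuous_on {0..1} (\<lambda>s. F s (y s))" and t: "t \<in> {0..1}"
  shows "(y has_vector_derivative F t (y t)) (at t within {0..1})"
proof (rule has_vector_derivative_transform[OF t _ integral_has_vector_derivative[OF c t]])
  show "y x = integral {0..x} (\<lambda>s. F s (y s))" if "x \<in> {0..1}" for x
    using y that integral_unique[of "\<lambda>s. F s (y s)" "y x" "{0..x}"] by (simp add: int_sol_def)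
qed

text \<open>Integral solutions start at zero, so the unknown is a displacement; starting points have
  to be supplied through \<open>F\<close>, as is done in \<open>local_flow\<close>.\<close>

lemma int_sol_0:
  assumes "int_sol F y"
  shows "y 0 = 0"
proof -
  have "\<forall>t\<in>{0..1}. ((\<lambda>s. F s (y s)) has_integral y t) {0..t}"
    using assms by (simp add: int_sol_def)
  then have "((\<lambda>s. F s (y s)) has_integral y 0) {0..0}"
    by (rule bspec) simp
  then show ?thesis using has_integral_unique[OF _ has_integral_refl(2)[of "\<lambda>s. F s (y s)" "0::real"]] by simp
qed

text \<open>\<open>Y t (s, x)\<close> is the flow of \<open>s g\<close> at time \<open>t\<close>, that is, the flow of \<open>g\<close> at time \<open>s t\<close>, so
  negative \<open>s\<close> are included.\<close>

lemma local_flow: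
  fixes g :: "'g::euclidean_space \<Rightarrow> 'g"
  assumes g: "smooth_on UNIV g"
  obtains S Y where "open S" "(0, x0) \<in> S" "\<And>n. Ck_param n {0..1} S Y"
    "\<And>s x. (s, x) \<in> S \<Longrightarrow> Y 0 (s, x) = x"
    "\<And>x t. (0, x) \<in> S \<Longrightarrow> t \<in> {0..1} \<Longrightarrow> Y t (0, x) = x"
    "\<And>l t. l \<in> S \<Longrightarrow> t \<in> {0..1} \<Longrightarrow>
      ((\<lambda>t. Y t l) has_vector_derivative fst l *\<^sub>R g (Y t l)) (at t within {0..1})"
    "\<And>l t v. l \<in> S \<Longrightarrow> t \<in> {0..1} \<Longrightarrow>
      ((\<lambda>t. \<D> (Y t) l v) has_vector_derivative
        fst v *\<^sub>R g (Y t l) + fst l *\<^sub>R \<D> g (Y t l) (\<D> (Y t) l v))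
        (at t within {0..1})"
    "\<And>l v. l \<in> S \<Longrightarrow> \<D> (Y 0) l v = snd v"
proof -
  define K where "K = cball x0 1"
  have K: "compact K" "convex K" "closed K" "K \<noteq> {}" by (simp_all add: K_def)
  note dg = smooth_on_has_derivative[OF g UNIV_I]
  obtain L where L: "L \<ge> 0" "\<And>x w. x \<in> K \<Longrightarrow> norm (\<D> g x w) \<le> L * norm w"
    by (rule linear_family_bound[OF K(1) has_derivative_linear[OF dg]
          continuous_on_subset[OF smooth_on_continuous[OF smooth_on_frechet_derivative[OF g]] subset_UNIV]])
      (rule that)
  have lip: "norm (g a - g b) \<le> L * norm (a - b)" if "a \<in> K" "b \<in> K" for a b
  proof (rule differentiable_bound[OF K(2) _ _ that])
    show "(g has_derivative \<D> g x) (at x within K)" for x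
      by (rule has_derivative_at_withinI[OF dg])
    show "onorm (\<D> g x) \<le> L" if "x \<in> K" for x
      by (rule onorm_le[OF L(2)[OF that]])
  qed
  have "continuous_on K g" by (rule continuous_on_subset[OF smooth_on_continuous[OF g]]) simp
  then have "bounded (g ` K)" using compact_continuous_image K(1) compact_imp_bounded by blast
  then obtain M where M: "M > 0" "\<And>x. x \<in> K \<Longrightarrow> norm (g x) \<le> M"
    unfolding bounded_pos by blast
  \<comment> \<open>Existence by contraction needs a globally Lipschitz field. Precomposing with the
    nearest-point projection onto the convex set \<open>K\<close> keeps the Lipschitz constant and
    bounds the field. It spoils smoothness, so \<open>gt\<close> serves only for existence and
    continuity.\<close>
  define gt where "gt x = g (closest_point K x)" for x
  have cp: "closest_point K x \<in> K" for x using closest_point_in_set[OF K(3,4)] .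
  have gt_lip: "norm (gt a - gt b) \<le> L * norm (a - b)" for a b
  proof -
    have "norm (closest_point K a - closest_point K b) \<le> norm (a - b)"
      using closest_point_lipschitz[OF K(2,3,4), of a b] by (simp add: dist_norm)
    then show ?thesis unfolding gt_def
      using lip[OF cp cp, of a b] L(1) by (meson mult_left_mono order_trans)
  qed
  have gt_bd: "norm (gt x) \<le> M" for x unfolding gt_def by (rule M(2)[OF cp])
  have gt_eq: "gt x = g x" if "x \<in> K" for x
    unfolding gt_def using closest_point_self[OF that] by simp
  have gt_cont: "continuous_on UNIV gt"
  proof (rule lipschitz_on_continuous_on[OF lipschitz_onI[OF _ L(1)]])
    show "dist (gt x) (gt y) \<le> L * dist x y" for x y using gt_lip by (simp add: dist_norm)
  qed
  \<comment> \<open>For \<open>\<bar>s\<bar> \<le> \<epsilon>\<close> both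
    \<open>\<bar>s\<bar> * L\<close> and \<open>\<bar>s\<bar> * M\<close> are at most one half: the
    former is the contraction constant, the latter bounds the displacement.\<close>
  define \<epsilon> where "\<epsilon> = 1 / (2 * (L + M))"
  have LM: "L + M > 0" using L M by simp
  have \<epsilon>: "\<epsilon> > 0" using LM by (simp add: \<epsilon>_def)
  define \<Lambda> where "\<Lambda> = {-\<epsilon><..<\<epsilon>} \<times> ball x0 (1/2)"
  have op: "open \<Lambda>" unfolding \<Lambda>_def by (intro open_Times) auto
  have sM: "\<bar>fst l\<bar> * c \<le> 1/2" if "l \<in> \<Lambda>" "0 \<le> c" "c \<le> L + M" for l c
  proof -
    have "\<bar>fst l\<bar> \<le> \<epsilon>" using that(1) by (auto simp: \<Lambda>_def)
    then have "\<bar>fst l\<bar> * c \<le> \<epsilon> * (L + M)" using that \<epsilon> by (intro mult_mono) auto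
    also have "\<dots> = 1/2" using LM unfolding \<epsilon>_def by (simp add: field_simps)
    finally show ?thesis .
  qed
  \<comment> \<open>The parameter \<open>fst x\<close> is the pair of scaling factor and starting
    point, and \<open>snd x\<close> is the displacement from that point. Both parameters are thus
    treated alike by the dependence theorem.\<close>
  define F where "F s x = fst (fst x) *\<^sub>R g (snd (fst x) + snd x)" for s :: real and x :: "(real \<times> 'g) \<times> 'g"
  define Ft where "Ft s x = fst (fst x) *\<^sub>R gt (snd (fst x) + snd x)" for s :: real and x :: "(real \<times> 'g) \<times> 'g"
  have cFt: "continuous_on UNIV (\<lambda>x. Ft s x)" for s
    unfolding Ft_def by (intro continuous_intros continuous_on_compose2[OF gt_cont]) auto
  have Ft_lip: "norm (Ft s (l, a) - Ft s (l, b)) \<le> 1/2 * norm (a - b)" if l: "l \<in> \<Lambda>" for s l a b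
  proof -
    have "norm (Ft s (l, a) - Ft s (l, b)) = \<bar>fst l\<bar> * norm (gt (snd l + a) - gt (snd l + b))"
      by (simp add: Ft_def flip: scaleR_diff_right)
    also have "\<dots> \<le> \<bar>fst l\<bar> * (L * norm (a - b))"
      using gt_lip[of "snd l + a" "snd l + b"] by (intro mult_left_mono) auto
    also have "\<dots> = (\<bar>fst l\<bar> * L) * norm (a - b)" by simp
    also have "\<dots> \<le> 1/2 * norm (a - b)" using sM[OF l L(1)] M(1) by (intro mult_right_mono) auto
    finally show ?thesis .
  qed
  have cFt': "continuous_on (A \<times> B) (\<lambda>z. Ft (fst z) (h z))" if "continuous_on (A \<times> B) h"
    for h :: "real \<times> 'c::topological_space \<Rightarrow> (real \<times> 'g) \<times> 'g" and A B
    using continuous_on_compose2[OF cFt[of 0] that] by (simp add: Ft_def)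
  have "\<exists>w. int_sol (\<lambda>s a. Ft s (l, a)) w" if l: "l \<in> \<Lambda>" for l
  proof (rule int_sol_exists[of _ "1/2"])
    show "continuous_on ({0..1} \<times> UNIV) (\<lambda>z. Ft (fst z) (l, snd z))"
      by (intro cFt' continuous_intros)
  qed (use Ft_lip[OF l] in auto)
  then obtain w where w: "\<And>l. l \<in> \<Lambda> \<Longrightarrow> int_sol (\<lambda>s a. Ft s (l, a)) (w l)" by metis
  define y where "y s l = w l s" for s l
  have yt: "int_sol (\<lambda>s a. Ft s (l, a)) (\<lambda>s. y s l)" if "l \<in> \<Lambda>" for l
    using w[OF that] by (simp add: y_def)
  have cy: "continuous_on ({0..1} \<times> \<Lambda>) (\<lambda>z. y (fst z) (snd z))"
  proof (rule int_sol_continuous[where F = Ft and q = "1/2"])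
    show "continuous_on ({0..1} \<times> \<Lambda> \<times> UNIV) (\<lambda>z. Ft (fst z) (snd z))"
      by (intro cFt' continuous_intros)
  qed (use Ft_lip yt in auto)
  \<comment> \<open>Starting within one half of \<open>x0\<close> and moving by at most one half,
    the curve never leaves \<open>K\<close>. There \<open>gt\<close> agrees with \<open>g\<close>,
    so the curve solves the smooth equation. The integrand is bounded outright, whence the
    contraction constant zero.\<close>
  have ybd: "norm (y t l) \<le> 1/2" if l: "l \<in> \<Lambda>" and t: "t \<in> {0..1}" for l t
  proof -
    have "norm (y t l) \<le> (1/2) / (1 - 0)"
    proof (rule contraction_bound[OF _ _ _ _ _ _ t])
      show "continuous_on {0..1} (\<lambda>s. y s l)" using yt[OF l] by (simp add: int_sol_def)
      show "((\<lambda>s. Ft s (l, y s l)) has_integral y t l) {0..t}" if "t \<in> {0..1}" for t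
        using yt[OF l] that by (simp add: int_sol_def)
      show "norm (Ft s (l, y s l)) \<le> 0 * norm (y s l) + 1/2" for s
      proof -
        have "norm (Ft s (l, y s l)) \<le> \<bar>fst l\<bar> * M"
          using gt_bd by (simp add: Ft_def mult_left_mono)
        then show ?thesis using sM[OF l, of M] L M by simp
      qed
    qed auto
    then show ?thesis by simp
  qed
  have inK: "snd l + y t l \<in> K" if "l \<in> \<Lambda>" "t \<in> {0..1}" for l t
  proof -
    have "norm (snd l - x0) < 1/2"
      using that(1) by (auto simp: \<Lambda>_def dist_norm norm_minus_commute)
    then have "norm ((snd l - x0) + y t l) \<le> 1"
      using ybd[OF that] norm_triangle_ineq[of "snd l - x0" "y t l"] by linarith
    then show ?thesis unfolding K_def mem_cball dist_norm
      by (metis (no_types, opaque_lifting) add.commute add_diff_eq norm_minus_commute)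
  qed
  have yF: "int_sol (\<lambda>s a. F s (l, a)) (\<lambda>s. y s l)" if l: "l \<in> \<Lambda>" for l
  proof -
    have "Ft s (l, y s l) = F s (l, y s l)" if "s \<in> {0..1}" for s
      using gt_eq[OF inK[OF l that]] by (simp add: F_def Ft_def)
    then show ?thesis using yt[OF l] unfolding int_sol_def
      using has_integral_eq[of _ "\<lambda>s. Ft s (l, y s l)" "\<lambda>s. F s (l, y s l)"] by fastforce
  qed
  have UU: "smooth_on (UNIV :: ((real \<times> 'g) \<times> 'g) set) (\<lambda>x. fst (fst x) *\<^sub>R g (snd (fst x) + snd x))"
    by (intro smooth_on_scaleR smooth_on_fst smooth_on_snd smooth_on_ident smooth_on_add
        smooth_on_compose[OF _ _ g] open_UNIV UNIV_I)
  have Fn: "Ck_param n {0..1} (\<Lambda> \<times> UNIV) F" for n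
    using smooth_on_imp_Ck_param[OF smooth_on_subset[OF UU subset_UNIV]] by (simp add: F_def[abs_def])
  have dF: "\<D> (F s) p = (\<lambda>v. fst (fst p) *\<^sub>R
      \<D> g (snd (fst p) + snd p) (snd (fst v) + snd v) + fst (fst v) *\<^sub>R g (snd (fst p) + snd p))" for s p
  proof (rule frechet_derivative_at[symmetric])
    have 1: "((\<lambda>x. fst (fst x)) has_derivative (\<lambda>x. fst (fst x))) (at p)"
      by (intro bounded_linear_imp_has_derivative bounded_linear_compose[OF bounded_linear_fst bounded_linear_fst])
    have 2: "((\<lambda>x. snd (fst x) + snd x) has_derivative (\<lambda>x. snd (fst x) + snd x)) (at p)"
      by (intro bounded_linear_imp_has_derivative bounded_linear_add bounded_linear_snd
          bounded_linear_compose[OF bounded_linear_snd bounded_linear_fst])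
    show "(F s has_derivative (\<lambda>v. fst (fst p) *\<^sub>R
      \<D> g (snd (fst p) + snd p) (snd (fst v) + snd v) + fst (fst v) *\<^sub>R g (snd (fst p) + snd p))) (at p)"
      unfolding F_def[abs_def] by (rule has_derivative_scaleR[OF 1 has_derivative_compose[OF 2 dg]])
  qed
  have bd: "norm (\<D> (F s) (l, y s l) (0, v)) \<le> 1/2 * norm v" if "s \<in> {0..1}" "l \<in> \<Lambda>" for s l v
  proof -
    have "norm (\<D> (F s) (l, y s l) (0, v)) \<le> \<bar>fst l\<bar> * (L * norm v)"
      unfolding dF using L(2)[OF inK[OF that(2,1)], of v] by (simp add: mult_left_mono)
    also have "\<dots> = (\<bar>fst l\<bar> * L) * norm v" by simp
    also have "\<dots> \<le> 1/2 * norm v" using sM[OF that(2) L(1)] M(1) by (intro mult_right_mono) auto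
    finally show ?thesis .
  qed
  have q: "0 \<le> (1/2 :: real)" "(1/2 :: real) < 1" by simp_all
  have R1: "Ck_param n {0..1} \<Lambda> y" for n by (rule int_sol_Ck_param(1)[OF op q Fn cy yF bd])
  have R2: "int_sol (\<lambda>s w. \<D> (F s) (l, y s l) (v, w))
      (\<lambda>s. \<D> (y s) l v)" if "l \<in> \<Lambda>" for l v
    by (rule int_sol_Ck_param(2)[OF op q Fn cy yF bd that])
  define Y where "Y t l = snd l + y t l" for t l
  have Yn: "Ck_param n {0..1} \<Lambda> Y" for n
    unfolding Y_def[abs_def] by (intro Ck_param_add[OF op] R1 Ck_param_linear_id[OF op bounded_linear_snd])
  have dY: "\<D> (Y t) l v = snd v + \<D> (y t) l v"
    if "l \<in> \<Lambda>" "t \<in> {0..1}" for t l v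
  proof -
    have "(Y t has_derivative (\<lambda>v. snd v + \<D> (y t) l v)) (at l)"
      unfolding Y_def[abs_def]
      by (intro has_derivative_add bounded_linear_imp_has_derivative bounded_linear_snd Ck_param_SucD(1)[OF R1] that)
    then show ?thesis using frechet_derivative_at by metis
  qed
  have cyl: "continuous_on {0..1} (\<lambda>s. y s l)" if "l \<in> \<Lambda>" for l
    using yF[OF that] by (simp add: int_sol_def)
  show ?thesis
  proof (rule that[OF op _ Yn])
    show "(0, x0) \<in> \<Lambda>" using \<epsilon> by (simp add: \<Lambda>_def)
    show "Y 0 (s, x) = x" if "(s, x) \<in> \<Lambda>" for s x
      using int_sol_0[OF yF[OF that]] by (simp add: Y_def)
    show "Y t (0, x) = x" if "(0, x) \<in> \<Lambda>" "t \<in> {0..1}" for x t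
      using yF[OF that(1)] that(2) by (simp add: int_sol_def Y_def F_def)
    show "((\<lambda>t. Y t l) has_vector_derivative fst l *\<^sub>R g (Y t l)) (at t within {0..1})"
      if l: "l \<in> \<Lambda>" and t: "t \<in> {0..1}" for l t
    proof -
      have "continuous_on {0..1} (\<lambda>s. F s (l, y s l))"
        unfolding F_def
        by (intro continuous_intros continuous_on_compose2[OF smooth_on_continuous[OF g]] cyl[OF l]) auto
      from int_sol_has_vector_derivative[OF yF[OF l] this t]
      show ?thesis unfolding Y_def by (auto simp: F_def intro!: derivative_eq_intros)
    qed
    show "((\<lambda>t. \<D> (Y t) l v) has_vector_derivative
        fst v *\<^sub>R g (Y t l) + fst l *\<^sub>R \<D> g (Y t l) (\<D> (Y t) l v))
        (at t within {0..1})" if l: "l \<in> \<Lambda>" and t: "t \<in> {0..1}" for l t v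
    proof -
      have cz: "continuous_on {0..1} (\<lambda>s. \<D> (y s) l v)"
        using R2[OF l] by (simp add: int_sol_def)
      have "continuous_on {0..1} (\<lambda>s. \<D> (F s) (l, y s l) (v, \<D> (y s) l v))"
      proof -
        have e: "\<D> g (snd l + y s l) u
           = (\<Sum>i\<in>Basis. (u \<bullet> i) *\<^sub>R \<D> g (snd l + y s l) i)" for s u
          by (rule linear_eq_sum_Basis[OF has_derivative_linear[OF dg]])
        have cp: "continuous_on {0..1} (\<lambda>s. snd l + y s l)" by (intro continuous_intros cyl l)
        have cg: "continuous_on {0..1} (\<lambda>s. g (snd l + y s l))"
          by (rule continuous_on_compose2[OF smooth_on_continuous[OF g] cp subset_UNIV])
        have cdg: "continuous_on {0..1} (\<lambda>s. \<D> g (snd l + y s l) i)" for i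
          by (rule continuous_on_compose2[OF smooth_on_continuous[OF smooth_on_frechet_derivative[OF g]] cp subset_UNIV])
        have "continuous_on {0..1} (\<lambda>s. fst l *\<^sub>R (\<Sum>i\<in>Basis.
            ((snd v + \<D> (y s) l v) \<bullet> i) *\<^sub>R \<D> g (snd l + y s l) i)
            + fst v *\<^sub>R g (snd l + y s l))"
          by (intro continuous_intros cg cdg cz)
        then show ?thesis by (simp add: dF flip: e)
      qed
      from int_sol_has_vector_derivative[OF R2[OF l] this t]
      have 1: "((\<lambda>t. \<D> (y t) l v) has_vector_derivative
        fst v *\<^sub>R g (Y t l) + fst l *\<^sub>R \<D> g (Y t l) (\<D> (Y t) l v))
        (at t within {0..1})"
        by (simp add: dF dY[OF l t] Y_def add.commute)
      have 2: "((\<lambda>t. snd v + \<D> (y t) l v) has_vector_derivative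
        fst v *\<^sub>R g (Y t l) + fst l *\<^sub>R \<D> g (Y t l) (\<D> (Y t) l v))
        (at t within {0..1})"
        using has_vector_derivative_add[OF has_vector_derivative_const 1, of "snd v"] by simp
      show ?thesis
        by (rule has_vector_derivative_transform[OF t _ 2]) (simp add: dY[OF l])
    qed
    show "\<D> (Y 0) l v = snd v" if "l \<in> \<Lambda>" for l v
      using int_sol_0[OF R2[OF that, of v]] by (simp add: dY[OF that])
  qed
qed

text \<open>A curried form of closed two-forms, with slots into which curves and vector fields can
  be inserted. Antisymmetry carries linearity to the first slot, and the cyclic sum is the exterior
  derivative on constant vector fields.\<close>

definition closed_2form :: "('a::euclidean_space \<Rightarrow> 'a \<Rightarrow> 'a \<Rightarrow> real) \<Rightarrow> bool" where
  "closed_2form \<omega> \<longleftrightarrow>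
     (\<forall>x a. linear (\<omega> x a)) \<and> (\<forall>x a b. \<omega> x a b = - \<omega> x b a) \<and>
     (\<forall>a b. smooth_on UNIV (\<lambda>x. \<omega> x a b)) \<and>
     (\<forall>x a b c. \<D> (\<lambda>y. \<omega> y b c) x a
        + \<D> (\<lambda>y. \<omega> y c a) x b
        + \<D> (\<lambda>y. \<omega> y a b) x c = 0)"

lemma
  assumes "closed_2form \<omega>"
  shows closed_2form_linear: "linear (\<omega> x a)"
    and closed_2form_antisym: "\<omega> x a b = - \<omega> x b a"
    and closed_2form_smooth: "smooth_on UNIV (\<lambda>x. \<omega> x a b)"
    and closed_2form_closed: "\<D> (\<lambda>y. \<omega> y b c) x a
        + \<D> (\<lambda>y. \<omega> y c a) x b + \<D> (\<lambda>y. \<omega> y a b) x c = 0"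
  using assms unfolding closed_2form_def by blast+

lemma closed_2form_linear_left:
  assumes "closed_2form \<omega>"
  shows "linear (\<lambda>a. \<omega> x a b)"
proof -
  have "(\<lambda>a. \<omega> x a b) = (\<lambda>a. - \<omega> x b a)" by (rule ext) (rule closed_2form_antisym[OF assms])
  then show ?thesis using linear_compose_neg[OF closed_2form_linear[OF assms, of x b]] by simp
qed

lemma closed_2form_expand:
  assumes "closed_2form \<omega>"
  shows "\<omega> x a b = (\<Sum>i\<in>Basis. \<Sum>j\<in>Basis. (a \<bullet> i) * ((b \<bullet> j) * \<omega> x i j))"
proof -
  have 1: "\<omega> x a b = (\<Sum>j\<in>Basis. (b \<bullet> j) * \<omega> x a j)" for a b
    using linear_eq_sum_Basis[OF closed_2form_linear[OF assms], of x a b] by simp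
  have 2: "\<omega> x a b = (\<Sum>i\<in>Basis. (a \<bullet> i) * \<omega> x i b)" for a b
    using linear_eq_sum_Basis[OF closed_2form_linear_left[OF assms], of x a b] by simp
  have "\<omega> x a b = (\<Sum>i\<in>Basis. (a \<bullet> i) * (\<Sum>j\<in>Basis. (b \<bullet> j) * \<omega> x i j))"
    unfolding 2[of a b] by (intro sum.cong refl arg_cong2[where f = "(*)"] 1)
  then show ?thesis by (simp add: sum_distrib_left)
qed

lemma closed_2form_derivative_expand:
  assumes cl: "closed_2form \<omega>"
  shows "\<D> (\<lambda>y. \<omega> y a b) x c
    = (\<Sum>i\<in>Basis. \<Sum>j\<in>Basis. (a \<bullet> i) * ((b \<bullet> j) * \<D> (\<lambda>y. \<omega> y i j) x c))"
proof -
  have e: "(\<lambda>y. \<omega> y a b) = (\<lambda>y. \<Sum>i\<in>Basis. \<Sum>j\<in>Basis. (a \<bullet> i) * ((b \<bullet> j) * \<omega> y i j))"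
    by (intro ext closed_2form_expand[OF cl])
  have "((\<lambda>y. \<Sum>i\<in>Basis. \<Sum>j\<in>Basis. (a \<bullet> i) * ((b \<bullet> j) * \<omega> y i j)) has_derivative
     (\<lambda>c. \<Sum>i\<in>Basis. \<Sum>j\<in>Basis. (a \<bullet> i) * ((b \<bullet> j) * \<D> (\<lambda>y. \<omega> y i j) x c))) (at x)"
    by (intro has_derivative_sum has_derivative_mult_right
        smooth_on_has_derivative[OF closed_2form_smooth[OF cl] UNIV_I])
  from fun_cong[OF frechet_derivative_at[OF this], of c, symmetric]
  show ?thesis unfolding e .
qed

text \<open>Expansion in the basis reduces the product rule in point and both slots to that for
  products of three scalar functions.\<close>

lemma closed_2form_along_curve:
  assumes cl: "closed_2form \<omega>"
    and Y: "(Y has_vector_derivative Y') (at t within S)"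
    and A: "(A has_vector_derivative A') (at t within S)"
    and B: "(B has_vector_derivative B') (at t within S)"
  shows "((\<lambda>t. \<omega> (Y t) (A t) (B t)) has_vector_derivative
    \<D> (\<lambda>y. \<omega> y (A t) (B t)) (Y t) Y' + \<omega> (Y t) A' (B t) + \<omega> (Y t) (A t) B') (at t within S)"
proof -
  have comp: "((\<lambda>t. f t \<bullet> i) has_vector_derivative f' \<bullet> i) (at t within S)"
    if "(f has_vector_derivative f') (at t within S)" for f f' and i :: 'a
    by (rule bounded_linear.has_vector_derivative[OF bounded_linear_inner_left that])
  have w: "((\<lambda>t. \<omega> (Y t) i j) has_vector_derivative \<D> (\<lambda>y. \<omega> y i j) (Y t) Y') (at t within S)" for i j
    using vector_derivative_diff_chain_within[OF Y has_derivative_at_withinI[OF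
        smooth_on_has_derivative[OF closed_2form_smooth[OF cl] UNIV_I]]]
    by (simp add: o_def)
  let ?d = "\<lambda>i j. \<D> (\<lambda>y. \<omega> y i j) (Y t) Y'"
  have 1: "((\<lambda>t. \<Sum>i\<in>Basis. \<Sum>j\<in>Basis. (A t \<bullet> i) * ((B t \<bullet> j) * \<omega> (Y t) i j)) has_vector_derivative
    (\<Sum>i\<in>Basis. \<Sum>j\<in>Basis. (A t \<bullet> i) * ((B t \<bullet> j) * ?d i j + (B' \<bullet> j) * \<omega> (Y t) i j)
        + (A' \<bullet> i) * ((B t \<bullet> j) * \<omega> (Y t) i j))) (at t within S)"
    by (intro has_vector_derivative_sum has_vector_derivative_mult comp A B w)
  have 2: "(\<Sum>i\<in>Basis. \<Sum>j\<in>Basis. (A t \<bullet> i) * ((B t \<bullet> j) * ?d i j + (B' \<bullet> j) * \<omega> (Y t) i j)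
        + (A' \<bullet> i) * ((B t \<bullet> j) * \<omega> (Y t) i j))
     = \<D> (\<lambda>y. \<omega> y (A t) (B t)) (Y t) Y' + \<omega> (Y t) A' (B t) + \<omega> (Y t) (A t) B'"
    unfolding closed_2form_derivative_expand[OF cl, of "A t" "B t"]
      closed_2form_expand[OF cl, of "Y t" A' "B t"] closed_2form_expand[OF cl, of "Y t" "A t" B']
    by (simp add: sum.distrib distrib_left)
  have e: "(\<lambda>t. \<omega> (Y t) (A t) (B t)) = (\<lambda>t. \<Sum>i\<in>Basis. \<Sum>j\<in>Basis. (A t \<bullet> i) * ((B t \<bullet> j) * \<omega> (Y t) i j))"
    by (intro ext closed_2form_expand[OF cl])
  show ?thesis
    unfolding e by (rule 1[unfolded 2])
qed

text \<open>Cartan's formula: the Lie derivative of \<open>\<omega>\<close> along \<open>g\<close> vanishes.\<close>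

lemma closed_2form_Lie_derivative:
  assumes cl: "closed_2form \<omega>" and g: "smooth_on UNIV g" and ker: "\<And>x b. \<omega> x (g x) b = 0"
  shows "\<D> (\<lambda>y. \<omega> y a b) x (g x)
     + \<omega> x (\<D> g x a) b + \<omega> x a (\<D> g x b) = 0"
proof -
  note anti = closed_2form_antisym[OF cl]
  \<comment> \<open>Differentiating the identity \<open>\<omega> y (g y) b = 0\<close> along the
    line through \<open>x\<close> in direction \<open>c\<close> trades the derivative of the
    coefficients for a derivative of \<open>g\<close>. This plays the part of the vanishing
    contraction in Cartan's formula.\<close>
  have k: "\<D> (\<lambda>y. \<omega> y (g x) b) x c = - \<omega> x (\<D> g x c) b" for b c
  proof -
    have line: "((\<lambda>s. x + s *\<^sub>R c) has_vector_derivative c) (at 0 within UNIV)"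
      by (auto intro!: derivative_eq_intros)
    have gl: "((\<lambda>s. g (x + s *\<^sub>R c)) has_vector_derivative \<D> g x c) (at 0 within UNIV)"
      using vector_derivative_diff_chain_within[OF line has_derivative_at_withinI[OF
        smooth_on_has_derivative[OF g UNIV_I]]] by (simp add: o_def)
    have "((\<lambda>s. \<omega> (x + s *\<^sub>R c) (g (x + s *\<^sub>R c)) b) has_vector_derivative
      \<D> (\<lambda>y. \<omega> y (g (x + 0 *\<^sub>R c)) b) (x + 0 *\<^sub>R c) c
        + \<omega> (x + 0 *\<^sub>R c) (\<D> g x c) b + \<omega> (x + 0 *\<^sub>R c) (g (x + 0 *\<^sub>R c)) 0) (at 0 within UNIV)"
      by (rule closed_2form_along_curve[OF cl line gl has_vector_derivative_const])
    moreover have "((\<lambda>s. \<omega> (x + s *\<^sub>R c) (g (x + s *\<^sub>R c)) b) has_vector_derivative 0) (at 0)"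
      by (simp add: ker)
    ultimately show ?thesis
      using vector_derivative_at by (fastforce simp: ker)
  qed
  have "\<D> (\<lambda>y. \<omega> y a b) x (g x) + \<D> (\<lambda>y. \<omega> y b (g x)) x a
      + \<D> (\<lambda>y. \<omega> y (g x) a) x b = 0"
    by (rule closed_2form_closed[OF cl])
  moreover have "\<D> (\<lambda>y. \<omega> y b (g x)) x a = - \<D> (\<lambda>y. \<omega> y (g x) b) x a"
  proof -
    have "((\<lambda>y. - \<omega> y (g x) b) has_derivative (\<lambda>h. - \<D> (\<lambda>y. \<omega> y (g x) b) x h)) (at x)"
      by (intro has_derivative_minus smooth_on_has_derivative[OF closed_2form_smooth[OF cl]] UNIV_I)
    from frechet_derivative_at[OF this]
    have "\<D> (\<lambda>y. - \<omega> y (g x) b) x a = - \<D> (\<lambda>y. \<omega> y (g x) b) x a"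
      by metis
    then show ?thesis by (simp flip: anti)
  qed
  ultimately show ?thesis
    using anti[of x a "\<D> g x b"] by (simp add: k)
qed

text \<open>Along a flow line the pulled-back form changes by \<open>fst l\<close> times the Lie
  derivative, which vanishes, plus terms with \<open>g\<close> in a slot, which vanish as well.
  Hence it keeps its value at time zero, where the flow derivative is \<open>snd\<close>. The form
  is quantified inside because the same box must serve every form with \<open>g\<close> in its
  kernel.\<close>

lemma flow_box:
  fixes g :: "'g::euclidean_space \<Rightarrow> 'g"
  assumes g: "smooth_on UNIV g"
  obtains S \<Phi> where "open S" "(0, x0) \<in> S" "smooth_on S \<Phi>"
    "\<And>x. (0, x) \<in> S \<Longrightarrow> \<Phi> (0, x) = x"
    "\<And>v. \<D> \<Phi> (0, x0) v = snd v + fst v *\<^sub>R g x0"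
    "\<And>\<omega> l v w. closed_2form \<omega> \<Longrightarrow> (\<And>x b. \<omega> x (g x) b = 0) \<Longrightarrow> l \<in> S \<Longrightarrow>
      \<omega> (\<Phi> l) (\<D> \<Phi> l v) (\<D> \<Phi> l w) = \<omega> (snd l) (snd v) (snd w)"
proof -
  obtain S Y where S: "open S" "(0, x0) \<in> S" and Yn: "\<And>n. Ck_param n {0..1} S Y"
    and Y0: "\<And>s x. (s, x) \<in> S \<Longrightarrow> Y 0 (s, x) = x"
    and Yx: "\<And>x t. (0, x) \<in> S \<Longrightarrow> t \<in> {0..1} \<Longrightarrow> Y t (0, x) = x"
    and Yd: "\<And>l t. l \<in> S \<Longrightarrow> t \<in> {0..1} \<Longrightarrow>
      ((\<lambda>t. Y t l) has_vector_derivative fst l *\<^sub>R g (Y t l)) (at t within {0..1})"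
    and Zd: "\<And>l t v. l \<in> S \<Longrightarrow> t \<in> {0..1} \<Longrightarrow>
      ((\<lambda>t. \<D> (Y t) l v) has_vector_derivative
        fst v *\<^sub>R g (Y t l) + fst l *\<^sub>R \<D> g (Y t l) (\<D> (Y t) l v))
        (at t within {0..1})"
    and Z0: "\<And>l v. l \<in> S \<Longrightarrow> \<D> (Y 0) l v = snd v"
    using local_flow[OF g, of x0] by blast
  show ?thesis
  proof (rule that[of S "Y 1"])
    show "smooth_on S (Y 1)"
      unfolding smooth_on_def using Ck_param_imp_Ck_on[OF Yn, of 1] by simp
    show "Y 1 (0, x) = x" if "(0, x) \<in> S" for x using Yx[OF that] by simp
    show "\<D> (Y 1) (0, x0) v = snd v + fst v *\<^sub>R g x0" for v
    proof -
      let ?Z = "\<lambda>t. \<D> (Y t) (0, x0) v"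
      \<comment> \<open>At scaling factor zero the flow stands still, and the variational equation
        reduces to the constant right-hand side \<open>fst v *\<^sub>R g x0\<close>.\<close>
      have H: "((\<lambda>t. ?Z t - t *\<^sub>R (fst v *\<^sub>R g x0)) has_vector_derivative 0) (at t within {0..1})" if t: "t \<in> {0..1}" for t
        using Zd[OF S(2) t, of v] Yx[OF S(2) t] by (auto intro!: derivative_eq_intros)
      obtain c where "\<And>t. t \<in> {0..1} \<Longrightarrow> ?Z t - t *\<^sub>R (fst v *\<^sub>R g x0) = c"
        by (rule has_vector_derivative_zero_constant[OF convex_real_interval(5) H]) (assumption, rule that)
      from this[of 0] this[of 1] show ?thesis using Z0[OF S(2), of v] by (simp add: algebra_simps)
    qed
    fix \<omega> l v w
    assume cl: "closed_2form \<omega>" and ker: "\<And>x b. \<omega> x (g x) b = 0" and l: "l \<in> S"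
    note anti = closed_2form_antisym[OF cl] and lin = closed_2form_linear[OF cl]
      and lin' = closed_2form_linear_left[OF cl]
    have ker': "\<omega> x a (g x) = 0" for x a using ker[of x a] anti[of x a "g x"] by simp
    let ?V = "\<lambda>t. \<D> (Y t) l v" and ?W = "\<lambda>t. \<D> (Y t) l w"
    have H: "((\<lambda>t. \<omega> (Y t l) (?V t) (?W t)) has_vector_derivative 0) (at t within {0..1})" if t: "t \<in> {0..1}" for t
    proof -
      have "linear (\<D> (\<lambda>y. \<omega> y (?V t) (?W t)) (Y t l))"
        by (rule has_derivative_linear[OF smooth_on_has_derivative[OF closed_2form_smooth[OF cl] UNIV_I]])
      then have "\<D> (\<lambda>y. \<omega> y (?V t) (?W t)) (Y t l) (fst l *\<^sub>R g (Y t l))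
         + \<omega> (Y t l) (fst v *\<^sub>R g (Y t l) + fst l *\<^sub>R \<D> g (Y t l) (?V t)) (?W t)
         + \<omega> (Y t l) (?V t) (fst w *\<^sub>R g (Y t l) + fst l *\<^sub>R \<D> g (Y t l) (?W t))
         = fst l * (\<D> (\<lambda>y. \<omega> y (?V t) (?W t)) (Y t l) (g (Y t l))
            + \<omega> (Y t l) (\<D> g (Y t l) (?V t)) (?W t)
            + \<omega> (Y t l) (?V t) (\<D> g (Y t l) (?W t)))"
        by (simp add: linear_add[OF lin] linear_cmul[OF lin] linear_add[OF lin'] linear_cmul[OF lin'] linear_cmul ker ker' distrib_left)
      also have "\<dots> = 0"
        using closed_2form_Lie_derivative[where \<omega> = \<omega>, OF cl g ker, of "?V t" "?W t" "Y t l"] by simp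
      finally show ?thesis
        using closed_2form_along_curve[OF cl Yd[OF l t] Zd[OF l t, of v] Zd[OF l t, of w]] by metis
    qed
    obtain c where "\<And>t. t \<in> {0..1} \<Longrightarrow> \<omega> (Y t l) (?V t) (?W t) = c"
      by (rule has_vector_derivative_zero_constant[OF convex_real_interval(5) H]) (assumption, rule that)
    from this[of 0] this[of 1]
    show "\<omega> (Y 1 l) (?V 1) (?W 1) = \<omega> (snd l) (snd v) (snd w)"
      using Z0[OF l] Y0[of "fst l" "snd l"] l by simp
  qed (use S in auto)
qed

section \<open>Smooth inverse functions and integrals with parameters\<close>

text \<open>Where the scalar factor vanishes, continuity of the other factor suffices for the
  product rule. This differentiates the inverse matrices below when only their continuity is
  known.\<close>

lemma has_derivative_scaleR_zero:
  fixes N :: "'a::real_normed_vector \<Rightarrow> 'b::real_normed_vector"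
  assumes k: "(k has_derivative k') (at y)" and k0: "k y = 0" and N: "isCont N y"
  shows "((\<lambda>z. k z *\<^sub>R N z) has_derivative (\<lambda>h. k' h *\<^sub>R N y)) (at y)"
proof -
  have "((\<lambda>z. k z *\<^sub>R (N z - N y)) has_derivative (\<lambda>h. 0)) (at y)"
    unfolding has_derivative_at_alt
  proof (intro conjI allI impI)
    fix e :: real assume e: "e > 0"
    have bl: "bounded_linear k'" using k by (rule has_derivative_bounded_linear)
    obtain K where K: "K > 0" "\<And>h. norm (k' h) \<le> norm h * K"
      using bounded_linear.pos_bounded[OF bl] by blast
    obtain d1 where d1: "d1 > 0" "\<And>z. norm (z - y) < d1 \<Longrightarrow> norm (k z - k y - k' (z - y)) \<le> 1 * norm (z - y)"
      using k unfolding has_derivative_at_alt using zero_less_one by blast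
    have "e / (K + 1) > 0" using e K by simp
    then obtain d2 where d2: "d2 > 0" "\<And>z. dist z y < d2 \<Longrightarrow> dist (N z) (N y) < e / (K + 1)"
      using N unfolding continuous_at_eps_delta by blast
    show "\<exists>d>0. \<forall>z. norm (z - y) < d \<longrightarrow> norm (k z *\<^sub>R (N z - N y) - k y *\<^sub>R (N y - N y) - 0) \<le> e * norm (z - y)"
    proof (intro exI[of _ "min d1 d2"] conjI allI impI)
      fix z assume z: "norm (z - y) < min d1 d2"
      have "\<bar>k z\<bar> \<le> (K + 1) * norm (z - y)"
        using d1(2)[of z] K(2)[of "z - y"] z k0 by (simp add: algebra_simps)
      moreover have "norm (N z - N y) \<le> e / (K + 1)"
        using d2(2)[of z] z by (simp add: dist_norm)
      ultimately have "\<bar>k z\<bar> * norm (N z - N y) \<le> ((K + 1) * norm (z - y)) * (e / (K + 1))"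
        using K by (intro mult_mono) auto
      then show "norm (k z *\<^sub>R (N z - N y) - k y *\<^sub>R (N y - N y) - 0) \<le> e * norm (z - y)"
        using K by (simp add: mult_ac)
    qed (use d1 d2 in auto)
  qed simp
  moreover have "((\<lambda>z. k z *\<^sub>R N y) has_derivative (\<lambda>h. k' h *\<^sub>R N y)) (at y)"
    by (rule has_derivative_scaleR_left[OF k])
  ultimately have "((\<lambda>z. k z *\<^sub>R N y + k z *\<^sub>R (N z - N y)) has_derivative (\<lambda>h. k' h *\<^sub>R N y + 0)) (at y)"
    by (rule has_derivative_add[rotated])
  then show ?thesis by (simp add: scaleR_diff_right)
qed

text \<open>\<open>N y\<close> is the inverse of the derivative of \<open>F\<close> at
  \<open>g y\<close>. The derivative of \<open>N\<close> is expressed through \<open>N\<close> and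
  the second derivatives of \<open>F\<close> at \<open>g y\<close>, so smoothness of
  \<open>g\<close> and \<open>N\<close> is obtained together by induction.\<close>

lemma smooth_on_inverse_function:
  fixes F :: "'a::euclidean_space \<Rightarrow> 'a"
  assumes S: "open S" and F: "smooth_on S F" and V: "open V" and gV: "g ` V \<subseteq> S"
    and dg: "\<And>y. y \<in> V \<Longrightarrow> (g has_derivative N y) (at y)"
    and NL: "\<And>y v. y \<in> V \<Longrightarrow> N y (\<D> F (g y) v) = v"
    and NR: "\<And>y v. y \<in> V \<Longrightarrow> \<D> F (g y) (N y v) = v"
  shows "smooth_on V g"
proof -
  define M where "M w x = \<D> F x w" for w x
  have gS: "g y \<in> S" if "y \<in> V" for y using gV that by auto
  have Ms: "smooth_on S (M w)" for w
    unfolding M_def by (rule smooth_on_frechet_derivative[OF F])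
  have linM: "linear (\<lambda>w. M w x)" if "x \<in> S" for x
    unfolding M_def by (rule has_derivative_linear[OF smooth_on_has_derivative[OF F that]])
  have linN: "linear (N y)" if "y \<in> V" for y by (rule has_derivative_linear[OF dg[OF that]])
  have NM: "N y (M v (g y)) = v" "M (N y v) (g y) = v" if "y \<in> V" for y v
    using NL[OF that] NR[OF that] by (simp_all add: M_def)
  have gcont: "isCont g y" if "y \<in> V" for y
    using dg[OF that] has_derivative_continuous by blast
  have Mcont: "isCont (\<lambda>z. M w (g z)) y" if "y \<in> V" for w y
  proof (rule isCont_o2[OF gcont[OF that]])
    show "isCont (M w) (g y)"
      using smooth_on_continuous[OF Ms] S gS[OF that] by (simp add: continuous_on_eq_continuous_at)
  qed
  have Ncont: "isCont (\<lambda>z. N z v) y" if y: "y \<in> V" for v y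
    unfolding continuous_at_eps_delta
  proof (intro allI impI)
    fix e :: real assume e: "e > 0"
    obtain K where K: "K > 0" "\<And>w. norm (N y w) \<le> norm w * K"
      using bounded_linear.pos_bounded[OF has_derivative_bounded_linear[OF dg[OF y]]] by blast
    \<comment> \<open>A perturbation of the matrix by \<open>\<delta>\<close> on each basis vector
      changes \<open>M w\<close> by at most \<open>norm w / (2 * K)\<close>. The nearby matrices are
      then bounded below, which bounds their inverses by \<open>2 * K\<close>.\<close>
    define \<delta> where "\<delta> = 1 / (2 * K * DIM('a))"
    have \<delta>: "\<delta> > 0" using K by (simp add: \<delta>_def)
    have ev: "\<forall>\<^sub>F z in at y. dist (M w (g z)) (M w (g y)) < c" if "c > 0" for w c
      using tendstoD[OF Mcont[OF y, of w, unfolded continuous_at] that] .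
    have c2: "min \<delta> (e / (2 * K)) > 0" using \<delta> e K by simp
    have "\<forall>\<^sub>F z in at y. z \<in> V \<and> (\<forall>i\<in>Basis. dist (M i (g z)) (M i (g y)) < \<delta>) \<and>
        dist (M (N y v) (g z)) (M (N y v) (g y)) < e / (2 * K)"
      using V y ev[OF \<delta>] ev[of "e / (2 * K)" "N y v"] e K
      by (intro eventually_conj eventually_ball_finite ballI eventually_at_in_open') auto
    then obtain d where d: "d > 0" and near: "\<And>z. z \<noteq> y \<Longrightarrow> dist z y < d \<Longrightarrow>
        z \<in> V \<and> (\<forall>i\<in>Basis. dist (M i (g z)) (M i (g y)) < \<delta>) \<and>
        dist (M (N y v) (g z)) (M (N y v) (g y)) < e / (2 * K)"
      unfolding eventually_at by blast
    show "\<exists>d>0. \<forall>z. dist z y < d \<longrightarrow> dist (N z v) (N y v) < e"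
    proof (intro exI[of _ d] conjI allI impI d)
      fix z assume z: "dist z y < d"
      show "dist (N z v) (N y v) < e"
      proof (cases "z = y")
        case False
        note n = near[OF False z]
        then have zV: "z \<in> V" by simp
        have inv: "norm w \<le> 2 * K * norm (M w (g z))" for w
        proof -
          have "w = N y (M w (g z)) - N y (M w (g z) - M w (g y))"
            by (simp add: linear_diff[OF linN[OF y]] NM[OF y])
          then have "norm w \<le> norm (N y (M w (g z))) + norm (N y (M w (g z) - M w (g y)))"
            by (metis norm_triangle_ineq4)
          also have "\<dots> \<le> K * norm (M w (g z)) + K * norm (M w (g z) - M w (g y))"
            using K(2) by (metis add_mono mult.commute)
          also have "norm (M w (g z) - M w (g y)) \<le> (\<delta> * DIM('a)) * norm w"
          proof -
            have l: "linear (\<lambda>w. M w (g z) - M w (g y))"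
              by (intro linear_compose_sub linM gS zV y)
            show ?thesis
              using norm_sum_Basis_le[of "\<lambda>i. M i (g z) - M i (g y)" \<delta> w] n
              by (subst linear_eq_sum_Basis[OF l]) (auto simp: dist_norm less_imp_le)
          qed
          finally have "norm w \<le> K * norm (M w (g z)) + K * ((\<delta> * DIM('a)) * norm w)"
            using K by (simp add: mult_left_mono)
          moreover have "K * ((\<delta> * DIM('a)) * norm w) = norm w / 2"
            using K by (simp add: \<delta>_def field_simps)
          ultimately show ?thesis by linarith
        qed
        have "M (N z v - N y v) (g z) = M (N y v) (g y) - M (N y v) (g z)"
          using linear_diff[OF linM[OF gS[OF zV]], of "N z v" "N y v"] by (simp add: NM[OF zV] NM[OF y])
        then have "norm (N z v - N y v) \<le> 2 * K * norm (M (N y v) (g y) - M (N y v) (g z))"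
          using inv[of "N z v - N y v"] by simp
        also have "\<dots> < 2 * K * (e / (2 * K))"
          using n K by (intro mult_strict_left_mono) (auto simp: dist_norm norm_minus_commute)
        also have "\<dots> = e" using K by simp
        finally show ?thesis by (simp add: dist_norm)
      qed (use e in auto)
    qed
  qed
  define H where "H k j x = \<D> (M k) x j" for k j x
  have Hs: "smooth_on S (H k j)" for k j
    unfolding H_def by (rule smooth_on_frechet_derivative[OF Ms])
  define D where "D v y h = - (\<Sum>i\<in>Basis. ((\<Sum>k\<in>Basis. \<Sum>j\<in>Basis. ((N y v \<bullet> k) * (N y h \<bullet> j)) *\<^sub>R H k j (g y)) \<bullet> i) *\<^sub>R N y i)" for v y h
  have dN: "((\<lambda>z. N z v) has_derivative D v y) (at y)" if y: "y \<in> V" for v y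
  proof -
    define w where "w = N y v"
    have dM: "(M w has_derivative (\<lambda>u. \<Sum>k\<in>Basis. \<Sum>j\<in>Basis. ((w \<bullet> k) * (u \<bullet> j)) *\<^sub>R H k j (g y))) (at (g y))"
    proof -
      have "((\<lambda>x. \<Sum>k\<in>Basis. (w \<bullet> k) *\<^sub>R M k x) has_derivative (\<lambda>u. \<Sum>k\<in>Basis. (w \<bullet> k) *\<^sub>R \<D> (M k) (g y) u)) (at (g y))"
        by (intro has_derivative_sum has_derivative_scaleR_right smooth_on_has_derivative[OF Ms] gS y)
      moreover have "\<D> (M k) (g y) u = (\<Sum>j\<in>Basis. (u \<bullet> j) *\<^sub>R H k j (g y))" for k u
        unfolding H_def by (rule linear_eq_sum_Basis[OF has_derivative_linear[OF smooth_on_has_derivative[OF Ms gS[OF y]]]])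
      ultimately have "((\<lambda>x. \<Sum>k\<in>Basis. (w \<bullet> k) *\<^sub>R M k x) has_derivative (\<lambda>u. \<Sum>k\<in>Basis. \<Sum>j\<in>Basis. ((w \<bullet> k) * (u \<bullet> j)) *\<^sub>R H k j (g y))) (at (g y))"
        by (simp add: scaleR_sum_right)
      then show ?thesis
        by (rule has_derivative_transform_within_open[OF _ S gS[OF y]])
          (rule linear_eq_sum_Basis[OF linM, symmetric])
    qed
    define k where "k i z = (M w (g z) - M w (g y)) \<bullet> i" for i z
    define k' where "k' i h = (\<Sum>k\<in>Basis. \<Sum>j\<in>Basis. ((w \<bullet> k) * (N y h \<bullet> j)) *\<^sub>R H k j (g y)) \<bullet> i" for i h
    have dk: "(k i has_derivative k' i) (at y)" for i
    proof -
      have "((\<lambda>z. M w (g z) - M w (g y)) has_derivative (\<lambda>h. (\<Sum>k\<in>Basis. \<Sum>j\<in>Basis. ((w \<bullet> k) * (N y h \<bullet> j)) *\<^sub>R H k j (g y)) - 0)) (at y)"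
        by (rule has_derivative_diff[OF has_derivative_compose[OF dg[OF y] dM] has_derivative_const])
      from has_derivative_inner_left[OF this, of i]
      show ?thesis by (simp add: k_def[abs_def] k'_def[abs_def])
    qed
    have fin: "((\<lambda>z. w + - (\<Sum>i\<in>Basis. k i z *\<^sub>R N z i)) has_derivative (\<lambda>h. 0 + - (\<Sum>i\<in>Basis. k' i h *\<^sub>R N y i))) (at y)"
      by (intro has_derivative_add has_derivative_const has_derivative_minus has_derivative_sum
          has_derivative_scaleR_zero dk Ncont y) (simp add: k_def)
    have fin': "((\<lambda>z. w + - (\<Sum>i\<in>Basis. k i z *\<^sub>R N z i)) has_derivative D v y) (at y)"
      using fin by (simp add: D_def[abs_def] k'_def w_def)
    \<comment> \<open>Resolvent identity: the difference of two inverses is, up to sign, one inverse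
      applied to the difference of the matrices applied to the other. The middle factor vanishes at
      \<open>y\<close>, so \<open>has_derivative_scaleR_zero\<close> differentiates the right-hand
      side.\<close>
    have eq: "w + - (\<Sum>i\<in>Basis. k i z *\<^sub>R N z i) = N z v" if z: "z \<in> V" for z
    proof -
      have "(\<Sum>i\<in>Basis. k i z *\<^sub>R N z i) = N z (M w (g z) - M w (g y))"
        unfolding k_def by (rule linear_eq_sum_Basis[OF linN[OF z], symmetric])
      also have "\<dots> = w - N z v"
        by (simp add: linear_diff[OF linN[OF z]] NM[OF z]) (simp add: w_def NM[OF y])
      finally show ?thesis by simp
    qed
    show ?thesis
      by (rule has_derivative_transform_within_open[OF fin' V y eq])
  qed
  have "Ck_param n {0::real} V (\<lambda>p. g) \<and> (\<forall>v. Ck_param n {0::real} V (\<lambda>p y. N y v))" for n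
  proof (induction n)
    case 0
    have cg: "continuous_on V g" and cN: "continuous_on V (\<lambda>y. N y v)" for v
      using gcont Ncont V by (auto simp: continuous_on_eq_continuous_at)
    show ?case by (simp add: continuous_on_snd_param[OF cN] continuous_on_snd_param[OF cg])
  next
    case (Suc n)
    then have gn: "Ck_param n {0::real} V (\<lambda>p. g)" and Nn: "\<And>v. Ck_param n {0::real} V (\<lambda>p y. N y v)" by auto
    have cg: "continuous_on V g" and cN: "continuous_on V (\<lambda>y. N y v)" for v
      using gcont Ncont V by (auto simp: continuous_on_eq_continuous_at)
    have "Ck_param (Suc n) {0::real} V (\<lambda>p. g)"
      by (rule Ck_param_SucI[OF V continuous_on_snd_param[OF cg] dg Nn])
    moreover have "Ck_param (Suc n) {0::real} V (\<lambda>p y. N y v)" for v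
    proof (rule Ck_param_SucI[OF V continuous_on_snd_param[OF cN] dN])
      have Hg: "Ck_param n {0::real} V (\<lambda>p y. H k j (g y))" for k j
        by (rule Ck_param_compose[where F = "\<lambda>p. H k j" and k = "\<lambda>p. g", OF V S smooth_on_imp_Ck_param[OF Hs] gn gS])
      have i: "Ck_param n {0::real} V (\<lambda>p y. N y v \<bullet> i)" for v i
        by (rule Ck_param_bounded_linear[OF V bounded_linear_inner_left Nn])
      have s: "Ck_param n {0::real} V (\<lambda>p y. (N y v \<bullet> k) * (N y h \<bullet> j))" for v k h j
        by (rule Ck_param_bilinear[OF V bounded_bilinear_mult i i])
      have t: "Ck_param n {0::real} V (\<lambda>p y. \<Sum>k\<in>Basis. \<Sum>j\<in>Basis. ((N y v \<bullet> k) * (N y h \<bullet> j)) *\<^sub>R H k j (g y))" for h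
        by (intro Ck_param_sum[OF V] Ck_param_bilinear[OF V bounded_bilinear_scaleR s Hg])
      have "Ck_param n {0::real} V (\<lambda>p y. \<Sum>i\<in>Basis. ((\<Sum>k\<in>Basis. \<Sum>j\<in>Basis. ((N y v \<bullet> k) * (N y h \<bullet> j)) *\<^sub>R H k j (g y)) \<bullet> i) *\<^sub>R N y i)" for h
        by (intro Ck_param_sum[OF V] Ck_param_bilinear[OF V bounded_bilinear_scaleR] Nn
            Ck_param_bounded_linear[OF V bounded_linear_inner_left t])
      then show "Ck_param n {0::real} V (\<lambda>p y. D v y h)" for h
        unfolding D_def by (rule Ck_param_bounded_linear[OF V bounded_linear_minus[OF bounded_linear_ident]])
    qed
    ultimately show ?case by simp
  qed
  then show ?thesis by (simp add: smooth_on_iff)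
qed

text \<open>A linear isomorphism \<open>h\<close> between the two spaces turns \<open>f\<close> into
  a self-map \<open>F\<close>, to which the inverse function theorem applies; smoothness of the
  local inverse comes from \<open>smooth_on_inverse_function\<close>.\<close>

lemma inverse_function_coordinates:
  fixes f :: "'a::euclidean_space \<Rightarrow> 'b::euclidean_space"
  assumes S: "open S" "x0 \<in> S" and f: "smooth_on S f" and dim: "DIM('a) = DIM('b)"
    and inj: "\<And>v. \<D> f x0 v = 0 \<Longrightarrow> v = 0"
  obtains U where "x0 \<in> U" "U \<subseteq> S" "coordinates_on U f"
proof -
  obtain h :: "'b \<Rightarrow> 'a" and hi where h: "linear h" "linear hi" "\<And>x. hi (h x) = x" "\<And>x. h (hi x) = x"
    using isomorphisms_UNIV_UNIV[OF dim[symmetric]] by metis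
  have bh: "bounded_linear h" "bounded_linear hi" using h by (simp_all add: linear_conv_bounded_linear)
  define F where "F x = h (f x)" for x
  have Fs: "smooth_on S F"
    unfolding F_def by (rule smooth_on_bounded_linear[OF S(1) bh(1) f])
  define F' where "F' x = Blinfun (\<D> F x)" for x
  have F': "blinfun_apply (F' x) = \<D> F x" if "x \<in> S" for x
    unfolding F'_def
    by (rule bounded_linear_Blinfun_apply[OF has_derivative_bounded_linear[OF smooth_on_has_derivative[OF Fs that]]])
  have dF: "(F has_derivative blinfun_apply (F' x)) (at x)" if "x \<in> S" for x
    unfolding F'[OF that] by (rule smooth_on_has_derivative[OF Fs that])
  have cF': "continuous_on S F'"
  proof (rule continuous_on_blinfun_componentwise)
    fix i :: 'a
    have "continuous_on S (\<lambda>x. \<D> F x i)"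
      by (rule smooth_on_continuous[OF smooth_on_frechet_derivative[OF Fs]])
    then show "continuous_on S (\<lambda>x. blinfun_apply (F' x) i)"
      by (rule continuous_on_eq) (simp add: F')
  qed
  have lin: "linear (\<D> F x0)"
    by (rule has_derivative_linear[OF smooth_on_has_derivative[OF Fs S(2)]])
  have "inj (\<D> F x0)"
    unfolding linear_injective_0[OF lin]
  proof (intro allI impI)
    fix v assume "\<D> F x0 v = 0"
    moreover have "(F has_derivative (\<lambda>v. h (\<D> f x0 v))) (at x0)"
      unfolding F_def by (rule bounded_linear.has_derivative[OF bh(1) smooth_on_has_derivative[OF f S(2)]])
    ultimately have "h (\<D> f x0 v) = 0"
      using frechet_derivative_at by metis
    then have "\<D> f x0 v = 0" using h(3) linear_0[OF h(2)] by metis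
    then show "v = 0" by (rule inj)
  qed
  then obtain B where B: "linear B" "B \<circ> \<D> F x0 = id"
    using linear_injective_left_inverse[OF lin] by blast
  have "Blinfun B o\<^sub>L F' x0 = id_blinfun"
  proof (rule blinfun_eqI)
    fix v
    have "bounded_linear B" using B(1) by (simp add: linear_conv_bounded_linear)
    then show "blinfun_apply (Blinfun B o\<^sub>L F' x0) v = blinfun_apply id_blinfun v"
      using B(2) by (simp add: bounded_linear_Blinfun_apply F'[OF S(2)] fun_eq_iff)
  qed
  from inverse_function_theorem[OF S(1) dF cF' S(2) this]
  obtain U V g g' where U: "open U" "U \<subseteq> S" "x0 \<in> U" and V: "open V" "F x0 \<in> V"
    and hom: "homeomorphism U V F g" and dg: "\<And>y. y \<in> V \<Longrightarrow> (g has_derivative (g' y)) (at y)"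
    and g': "\<And>y. y \<in> V \<Longrightarrow> g' y = inv (blinfun_apply (F' (g y)))"
    and bij: "\<And>y. y \<in> V \<Longrightarrow> bij (blinfun_apply (F' (g y)))"
    by metis
  have gU: "g y \<in> U" "F (g y) = y" if "y \<in> V" for y
    using hom that unfolding homeomorphism_def by auto
  have gF: "g (F x) = x" "F x \<in> V" if "x \<in> U" for x
    using hom that unfolding homeomorphism_def by auto
  have gs: "smooth_on V g"
  proof (rule smooth_on_inverse_function[OF S(1) Fs V(1) _ dg])
    show "g ` V \<subseteq> S" using gU U by auto
    fix y v assume y: "y \<in> V"
    then have e: "blinfun_apply (F' (g y)) = \<D> F (g y)" using gU U F' by auto
    show "g' y (\<D> F (g y) v) = v"
      using bij[OF y] unfolding g'[OF y] e by (simp add: bij_is_inj)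
    show "\<D> F (g y) (g' y v) = v"
      using bij[OF y] unfolding g'[OF y] e by (simp add: bij_is_surj surj_f_inv_f)
  qed
  \<comment> \<open>Openness of the image is read off as the preimage of \<open>V\<close> under the
    isomorphism.\<close>
  have img: "f ` U = h -` V"
  proof (intro equalityI subsetI)
    show "y \<in> h -` V" if "y \<in> f ` U" for y using that gF by (auto simp: F_def)
    show "y \<in> f ` U" if "y \<in> h -` V" for y
    proof (rule image_eqI[of _ _ "g (h y)"])
      show "g (h y) \<in> U" using that gU by simp
      have "h (f (g (h y))) = h y" using that gU(2)[of "h y"] by (simp add: F_def)
      then show "y = f (g (h y))" using h(3) by metis
    qed
  qed
  have op: "open (f ` U)"
    unfolding img by (rule open_vimage[OF V(1) linear_continuous_on[OF bh(1)]])
  have inj_f: "inj_on f U"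
    by (rule inj_onI) (metis F_def gF(1))
  have inv: "inv_into U f y = g (h y)" if "y \<in> f ` U" for y
  proof -
    obtain x where x: "x \<in> U" "y = f x" using \<open>y \<in> f ` U\<close> by auto
    then have "inv_into U f y = x" using inj_f by simp
    moreover have "g (h y) = x" using gF(1)[OF x(1)] x(2) by (simp add: F_def)
    ultimately show ?thesis by simp
  qed
  have "smooth_on (f ` U) (\<lambda>y. g (h y))"
    by (rule smooth_on_compose[OF op V(1) gs smooth_on_bounded_linear[OF op bh(1) smooth_on_ident[OF op]]])
      (auto simp: img)
  then have "smooth_on (f ` U) (inv_into U f)"
    by (rule smooth_on_cong[OF op]) (simp add: inv)
  then have "coordinates_on U f"
    unfolding coordinates_on_def using U op inj_f smooth_on_subset[OF f U(2)] by simp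
  with U show ?thesis using that by blast
qed

text \<open>Differentiation under the integral sign: the expansion error of
  \<open>uniform_derivative\<close> is uniform in time and may be integrated. Iterating over the
  order gives the statement on differentiability classes.\<close>

lemma
  fixes k :: "real \<Rightarrow> 'a::euclidean_space \<Rightarrow> 'b::euclidean_space"
  assumes S: "open S"
  shows Ck_param_integral_Ck_on: "Ck_param n {0..1} S k \<Longrightarrow> Ck_on n S (\<lambda>x. integral {0..1} (\<lambda>t. k t x))"
    and Ck_param_integral_has_derivative: "Ck_param (Suc 0) {0..1} S k \<Longrightarrow> x \<in> S \<Longrightarrow>
      ((\<lambda>x. integral {0..1} (\<lambda>t. k t x)) has_derivative
        (\<lambda>v. integral {0..1} (\<lambda>t. \<D> (k t) x v))) (at x)"
proof -
  have sw: "continuous_on (S \<times> {0..1}) (\<lambda>z. l (snd z) (fst z))"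
    if "continuous_on ({0..1} \<times> S) (\<lambda>z. l (fst z) (snd z))" for l :: "real \<Rightarrow> 'a \<Rightarrow> 'b"
  proof -
    have "continuous_on (S \<times> {0..1}) (\<lambda>z :: 'a \<times> real. (snd z, fst z))" by (intro continuous_intros)
    from continuous_on_compose2[OF that this] show ?thesis by fastforce
  qed
  have int: "(\<lambda>t. l t x) integrable_on {0..1}"
    if "continuous_on ({0..1} \<times> S) (\<lambda>z. l (fst z) (snd z))" "x \<in> S" for l :: "real \<Rightarrow> 'a \<Rightarrow> 'b" and x
  proof -
    have "continuous_on {0..1} (\<lambda>t :: real. (t, x))" by (intro continuous_intros)
    from continuous_on_compose2[OF that(1) this] that(2) show ?thesis
      by (intro integrable_continuous_interval) fastforce
  qed
  show der: "((\<lambda>x. integral {0..1} (\<lambda>t. k t x)) has_derivative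
        (\<lambda>v. integral {0..1} (\<lambda>t. \<D> (k t) x v))) (at x)"
    if k: "Ck_param (Suc 0) {0..1} S k" and x: "x \<in> S" for k :: "real \<Rightarrow> 'a \<Rightarrow> 'b" and x
  proof -
    note dk = Ck_param_SucD(1)[OF k] and cdk = Ck_param_continuous[OF Ck_param_SucD(2)[OF k]]
    have ic: "(\<lambda>t. \<D> (k t) x v) integrable_on {0..1}" for v
      by (rule int[where l = "\<lambda>t x. \<D> (k t) x v", OF cdk x])
    have lin: "linear (\<D> (k t) x)" if "t \<in> {0..1}" for t
      by (rule has_derivative_linear[OF dk[OF that x]])
    show ?thesis unfolding has_derivative_at_alt
    proof (intro conjI allI impI)
      have "linear (\<lambda>v. integral {0..1} (\<lambda>t. \<D> (k t) x v))"
      proof (rule linearI)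
        fix a b
        have "integral {0..1} (\<lambda>t. \<D> (k t) x (a + b))
           = integral {0..1} (\<lambda>t. \<D> (k t) x a + \<D> (k t) x b)"
          by (intro integral_cong linear_add lin)
        also have "\<dots> = integral {0..1} (\<lambda>t. \<D> (k t) x a) + integral {0..1} (\<lambda>t. \<D> (k t) x b)"
          by (intro integral_add ic)
        finally show "integral {0..1} (\<lambda>t. \<D> (k t) x (a + b)) =
          integral {0..1} (\<lambda>t. \<D> (k t) x a) + integral {0..1} (\<lambda>t. \<D> (k t) x b)" .
      next
        fix c :: real and a
        have "integral {0..1} (\<lambda>t. \<D> (k t) x (c *\<^sub>R a))
           = integral {0..1} (\<lambda>t. c *\<^sub>R \<D> (k t) x a)"
          by (intro integral_cong linear_cmul lin)
        then show "integral {0..1} (\<lambda>t. \<D> (k t) x (c *\<^sub>R a)) =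
          c *\<^sub>R integral {0..1} (\<lambda>t. \<D> (k t) x a)" by simp
      qed
      then show "bounded_linear (\<lambda>v. integral {0..1} (\<lambda>t. \<D> (k t) x v))"
        by (simp add: linear_conv_bounded_linear)
      fix e :: real assume e: "e > 0"
      obtain d where d: "d > 0" "\<forall>p\<in>{0..1}. \<forall>z\<in>ball x d.
          norm (k p z - k p x - \<D> (k p) x (z - x)) \<le> e * norm (z - x)"
        using uniform_derivative[where k = k and D = "\<lambda>p z. \<D> (k p) z", OF S x dk cdk e] by blast
      obtain d' where d': "d' > 0" "ball x d' \<subseteq> S" using S x open_contains_ball by blast
      show "\<exists>d>0. \<forall>z. norm (z - x) < d \<longrightarrow> norm (integral {0..1} (\<lambda>t. k t z) - integral {0..1} (\<lambda>t. k t x)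
          - integral {0..1} (\<lambda>t. \<D> (k t) x (z - x))) \<le> e * norm (z - x)"
      proof (intro exI[of _ "min d d'"] conjI allI impI)
        fix z assume "norm (z - x) < min d d'"
        then have z: "z \<in> ball x d" "z \<in> S" using d'(2) by (auto simp: dist_norm norm_minus_commute subset_iff)
        note i = int[OF Ck_param_continuous[OF k] z(2)] int[OF Ck_param_continuous[OF k] x] ic[of "z - x"]
        have "integral {0..1} (\<lambda>t. k t z) - integral {0..1} (\<lambda>t. k t x)
          - integral {0..1} (\<lambda>t. \<D> (k t) x (z - x))
          = integral {0..1} (\<lambda>t. k t z - k t x - \<D> (k t) x (z - x))"
          using i by (simp add: integral_diff integrable_diff)
        also have "norm \<dots> \<le> (e * norm (z - x)) * measure lborel {0..1::real}"
          by (rule has_integral_bound_real[OF _ finite.emptyI integrable_integral])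
            (use e d(2) z i in \<open>auto intro!: integrable_diff\<close>)
        finally show "norm (integral {0..1} (\<lambda>t. k t z) - integral {0..1} (\<lambda>t. k t x)
          - integral {0..1} (\<lambda>t. \<D> (k t) x (z - x))) \<le> e * norm (z - x)" by simp
      qed (use d d' in auto)
    qed
  qed
  have "Ck_param n {0::real} S (\<lambda>p x. integral {0..1} (\<lambda>t. k t x))" if "Ck_param n {0..1} S k" for n
    using that
  proof (induction n arbitrary: k)
    case 0
    have "continuous_on S (\<lambda>x. integral (cbox 0 1) (\<lambda>t. k t x))"
      by (rule integral_continuous_on_param)
        (use sw[OF 0[unfolded Ck_param.simps]] in \<open>simp add: case_prod_beta\<close>)
    then have c: "continuous_on S (\<lambda>x. integral {0..1} (\<lambda>t. k t x))" by simp
    show ?case by (simp add: continuous_on_snd_param[OF c])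
  next
    case (Suc n)
    have k1: "Ck_param (Suc 0) {0..1} S k" using Suc.prems by (induction n) (auto intro: Ck_param_Suc_imp simp del: Ck_param.simps)
    have "continuous_on S (\<lambda>x. integral {0..1} (\<lambda>t. k t x))"
      by (rule has_derivative_continuous_on[OF has_derivative_at_withinI[OF der[OF k1]]])
    then show ?case
      by (intro Ck_param_SucI[OF S continuous_on_snd_param der[OF k1]] Suc.IH Ck_param_SucD(2)[OF Suc.prems])
  qed
  then show "Ck_param n {0..1} S k \<Longrightarrow> Ck_on n S (\<lambda>x. integral {0..1} (\<lambda>t. k t x))"
    using Ck_param_imp_Ck_on[of n "{0::real}" S "\<lambda>p x. integral {0..1} (\<lambda>t. k t x)" 0] by simp
qed

section \<open>Primitives of closed one-forms\<close>

text \<open>The primitive is the integral of the form along the radius from \<open>c\<close> to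
  \<open>x\<close>. Differentiating under the integral and using closedness turns the integrand into
  the time derivative of \<open>t * \<theta> (X t x) v\<close>, whose integral is the boundary value
  \<open>\<theta> x v\<close>.\<close>

lemma Poincare_ball:
  fixes \<theta> :: "'a::euclidean_space \<Rightarrow> 'a \<Rightarrow> real"
  assumes U: "open U" and sub: "ball c r \<subseteq> U"
    and lin: "\<And>x. x \<in> U \<Longrightarrow> linear (\<theta> x)" and sm: "\<And>v. smooth_on U (\<lambda>x. \<theta> x v)"
    and cl: "\<And>x a b. x \<in> U \<Longrightarrow>
      \<D> (\<lambda>y. \<theta> y a) x b = \<D> (\<lambda>y. \<theta> y b) x a"
  obtains f where "\<And>x. x \<in> ball c r \<Longrightarrow> (f has_derivative \<theta> x) (at x)"
proof -
  let ?B = "ball c r"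
  define X where "X t x = c + t *\<^sub>R (x - c)" for t :: real and x
  have op: "open ?B" by simp
  have XB: "X t x \<in> ?B" if "t \<in> {0..1}" "x \<in> ?B" for t x
  proof -
    have "\<bar>t\<bar> * norm (x - c) \<le> 1 * norm (x - c)" using that(1) by (intro mult_right_mono) auto
    then have "dist c (X t x) \<le> dist c x" by (simp add: X_def dist_norm norm_minus_commute)
    then show ?thesis using that(2) by simp
  qed
  have XU: "X t x \<in> U" if "t \<in> {0..1}" "x \<in> ?B" for t x using XB[OF that] sub by blast
  have xc: "Ck_param n {0..1} ?B (\<lambda>t x. x - c)" for n
    using Ck_param_add[OF op Ck_param_linear_id[OF op bounded_linear_ident] Ck_param_const[OF op continuous_on_const[of _ "- c"]]]
    by simp
  have Xn: "Ck_param n {0..1} ?B X" for n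
    unfolding X_def[abs_def]
    by (intro Ck_param_add[OF op Ck_param_const[OF op continuous_on_const]]
        Ck_param_bilinear[OF op bounded_bilinear_scaleR Ck_param_const[OF op continuous_on_id] xc])
  define k where "k t x = (\<Sum>i\<in>Basis. ((x - c) \<bullet> i) * \<theta> (X t x) i)" for t x
  have tn: "Ck_param n {0..1} ?B (\<lambda>t x. \<theta> (X t x) i)" for n i
    by (rule Ck_param_compose[where F = "\<lambda>p x. \<theta> x i", OF op U smooth_on_imp_Ck_param[OF sm] Xn XU])
  have kn: "Ck_param n {0..1} ?B k" for n
    unfolding k_def[abs_def]
    by (intro Ck_param_sum[OF op] Ck_param_bilinear[OF op bounded_bilinear_mult] tn
        Ck_param_bounded_linear[OF op bounded_linear_inner_left xc])
  note dth = smooth_on_has_derivative[OF sm]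
  have dX: "(X t has_derivative (\<lambda>v. t *\<^sub>R v)) (at x)" for t x
    unfolding X_def[abs_def] by (auto intro!: derivative_eq_intros)
  have dk: "\<D> (k t) x v
      = \<theta> (X t x) v + t * \<D> (\<lambda>y. \<theta> y v) (X t x) (x - c)"
    if t: "t \<in> {0..1}" and x: "x \<in> ?B" for t x v
  proof -
    have l: "linear (\<D> (\<lambda>y. \<theta> y i) (X t x))" for i
      by (rule has_derivative_linear[OF dth[OF XU[OF t x]]])
    have i: "((\<lambda>x. (x - c) \<bullet> i) has_derivative (\<lambda>v. v \<bullet> i)) (at x)" for i
      by (auto intro!: derivative_eq_intros)
    have "(k t has_derivative (\<lambda>v. \<Sum>i\<in>Basis. ((x - c) \<bullet> i) * \<D> (\<lambda>y. \<theta> y i) (X t x) (t *\<^sub>R v)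
        + (v \<bullet> i) * \<theta> (X t x) i)) (at x)"
      unfolding k_def[abs_def]
      by (intro has_derivative_sum has_derivative_mult i has_derivative_compose[OF dX dth[OF XU[OF t x]]])
    from fun_cong[OF frechet_derivative_at[OF this], of v, symmetric]
    have "\<D> (k t) x v = (\<Sum>i\<in>Basis. ((x - c) \<bullet> i) * \<D> (\<lambda>y. \<theta> y i) (X t x) (t *\<^sub>R v)
        + (v \<bullet> i) * \<theta> (X t x) i)" .
    \<comment> \<open>Closedness swaps the differentiation direction \<open>v\<close> with the slot
      \<open>i\<close>, so that the sum can be collected into a derivative in the radial
      direction.\<close>
    also have "\<dots> = (\<Sum>i\<in>Basis. t * (((x - c) \<bullet> i) * \<D> (\<lambda>y. \<theta> y v) (X t x) i)
        + (v \<bullet> i) * \<theta> (X t x) i)"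
      using cl[OF XU[OF t x], of _ v] by (intro sum.cong refl) (simp add: linear_cmul[OF l])
    also have "\<dots> = t * (\<Sum>i\<in>Basis. ((x - c) \<bullet> i) * \<D> (\<lambda>y. \<theta> y v) (X t x) i)
        + (\<Sum>i\<in>Basis. (v \<bullet> i) * \<theta> (X t x) i)"
      by (simp add: sum.distrib sum_distrib_left)
    also have "(\<Sum>i\<in>Basis. ((x - c) \<bullet> i) * \<D> (\<lambda>y. \<theta> y v) (X t x) i)
        = \<D> (\<lambda>y. \<theta> y v) (X t x) (x - c)"
      using linear_eq_sum_Basis[OF l[of v], of "x - c"] by simp
    also have "(\<Sum>i\<in>Basis. (v \<bullet> i) * \<theta> (X t x) i) = \<theta> (X t x) v"
      using linear_eq_sum_Basis[OF lin[OF XU[OF t x]], of v] by simp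
    finally show ?thesis by simp
  qed
  show ?thesis
  proof (rule that[of "\<lambda>x. integral {0..1} (\<lambda>t. k t x)"])
    fix x assume x: "x \<in> ?B"
    have "integral {0..1} (\<lambda>t. \<D> (k t) x v) = \<theta> x v" for v
    proof -
      have "((\<lambda>t. t * \<theta> (X t x) v) has_vector_derivative
        (t * \<D> (\<lambda>y. \<theta> y v) (X t x) (x - c) + 1 * \<theta> (X t x) v)) (at t within {0..1})"
        if t: "t \<in> {0..1}" for t
      proof -
        have "((\<lambda>t. X t x) has_vector_derivative (x - c)) (at t within {0..1})"
          unfolding X_def by (auto intro!: derivative_eq_intros)
        from vector_derivative_diff_chain_within[OF this has_derivative_at_withinI[OF dth[OF XU[OF t x]]], of v]
        have "((\<lambda>t. \<theta> (X t x) v) has_vector_derivative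
          \<D> (\<lambda>y. \<theta> y v) (X t x) (x - c)) (at t within {0..1})"
          by (simp add: o_def)
        from has_vector_derivative_mult[OF has_vector_derivative_id this]
        show ?thesis by simp
      qed
      then have "((\<lambda>t. t * \<D> (\<lambda>y. \<theta> y v) (X t x) (x - c) + 1 * \<theta> (X t x) v)
          has_integral 1 * \<theta> (X 1 x) v - 0 * \<theta> (X 0 x) v) {0..1}"
        by (intro fundamental_theorem_of_calculus) auto
      then have "((\<lambda>t. t * \<D> (\<lambda>y. \<theta> y v) (X t x) (x - c) + 1 * \<theta> (X t x) v)
          has_integral \<theta> x v) {0..1}" by (simp add: X_def)
      then have "((\<lambda>t. \<D> (k t) x v) has_integral \<theta> x v) {0..1}"
        by (rule has_integral_eq[rotated]) (simp add: dk[OF _ x])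
      then show ?thesis by (rule integral_unique)
    qed
    then show "((\<lambda>x. integral {0..1} (\<lambda>t. k t x)) has_derivative \<theta> x) (at x)"
      using Ck_param_integral_has_derivative[OF op kn x] by simp
  qed
qed

text \<open>The integral of \<open>g\<close> in the first variable from zero, rescaled to the unit
  interval so that the variable bound becomes a parameter of the integrand.\<close>

lemma antiderivative_fst:
  fixes g :: "real \<times> real \<Rightarrow> real"
  assumes g: "smooth_on UNIV g"
  obtains p where "smooth_on UNIV p" "\<And>y. \<D> p y (1, 0) = g y"
proof -
  define X where "X t y = (t * fst y, snd y)" for t :: real and y :: "real \<times> real"
  have op: "open (UNIV :: (real \<times> real) set)" by simp
  have fs: "Ck_param n {0..1::real} UNIV (\<lambda>t. fst :: real \<times> real \<Rightarrow> real)" for n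
    by (rule Ck_param_linear_id[OF op bounded_linear_fst])
  have Xn: "Ck_param n {0..1} UNIV X" for n
    unfolding X_def[abs_def]
    by (intro Ck_param_Pair[OF op] Ck_param_linear_id[OF op bounded_linear_snd]
        Ck_param_bilinear[OF op bounded_bilinear_mult Ck_param_const[OF op continuous_on_id] fs])
  define k where "k t y = fst y * g (X t y)" for t y
  have kn: "Ck_param n {0..1} UNIV k" for n
    unfolding k_def[abs_def]
    by (intro Ck_param_bilinear[OF op bounded_bilinear_mult fs]
        Ck_param_compose[where F = "\<lambda>p. g", OF op op smooth_on_imp_Ck_param[OF g] Xn UNIV_I])
  note dg = smooth_on_has_derivative[OF g UNIV_I]
  have lg: "linear (\<D> g y)" for y by (rule has_derivative_linear[OF dg])
  have dk: "\<D> (k t) y (1, 0) = g (X t y) + t * \<D> g (X t y) (fst y, 0)" for t y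
  proof -
    have dX: "(X t has_derivative (\<lambda>v. (t * fst v, snd v))) (at y)"
      unfolding X_def[abs_def]
      by (intro has_derivative_Pair has_derivative_mult_right bounded_linear_imp_has_derivative
          bounded_linear_fst bounded_linear_snd)
    have f: "(fst has_derivative fst) (at y)"
      by (rule bounded_linear_imp_has_derivative[OF bounded_linear_fst])
    have "(k t has_derivative (\<lambda>v. fst y * \<D> g (X t y) (t * fst v, snd v) + fst v * g (X t y))) (at y)"
      unfolding k_def[abs_def] by (rule has_derivative_mult[OF f has_derivative_compose[OF dX dg]])
    from fun_cong[OF frechet_derivative_at[OF this], of "(1, 0)", symmetric]
    have "\<D> (k t) y (1, 0) = fst y * \<D> g (X t y) (t, 0) + g (X t y)"
      by simp
    moreover have "fst y * \<D> g (X t y) (t, 0) = t * \<D> g (X t y) (fst y, 0)"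
      using linear_cmul[OF lg, of "X t y" "fst y" "(t, 0)"] linear_cmul[OF lg, of "X t y" t "(fst y, 0)"]
      by (simp add: mult.commute)
    ultimately show ?thesis by simp
  qed
  show ?thesis
  proof (rule that[of "\<lambda>y. integral {0..1} (\<lambda>t. k t y)"])
    show "smooth_on UNIV (\<lambda>y. integral {0..1} (\<lambda>t. k t y))"
      unfolding smooth_on_def using Ck_param_integral_Ck_on[OF op kn] by blast
    fix y
    have "((\<lambda>t. t * g (X t y)) has_vector_derivative
        t * \<D> g (X t y) (fst y, 0) + 1 * g (X t y)) (at t within {0..1})" for t
    proof -
      have "((\<lambda>t. X t y) has_vector_derivative (fst y, 0)) (at t within {0..1})"
        unfolding X_def by (auto intro!: derivative_eq_intros)
      from vector_derivative_diff_chain_within[OF this has_derivative_at_withinI[OF dg]]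
      have "((\<lambda>t. g (X t y)) has_vector_derivative \<D> g (X t y) (fst y, 0)) (at t within {0..1})"
        by (simp add: o_def)
      from has_vector_derivative_mult[OF has_vector_derivative_id this]
      show ?thesis by simp
    qed
    then have "((\<lambda>t. t * \<D> g (X t y) (fst y, 0) + 1 * g (X t y)) has_integral
        1 * g (X 1 y) - 0 * g (X 0 y)) {0..1}"
      by (intro fundamental_theorem_of_calculus) auto
    then have "((\<lambda>t. \<D> (k t) y (1, 0)) has_integral g y) {0..1}"
      by (simp add: dk X_def add.commute)
    then have i: "integral {0..1} (\<lambda>t. \<D> (k t) y (1, 0)) = g y" by (rule integral_unique)
    show "\<D> (\<lambda>y. integral {0..1} (\<lambda>t. k t y)) y (1, 0) = g y"
      using fun_cong[OF frechet_derivative_at[OF Ck_param_integral_has_derivative[OF op kn UNIV_I[of y]]], of "(1, 0)"] i by simp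
  qed
qed

section \<open>Integration of closed one-forms along continuous paths\<close>

definition edge_integral :: "('a::euclidean_space \<Rightarrow> 'a \<Rightarrow> real) \<Rightarrow> 'a \<Rightarrow> 'a \<Rightarrow> real" where
  "edge_integral \<theta> x y = integral {0..1} (\<lambda>t. \<theta> (x + t *\<^sub>R (y - x)) (y - x))"

text \<open>The integral over the polygon inscribed in \<open>p\<close> with \<open>N\<close> equal
  time steps. It makes sense for a path that is merely continuous.\<close>

definition path_sum :: "('a::euclidean_space \<Rightarrow> 'a \<Rightarrow> real) \<Rightarrow> (real \<Rightarrow> 'a) \<Rightarrow> nat \<Rightarrow> real" where
  "path_sum \<theta> p N = (\<Sum>i<N. edge_integral \<theta> (p (real i / real N)) (p (real (Suc i) / real N)))"

text \<open>\<open>N\<close> is so large that every piece of \<open>p\<close> of length \<open>1 / N\<close> lies in a ball contained in \<open>U\<close>.\<close>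

definition fine_for :: "'a::euclidean_space set \<Rightarrow> (real \<Rightarrow> 'a) \<Rightarrow> nat \<Rightarrow> bool" where
  "fine_for U p N \<longleftrightarrow> N > 0 \<and> (\<exists>e. \<forall>s\<in>{0..1}. ball (p s) e \<subseteq> U \<and>
     (\<forall>t\<in>{0..1}. \<bar>t - s\<bar> \<le> 1 / real N \<longrightarrow> dist (p s) (p t) < e))"

lemma edge_integral_primitive:
  assumes f: "\<And>z. z \<in> C \<Longrightarrow> (f has_derivative \<theta> z) (at z)" and C: "convex C" "x \<in> C" "y \<in> C"
  shows "edge_integral \<theta> x y = f y - f x"
proof -
  have "((\<lambda>t. f (x + t *\<^sub>R (y - x))) has_vector_derivative \<theta> (x + t *\<^sub>R (y - x)) (y - x)) (at t within {0..1})"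
    if t: "t \<in> {0..1}" for t
  proof -
    have "x + t *\<^sub>R (y - x) = (1 - t) *\<^sub>R x + t *\<^sub>R y" by (simp add: algebra_simps)
    then have z: "x + t *\<^sub>R (y - x) \<in> C" using C t by (auto intro: convexD_alt)
    have "((\<lambda>t. x + t *\<^sub>R (y - x)) has_vector_derivative (y - x)) (at t within {0..1})"
      by (auto intro!: derivative_eq_intros)
    from vector_derivative_diff_chain_within[OF this has_derivative_at_withinI[OF f[OF z]]]
    show ?thesis by (simp add: o_def)
  qed
  then have "((\<lambda>t. \<theta> (x + t *\<^sub>R (y - x)) (y - x)) has_integral f (x + 1 *\<^sub>R (y - x)) - f (x + 0 *\<^sub>R (y - x))) {0..1}"
    by (intro fundamental_theorem_of_calculus) auto
  then show ?thesis unfolding edge_integral_def by (simp add: integral_unique)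
qed

lemma fine_for_mult:
  assumes "fine_for U p N" "m > 0"
  shows "fine_for U p (N * m)"
proof -
  have N: "N > 0" using assms by (simp add: fine_for_def)
  have "1 / real (N * m) \<le> 1 / real N"
    using N assms(2) by (intro divide_left_mono) auto
  then show ?thesis using assms unfolding fine_for_def by (meson mult_pos_pos order_trans)
qed

text \<open>Compactness of the path image yields a common ball radius inside \<open>U\<close>, and
  uniform continuity of the path a matching time step.\<close>

lemma fine_for_exists:
  assumes U: "open U" and p: "path p" "path_image p \<subseteq> U"
  shows "\<exists>N. fine_for U p N"
proof -
  obtain e where e: "e > 0" "(\<Union>x\<in>path_image p. ball x e) \<subseteq> U"
    using compact_subset_open_imp_ball_epsilon_subset[OF compact_path_image[OF p(1)] U p(2)] by metis
  have "uniformly_continuous_on {0..1} p"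
    using p(1) unfolding path_def by (intro compact_uniformly_continuous) auto
  then obtain d where d: "d > 0" "\<And>s t. s \<in> {0..1} \<Longrightarrow> t \<in> {0..1} \<Longrightarrow> dist t s < d \<Longrightarrow> dist (p t) (p s) < e"
    using e(1) unfolding uniformly_continuous_on_def by metis
  obtain n where n: "1 / real (Suc n) < d" using reals_Archimedean[OF d(1)] by (auto simp: inverse_eq_divide)
  have "\<forall>s\<in>{0..1}. ball (p s) e \<subseteq> U \<and> (\<forall>t\<in>{0..1}. \<bar>t - s\<bar> \<le> 1 / real (Suc n) \<longrightarrow> dist (p s) (p t) < e)"
  proof (intro ballI conjI impI)
    fix s :: real assume s: "s \<in> {0..1}"
    then show "ball (p s) e \<subseteq> U" using e(2) unfolding path_image_def by blast
    fix t :: real assume t: "t \<in> {0..1}" "\<bar>t - s\<bar> \<le> 1 / real (Suc n)"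
    then have "dist s t < d" using n by (simp add: dist_real_def)
    then show "dist (p s) (p t) < e" using d(2)[OF t(1) s] by simp
  qed
  then show ?thesis unfolding fine_for_def by blast
qed

text \<open>The nodes of the refinement belonging to one coarse edge lie in a ball on which the form
  has a primitive, so the fine edges telescope to the value of the coarse edge.\<close>

lemma path_sum_refine:
  assumes loc: "\<And>c r. ball c r \<subseteq> U \<Longrightarrow> \<exists>f. \<forall>x\<in>ball c r. (f has_derivative \<theta> x) (at x)"
    and N: "fine_for U p N" and m: "m > 0"
  shows "path_sum \<theta> p (N * m) = path_sum \<theta> p N"
proof -
  obtain e where N0: "N > 0" and e: "\<And>s. s \<in> {0..1} \<Longrightarrow> ball (p s) e \<subseteq> U"
    "\<And>s t. s \<in> {0..1} \<Longrightarrow> t \<in> {0..1} \<Longrightarrow> \<bar>t - s\<bar> \<le> 1 / real N \<Longrightarrow> dist (p s) (p t) < e"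
    using N unfolding fine_for_def by blast
  have "path_sum \<theta> p (N * m) = (\<Sum>i<N. \<Sum>l = i * m..<i * m + m.
      edge_integral \<theta> (p (real l / real (N * m))) (p (real (Suc l) / real (N * m))))"
    unfolding path_sum_def by (rule sum.nat_group[symmetric])
  also have "\<dots> = (\<Sum>i<N. edge_integral \<theta> (p (real i / real N)) (p (real (Suc i) / real N)))"
  proof (rule sum.cong[OF refl])
    fix i assume "i \<in> {..<N}"
    then have i: "i < N" by simp
    define s where "s = real i / real N"
    have s: "s \<in> {0..1}" using i by (simp add: s_def)
    obtain f where f: "\<And>x. x \<in> ball (p s) e \<Longrightarrow> (f has_derivative \<theta> x) (at x)"
      using loc[OF e(1)[OF s]] by blast
    have near: "p (real l / real (N * m)) \<in> ball (p s) e" if l: "i * m \<le> l" "l \<le> i * m + m" for l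
    proof -
      have Nm: "real N > 0" "real m > 0" using N0 m by simp_all
      have r: "real i * real m \<le> real l" "real l \<le> real i * real m + real m"
        using l by (metis of_nat_le_iff of_nat_mult, metis of_nat_add of_nat_le_iff of_nat_mult)
      have "real l / real (N * m) - s = (real l - real i * real m) / (real N * real m)"
        using Nm by (simp add: s_def field_simps)
      moreover have "0 \<le> (real l - real i * real m) / (real N * real m)"
        using r Nm by simp
      moreover have "(real l - real i * real m) / (real N * real m) \<le> real m / (real N * real m)"
        using r Nm by (intro divide_right_mono) auto
      moreover have "real m / (real N * real m) = 1 / real N" using Nm by simp
      ultimately have a: "\<bar>real l / real (N * m) - s\<bar> \<le> 1 / real N" by simp
      have "l \<le> N * m"
      proof -
        have "l \<le> Suc i * m" using l by simp
        also have "\<dots> \<le> N * m" using i by (intro mult_le_mono1) simp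
        finally show ?thesis .
      qed
      then have "real l / real (N * m) \<in> {0..1}"
        using Nm by (simp add: divide_le_eq_1 flip: of_nat_mult)
      then show ?thesis using e(2)[OF s _ a] by simp
    qed
    have "(\<Sum>l = i * m..<i * m + m. edge_integral \<theta> (p (real l / real (N * m))) (p (real (Suc l) / real (N * m))))
        = (\<Sum>l = i * m..<i * m + m. f (p (real (Suc l) / real (N * m))) - f (p (real l / real (N * m))))"
    proof (rule sum.cong[OF refl])
      fix l assume "l \<in> {i * m..<i * m + m}"
      then have l: "i * m \<le> l" "l \<le> i * m + m" "i * m \<le> Suc l" "Suc l \<le> i * m + m" by auto
      show "edge_integral \<theta> (p (real l / real (N * m))) (p (real (Suc l) / real (N * m)))
          = f (p (real (Suc l) / real (N * m))) - f (p (real l / real (N * m)))"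
        by (rule edge_integral_primitive[OF f convex_ball near[OF l(1,2)] near[OF l(3,4)]])
    qed
    also have "\<dots> = f (p (real (i * m + m) / real (N * m))) - f (p (real (i * m) / real (N * m)))"
      by (rule sum_Suc_diff') simp
    also have "\<dots> = edge_integral \<theta> (p (real (i * m) / real (N * m))) (p (real (i * m + m) / real (N * m)))"
      by (rule edge_integral_primitive[OF f convex_ball near near, symmetric]) simp_all
    also have "real (i * m) / real (N * m) = real i / real N" using m by simp
    also have "real (i * m + m) / real (N * m) = real (Suc i) / real N"
    proof -
      have "i * m + m = Suc i * m" by simp
      then show ?thesis using m by (simp only: of_nat_mult) simp
    qed
    finally show "(\<Sum>l = i * m..<i * m + m. edge_integral \<theta> (p (real l / real (N * m))) (p (real (Suc l) / real (N * m))))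
      = edge_integral \<theta> (p (real i / real N)) (p (real (Suc i) / real N))" .
  qed
  finally show ?thesis unfolding path_sum_def .
qed

text \<open>Moving from one row of a fine grid on the homotopy to the next changes the sum only by the edges
  at the two fixed ends, which are degenerate.\<close>

lemma path_sum_homotopic:
  fixes \<theta> :: "'a::euclidean_space \<Rightarrow> 'a \<Rightarrow> real"
  assumes U: "open U"
    and loc: "\<And>c r. ball c r \<subseteq> U \<Longrightarrow> \<exists>f. \<forall>x\<in>ball c r. (f has_derivative \<theta> x) (at x)"
    and hom: "homotopic_paths U p q"
    and N: "fine_for U p N" and M: "fine_for U q M"
  shows "path_sum \<theta> p N = path_sum \<theta> q M"
proof -
  obtain h :: "real \<times> real \<Rightarrow> 'a" where ch: "continuous_on ({0..1} \<times> {0..1}) h" and hU: "h ` ({0..1} \<times> {0..1}) \<subseteq> U"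
    and hp: "\<forall>t\<in>{0..1}. h (0, t) = p t" and hq: "\<forall>t\<in>{0..1}. h (1, t) = q t"
    and he: "\<forall>s\<in>{0..1}. pathstart (h \<circ> Pair s) = pathstart p \<and> pathfinish (h \<circ> Pair s) = pathfinish p"
    using hom unfolding homotopic_paths image_subset_iff_funcset by blast
  have h0: "h (0, t) = p t" and h1: "h (1, t) = q t" if "t \<in> {0..1}" for t
    using hp hq that by blast+
  have ends: "h (s, 0) = p 0 \<and> h (s, 1) = p 1" if "s \<in> {0..1}" for s
    using he that unfolding pathstart_def pathfinish_def o_def by blast
  let ?Q = "{0..1::real} \<times> {0..1::real}"
  have K: "compact ?Q" by (intro compact_Times compact_Icc)
  obtain e where e: "e > 0" "(\<Union>x\<in>h ` ?Q. ball x e) \<subseteq> U"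
    using compact_subset_open_imp_ball_epsilon_subset[OF compact_continuous_image[OF ch K] U hU] by metis
  obtain d where d: "d > 0" "\<And>x y. x \<in> ?Q \<Longrightarrow> y \<in> ?Q \<Longrightarrow> dist y x < d \<Longrightarrow> dist (h y) (h x) < e"
    using compact_uniformly_continuous[OF ch K] e(1) unfolding uniformly_continuous_on_def by metis
  have "d / 2 > 0" using d(1) by simp
  then obtain n where "inverse (real (Suc n)) < d / 2" using reals_Archimedean by blast
  then have n: "1 / real (Suc n) < d / 2" by (simp only: inverse_eq_divide)
  \<comment> \<open>A common multiple of \<open>N\<close> and \<open>M\<close>, so that both
    boundary rows are refinements of the given subdivisions; the factor \<open>Suc n\<close> makes
    the mesh small enough for the homotopy.\<close>
  define L where "L = Suc n * (N * M)"
  have NM: "N > 0" "M > 0" using N M by (auto simp: fine_for_def)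
  have L0: "L > 0" using NM by (simp add: L_def)
  then have L0': "real L > 0" by simp
  have "real (Suc n) * 1 \<le> real (Suc n) * (real N * real M)"
  proof (rule mult_left_mono)
    have "1 \<le> N * M" using NM by simp
    then show "1 \<le> real N * real M" by (metis of_nat_1 of_nat_le_iff of_nat_mult)
  qed simp
  then have "real (Suc n) \<le> real L" unfolding L_def of_nat_mult by simp
  then have "1 / real L \<le> 1 / real (Suc n)" by (intro divide_left_mono) (use L0' in auto)
  then have Ld: "2 * (1 / real L) < d" using n by linarith
  define x where "x j i = h (real j / real L, real i / real L)" for j i
  have frac: "real i / real L \<in> {0..1}" if "i \<le> L" for i using that L0' by simp
  \<comment> \<open>All four corners lie in one ball with a primitive, so both ways around the cell
    give the same difference.\<close>
  have cell: "edge_integral \<theta> (x j i) (x j (Suc i)) + edge_integral \<theta> (x j (Suc i)) (x (Suc j) (Suc i))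
     = edge_integral \<theta> (x j i) (x (Suc j) i) + edge_integral \<theta> (x (Suc j) i) (x (Suc j) (Suc i))"
    if ij: "i < L" "j < L" for i j
  proof -
    have "ball (x j i) e \<subseteq> U"
      using e(2) frac[of i] frac[of j] ij by (force simp: x_def)
    then obtain f where f: "\<And>z. z \<in> ball (x j i) e \<Longrightarrow> (f has_derivative \<theta> z) (at z)"
      using loc by blast
    have near: "x j' i' \<in> ball (x j i) e" if "i' \<in> {i, Suc i}" "j' \<in> {j, Suc j}" for i' j'
    proof -
      have le: "i' \<le> L" "j' \<le> L" using that ij by auto
      have "\<bar>real i' / real L - real i / real L\<bar> \<le> 1 / real L" "\<bar>real j' / real L - real j / real L\<bar> \<le> 1 / real L"
        using that L0' by (auto simp: diff_divide_distrib[symmetric] add_divide_distrib)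
      then have "dist (real j' / real L, real i' / real L) (real j / real L, real i / real L) \<le> 2 * (1 / real L)"
        using norm_Pair_le[of "real j' / real L - real j / real L" "real i' / real L - real i / real L"]
        by (simp add: dist_norm)
      then have "dist (h (real j' / real L, real i' / real L)) (h (real j / real L, real i / real L)) < e"
        using Ld frac[OF le(1)] frac[OF le(2)] frac[of i] frac[of j] ij by (intro d(2)) auto
      then show ?thesis by (simp add: x_def dist_commute)
    qed
    have E: "edge_integral \<theta> (x j1 i1) (x j2 i2) = f (x j2 i2) - f (x j1 i1)"
      if "i1 \<in> {i, Suc i}" "j1 \<in> {j, Suc j}" "i2 \<in> {i, Suc i}" "j2 \<in> {j, Suc j}" for i1 j1 i2 j2
      by (rule edge_integral_primitive[OF f convex_ball near near]) (use that in auto)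
    show ?thesis by (simp add: E)
  qed
  have row: "(\<Sum>i<L. edge_integral \<theta> (x (Suc j) i) (x (Suc j) (Suc i))) = (\<Sum>i<L. edge_integral \<theta> (x j i) (x j (Suc i)))"
    if j: "j < L" for j
  proof -
    have z: "edge_integral \<theta> y y = 0" if "y \<in> U" for y
    proof -
      obtain r where r: "r > 0" "ball y r \<subseteq> U" using U \<open>y \<in> U\<close> open_contains_ball by blast
      obtain f where f: "\<And>z. z \<in> ball y r \<Longrightarrow> (f has_derivative \<theta> z) (at z)" using loc[OF r(2)] by blast
      show ?thesis using edge_integral_primitive[OF f convex_ball, where x = y and y = y] r(1) by simp
    qed
    have xU: "x j i \<in> U" if "i \<le> L" "j \<le> L" for i j
      using hU frac[OF that(1)] frac[OF that(2)] by (force simp: x_def)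
    have e0: "x (Suc j) 0 = x j 0" "x (Suc j) L = x j L"
      using ends[OF frac[of j]] ends[OF frac[of "Suc j"]] j L0 by (auto simp: x_def simp del: of_nat_Suc)
    have "(\<Sum>i<L. edge_integral \<theta> (x (Suc j) i) (x (Suc j) (Suc i))) - (\<Sum>i<L. edge_integral \<theta> (x j i) (x j (Suc i)))
       = (\<Sum>i<L. edge_integral \<theta> (x j (Suc i)) (x (Suc j) (Suc i)) - edge_integral \<theta> (x j i) (x (Suc j) i))"
      unfolding sum_subtractf[symmetric]
    proof (rule sum.cong[OF refl])
      fix i assume "i \<in> {..<L}"
      then show "edge_integral \<theta> (x (Suc j) i) (x (Suc j) (Suc i)) - edge_integral \<theta> (x j i) (x j (Suc i))
        = edge_integral \<theta> (x j (Suc i)) (x (Suc j) (Suc i)) - edge_integral \<theta> (x j i) (x (Suc j) i)"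
        using cell[of i j] j by simp
    qed
    also have "\<dots> = edge_integral \<theta> (x j L) (x (Suc j) L) - edge_integral \<theta> (x j 0) (x (Suc j) 0)"
      by (rule sum_lessThan_telescope)
    also have "\<dots> = 0" unfolding e0 using z[OF xU] j by simp
    finally show ?thesis by simp
  qed
  have "(\<Sum>i<L. edge_integral \<theta> (x j i) (x j (Suc i))) = (\<Sum>i<L. edge_integral \<theta> (x 0 i) (x 0 (Suc i)))" if "j \<le> L" for j
    using that by (induction j) (auto simp: row)
  from this[of L]
  have "(\<Sum>i<L. edge_integral \<theta> (x L i) (x L (Suc i))) = (\<Sum>i<L. edge_integral \<theta> (x 0 i) (x 0 (Suc i)))" by simp
  moreover have "(\<Sum>i<L. edge_integral \<theta> (x 0 i) (x 0 (Suc i))) = path_sum \<theta> p L"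
    unfolding path_sum_def x_def using frac by (intro sum.cong refl) (simp add: h0 del: of_nat_Suc)
  moreover have "(\<Sum>i<L. edge_integral \<theta> (x L i) (x L (Suc i))) = path_sum \<theta> q L"
    unfolding path_sum_def x_def using frac L0 by (intro sum.cong refl) (simp add: h1 del: of_nat_Suc)
  moreover have "path_sum \<theta> p L = path_sum \<theta> p N"
    using path_sum_refine[OF loc N, of "Suc n * M"] NM by (simp add: L_def mult_ac del: mult_Suc mult_Suc_right)
  moreover have "path_sum \<theta> q L = path_sum \<theta> q M"
    using path_sum_refine[OF loc M, of "Suc n * N"] NM by (simp add: L_def mult_ac del: mult_Suc mult_Suc_right)
  ultimately show ?thesis by simp
qed

text \<open>With an even number of steps the junction at time one half is a node, so no edge cuts
  the corner.\<close>

lemma path_sum_joinpaths: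
  assumes K: "K > 0" and "pathfinish p = pathstart q"
  shows "path_sum \<theta> (p +++ q) (2 * K) = path_sum \<theta> p K + path_sum \<theta> q K"
proof -
  have K0: "real K > 0" using K by simp
  have l: "(p +++ q) (real i / real (2 * K)) = p (real i / real K)" if "i \<le> K" for i
  proof -
    have "real i / real (2 * K) \<le> 1/2" using that K0 by (simp add: field_simps)
    moreover have "2 * (real i / real (2 * K)) = real i / real K" using K0 by (simp add: field_simps)
    ultimately show ?thesis by (simp add: joinpaths_def)
  qed
  have r: "(p +++ q) (real (i + K) / real (2 * K)) = q (real i / real K)" for i
  proof (cases "i = 0")
    case True
    have h: "real K / real (2 * K) = 1/2" using K0 by simp
    show ?thesis
      using True assms(2) unfolding True add_0 h by (simp add: joinpaths_def pathfinish_def pathstart_def)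
  next
    case False
    then have "\<not> real (i + K) / real (2 * K) \<le> 1/2" using K0 by (simp add: field_simps)
    moreover have "2 * (real (i + K) / real (2 * K)) - 1 = real i / real K" using K0 by (simp add: field_simps)
    ultimately show ?thesis by (simp add: joinpaths_def)
  qed
  let ?E = "\<lambda>i. edge_integral \<theta> ((p +++ q) (real i / real (2 * K))) ((p +++ q) (real (Suc i) / real (2 * K)))"
  have "{..<2 * K} = {0..<K + K}" by auto
  then have "path_sum \<theta> (p +++ q) (2 * K) = sum ?E {0..<K + K}" by (simp only: path_sum_def)
  also have "\<dots> = sum ?E {0..<K} + sum ?E {K..<K + K}"
    by (rule sum.atLeastLessThan_concat[symmetric]) auto
  also have "sum ?E {K..<K + K} = (\<Sum>i=0..<K. ?E (i + K))"
    using sum.shift_bounds_nat_ivl[of ?E 0 K K] by simp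
  also have "(\<Sum>i=0..<K. ?E (i + K)) = path_sum \<theta> q K"
    unfolding path_sum_def atLeast0LessThan add_Suc[symmetric] r ..
  also have "sum ?E {0..<K} = path_sum \<theta> p K"
    unfolding path_sum_def atLeast0LessThan by (intro sum.cong refl) (simp add: l del: of_nat_Suc of_nat_mult)
  finally show ?thesis .
qed

text \<open>The potential at \<open>x\<close> is the polygonal integral along a chosen path from a
  base point. Near \<open>x\<close>, homotopy invariance replaces the path chosen for a neighbour by
  the path for \<open>x\<close> followed by a segment, so the potential differs from a local
  primitive by a constant.\<close>

lemma simply_connected_potential:
  fixes \<theta> :: "'a::euclidean_space \<Rightarrow> 'a \<Rightarrow> real"
  assumes U: "open U" "simply_connected U"
    and lin: "\<And>x. x \<in> U \<Longrightarrow> linear (\<theta> x)" and sm: "\<And>v. smooth_on U (\<lambda>x. \<theta> x v)"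
    and cl: "\<And>x a b. x \<in> U \<Longrightarrow>
      \<D> (\<lambda>y. \<theta> y a) x b = \<D> (\<lambda>y. \<theta> y b) x a"
  obtains s where "smooth_on U s" "\<And>x. x \<in> U \<Longrightarrow> (s has_derivative \<theta> x) (at x)"
proof (cases "U = {}")
  case True
  then show ?thesis using that[of "\<lambda>x. 0"] smooth_on_const[OF U(1)] by auto
next
  case False
  then obtain a where a: "a \<in> U" by auto
  have loc: "\<exists>f. \<forall>x\<in>ball c r. (f has_derivative \<theta> x) (at x)" if "ball c r \<subseteq> U" for c r
    using Poincare_ball[OF U(1) that lin sm cl] by metis
  have "\<exists>g. path g \<and> path_image g \<subseteq> U \<and> pathstart g = a \<and> pathfinish g = x" if "x \<in> U" for x
    using simply_connected_imp_path_connected[OF U(2)] a that unfolding path_connected_def by blast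
  then obtain g where g: "\<And>x. x \<in> U \<Longrightarrow> path (g x)" "\<And>x. x \<in> U \<Longrightarrow> path_image (g x) \<subseteq> U"
    "\<And>x. x \<in> U \<Longrightarrow> pathstart (g x) = a" "\<And>x. x \<in> U \<Longrightarrow> pathfinish (g x) = x"
    by metis
  obtain N where N: "\<And>x. x \<in> U \<Longrightarrow> fine_for U (g x) (N x)"
    using fine_for_exists[OF U(1) g(1,2)] by metis
  define s where "s x = path_sum \<theta> (g x) (N x)" for x
  have diff: "s y = s x + (f y - f x)"
    if r: "ball x r \<subseteq> U" "r > 0" and f: "\<And>z. z \<in> ball x r \<Longrightarrow> (f has_derivative \<theta> z) (at z)" and y: "y \<in> ball x r"
    for x y r f
  proof -
    have xU: "x \<in> U" "y \<in> U" using r y by auto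
    let ?l = "linepath x y"
    have seg: "?l t \<in> ball x r" if "t \<in> {0..1}" for t
      using convexD_alt[OF convex_ball, of x x r y t] y r(2) that by (simp add: linepath_def)
    have pl: "path ?l" "path_image ?l \<subseteq> U" using seg r(1) by (auto simp: path_image_def simp del: mem_ball)
    let ?j = "g x +++ ?l"
    have pj: "path ?j" "path_image ?j \<subseteq> U"
      by (rule path_join_imp[OF g(1)[OF xU(1)] pl(1)], simp add: g(4)[OF xU(1)])
        (rule subset_path_image_join[OF g(2)[OF xU(1)] pl(2)])
    obtain M where M: "fine_for U ?j M" using fine_for_exists[OF U(1) pj] by blast
    have hom: "homotopic_paths U (g y) ?j"
      using U(2) unfolding simply_connected_eq_homotopic_paths using g[OF xU(1)] g[OF xU(2)] pj by simp
    \<comment> \<open>Twice this number is a multiple of \<open>M\<close>, hence fine for the joined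
      path, and even, so the junction is a node; each half then has a multiple of \<open>N x\<close>
      steps. The segment stays in a ball with a primitive and needs no fineness.\<close>
    define K where "K = M * N x"
    have K: "K > 0" using M N[OF xU(1)] by (simp add: K_def fine_for_def)
    have "s y = path_sum \<theta> ?j (M * (2 * N x))"
      unfolding s_def using N[OF xU(1)]
      by (intro path_sum_homotopic[OF U(1) loc hom N[OF xU(2)]] fine_for_mult M) (auto simp: fine_for_def)
    also have "M * (2 * N x) = 2 * K" by (simp add: K_def)
    also have "path_sum \<theta> ?j (2 * K) = path_sum \<theta> (g x) K + path_sum \<theta> ?l K"
      by (rule path_sum_joinpaths[OF K]) (use g(4)[OF xU(1)] in simp)
    also have "path_sum \<theta> (g x) K = s x"
      using path_sum_refine[OF loc N[OF xU(1)], of M] M by (simp add: K_def s_def fine_for_def mult.commute)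
    also have "path_sum \<theta> ?l K = f y - f x"
    proof -
      have fr: "real i / real K \<in> {0..1}" if "i \<le> K" for i using that K by simp
      have "path_sum \<theta> ?l K = (\<Sum>i<K. f (?l (real (Suc i) / real K)) - f (?l (real i / real K)))"
        unfolding path_sum_def
      proof (rule sum.cong[OF refl])
        fix i assume "i \<in> {..<K}"
        then have "i \<le> K" "Suc i \<le> K" by auto
        then show "edge_integral \<theta> (?l (real i / real K)) (?l (real (Suc i) / real K))
            = f (?l (real (Suc i) / real K)) - f (?l (real i / real K))"
          by (intro edge_integral_primitive[OF f convex_ball seg[OF fr] seg[OF fr]])
      qed
      also have "\<dots> = f (?l (real K / real K)) - f (?l (real 0 / real K))" by (rule sum_lessThan_telescope)
      also have "\<dots> = f y - f x" using K by (simp add: linepath_def)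
      finally show ?thesis .
    qed
    finally show ?thesis .
  qed
  have ds: "(s has_derivative \<theta> x) (at x)" if x: "x \<in> U" for x
  proof -
    obtain r where r: "r > 0" "ball x r \<subseteq> U" using U(1) x open_contains_ball by blast
    obtain f where f: "\<And>z. z \<in> ball x r \<Longrightarrow> (f has_derivative \<theta> z) (at z)" using loc[OF r(2)] by blast
    have "((\<lambda>y. (s x - f x) + f y) has_derivative (\<lambda>v. 0 + \<theta> x v)) (at x)"
      by (intro has_derivative_add has_derivative_const f[OF centre_in_ball[THEN iffD2, OF r(1)]])
    then have d: "((\<lambda>y. (s x - f x) + f y) has_derivative \<theta> x) (at x)"
      by (simp only: add_0_left)
    have xr: "x \<in> ball x r" using r(1) by simp
    have eq: "(s x - f x) + f y = s y" if "y \<in> ball x r" for y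
      using diff[OF r(2,1) f that] by linarith
    show ?thesis by (rule has_derivative_transform_within_open[OF d open_ball xr eq])
  qed
  show ?thesis by (rule that[OF smooth_onI[OF U(1) ds sm] ds])
qed

section \<open>Forms on space-time\<close>

text \<open>Every permutation of \<open>Suc n\<close> points is a transposition moving the last
  point, composed with a permutation of the others. Used as a rewrite rule, it unrolls the sums in
  \<open>wedge\<close> for fixed small degrees.\<close>

lemma sum_sign_permutes_Suc:
  fixes g :: "(nat \<Rightarrow> nat) \<Rightarrow> real"
  shows "(\<Sum>\<sigma> | \<sigma> permutes {..<Suc n}. of_int (sign \<sigma>) * g \<sigma>)
    = (\<Sum>b\<le>n. (if b = n then 1 else - 1) *
        (\<Sum>\<sigma> | \<sigma> permutes {..<n}. of_int (sign \<sigma>) * g (Transposition.transpose n b \<circ> \<sigma>)))"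
proof -
  have s: "of_int (sign (Transposition.transpose n b \<circ> \<sigma>)) = (if b = n then 1 else - 1 :: real) * of_int (sign \<sigma>)"
    if "\<sigma> permutes {..<n}" for b \<sigma>
  proof -
    have "permutation \<sigma>" using that by (auto simp: permutation_permutes)
    then show ?thesis
      by (simp add: sign_compose permutation_swap_id sign_swap_id)
  qed
  have "(\<Sum>\<sigma> | \<sigma> permutes {..<Suc n}. of_int (sign \<sigma>) * g \<sigma>)
      = (\<Sum>b\<in>insert n {..<n}. \<Sum>\<sigma> | \<sigma> permutes {..<n}.
          of_int (sign (Transposition.transpose n b \<circ> \<sigma>)) * g (Transposition.transpose n b \<circ> \<sigma>))"
    unfolding lessThan_Suc by (rule sum_over_permutations_insert) auto
  also have "insert n {..<n} = {..n}" by auto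
  also have "(\<Sum>b\<le>n. \<Sum>\<sigma> | \<sigma> permutes {..<n}.
          of_int (sign (Transposition.transpose n b \<circ> \<sigma>)) * g (Transposition.transpose n b \<circ> \<sigma>))
     = (\<Sum>b\<le>n. (if b = n then 1 else - 1) *
        (\<Sum>\<sigma> | \<sigma> permutes {..<n}. of_int (sign \<sigma>) * g (Transposition.transpose n b \<circ> \<sigma>)))"
    unfolding sum_distrib_left by (intro sum.cong refl) (simp add: s)
  finally show ?thesis .
qed

lemma sum_sign_permutes_0: "(\<Sum>\<sigma> | \<sigma> permutes {..<0::nat}. of_int (sign \<sigma>) * g \<sigma>) = (g id :: real)"
  by simp

lemma wedge_1_1:
  "wedge 1 1 (\<lambda>x v. A x (v 0)) (\<lambda>x v. B x (v 0)) x v = A x (v 0) * B x (v 1) - A x (v 1) * B x (v 0)"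
proof -
  have n: "1 + 1 = Suc (Suc 0)" by simp
  show ?thesis
    unfolding wedge_def n mult.assoc sum_sign_permutes_Suc sum_sign_permutes_0
    by (simp add: Transposition.transpose_def)
qed

text \<open>Antisymmetry folds the six permutations into three shuffles, each occurring twice, which
  the factorials in \<open>wedge\<close> compensate.\<close>

lemma wedge_2_1:
  assumes "\<And>x a b. A x a b = - A x b a"
  shows "wedge 2 1 (\<lambda>x v. A x (v 0) (v 1)) (\<lambda>x v. B x (v 0)) x v
    = A x (v 0) (v 1) * B x (v 2) - A x (v 0) (v 2) * B x (v 1) + A x (v 1) (v 2) * B x (v 0)"
proof -
  have n: "2 + 1 = Suc (Suc (Suc 0))" by simp
  show ?thesis
    unfolding wedge_def n mult.assoc sum_sign_permutes_Suc sum_sign_permutes_0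
    using assms[of x "v 1" "v 0"] assms[of x "v 2" "v 0"] assms[of x "v 2" "v 1"]
    by (simp add: Transposition.transpose_def numeral_2_eq_2 field_simps)
qed

text \<open>The normalisation reduces 24 permutations to six shuffles; as the two factors coincide,
  these agree in pairs, whence the factor two.\<close>

lemma wedge_2_2:
  assumes "\<And>x a b. A x a b = - A x b a"
  shows "wedge 2 2 (\<lambda>x v. A x (v 0) (v 1)) (\<lambda>x v. A x (v 0) (v 1)) x v
    = 2 * (A x (v 0) (v 1) * A x (v 2) (v 3) - A x (v 0) (v 2) * A x (v 1) (v 3) + A x (v 0) (v 3) * A x (v 1) (v 2))"
proof -
  have n: "2 + 2 = Suc (Suc (Suc (Suc 0)))" by simp
  show ?thesis
    unfolding wedge_def n mult.assoc sum_sign_permutes_Suc sum_sign_permutes_0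
    using assms[of x "v 1" "v 0"] assms[of x "v 2" "v 0"] assms[of x "v 2" "v 1"]
      assms[of x "v 3" "v 0"] assms[of x "v 3" "v 1"] assms[of x "v 3" "v 2"]
    by (simp add: Transposition.transpose_def numeral_2_eq_2 numeral_3_eq_3 fact_numeral field_simps)
qed

text \<open>The two assumed adjacent swaps generate all sign rules for \<open>T\<close>; what
  remains is a choice of the argument that goes to \<open>B\<close>.\<close>

lemma wedge_3_1:
  assumes "\<And>x a b c. T x a b c = - T x b a c" "\<And>x a b c. T x a b c = - T x a c b"
  shows "wedge 3 1 (\<lambda>x v. T x (v 0) (v 1) (v 2)) (\<lambda>x v. B x (v 0)) x v
    = T x (v 0) (v 1) (v 2) * B x (v 3) - T x (v 0) (v 1) (v 3) * B x (v 2)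
      + T x (v 0) (v 2) (v 3) * B x (v 1) - T x (v 1) (v 2) (v 3) * B x (v 0)"
proof -
  have n: "3 + 1 = Suc (Suc (Suc (Suc 0)))" by simp
  have p: "T x b a c = - T x a b c" "T x a c b = - T x a b c" "T x b c a = T x a b c"
    "T x c a b = T x a b c" "T x c b a = - T x a b c" for a b c
    using assms(1)[of x b a c] assms(2)[of x a c b] assms(2)[of x b c a] assms(1)[of x c a b] assms(1)[of x c b a]
    by linarith+
  show ?thesis
    unfolding wedge_def n mult.assoc sum_sign_permutes_Suc sum_sign_permutes_0
    using p[of "v 0" "v 1" "v 2"] p[of "v 0" "v 1" "v 3"] p[of "v 0" "v 2" "v 3"] p[of "v 1" "v 2" "v 3"]
    by (simp add: Transposition.transpose_def numeral_2_eq_2 numeral_3_eq_3 fact_numeral field_simps)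
qed

lemma ext_d_form0: "ext_d 0 (form0 f) = (\<lambda>x v. \<D> f x (v 0))"
  by (simp add: ext_d_def form0_def)

lemma frechet_derivative_bounded_linear:
  "bounded_linear f \<Longrightarrow> \<D> f x = f"
  using frechet_derivative_at[OF bounded_linear_imp_has_derivative] by metis

lemma dt_eq: "dt = (\<lambda>x v. fst (v 0))"
  unfolding dt_def ext_d_form0 by (simp add: frechet_derivative_bounded_linear[OF bounded_linear_fst])

lemma wedge_d_d: "wedge 1 1 (ext_d 0 (form0 p)) (ext_d 0 (form0 q)) x v
    = \<D> p x (v 0) * \<D> q x (v 1)
      - \<D> p x (v 1) * \<D> q x (v 0)"
  unfolding ext_d_form0
  by (rule wedge_1_1[where A = "\<lambda>x. \<D> p x" and B = "\<lambda>x. \<D> q x"])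

lemma wedge_d_dt: "wedge 1 1 (ext_d 0 (form0 f)) dt x v
    = \<D> f x (v 0) * fst (v 1) - \<D> f x (v 1) * fst (v 0)"
  unfolding ext_d_form0 dt_eq
  by (rule wedge_1_1[where A = "\<lambda>x. \<D> f x" and B = "\<lambda>x. fst"])

lemma dx_eq: "dx i = (\<lambda>x v. snd (v 0) $ i)"
  unfolding dx_def ext_d_form0
  by (simp add: frechet_derivative_bounded_linear[OF bounded_linear_compose[OF bounded_linear_vec_nth bounded_linear_snd]])

lemma inner_3: "(a :: real^3) \<bullet> b = a$1 * b$1 + a$2 * b$2 + a$3 * b$3"
  by (simp add: inner_vec_def sum_3)

lemma cross3_components:
  "cross3 a b $ 1 = a$2 * b$3 - a$3 * b$2"
  "cross3 a b $ 2 = a$3 * b$1 - a$1 * b$3"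
  "cross3 a b $ 3 = a$1 * b$2 - a$2 * b$1"
  by (simp_all add: cross3_def)

lemma dot_dx_eq: "dot_dx V = (\<lambda>x v. V x \<bullet> snd (v 0))"
  by (simp add: dot_dx_def dx_eq inner_3)

lemma dot_dxdx_eq: "dot_dxdx V = (\<lambda>x v. V x \<bullet> cross3 (snd (v 0)) (snd (v 1)))"
proof (intro ext)
  fix x v
  have w: "wedge 1 1 (dx i) (dx j) x v = snd (v 0) $ i * snd (v 1) $ j - snd (v 1) $ i * snd (v 0) $ j" for i j
    unfolding dx_eq by (rule wedge_1_1)
  show "dot_dxdx V x v = V x \<bullet> cross3 (snd (v 0)) (snd (v 1))"
    unfolding dot_dxdx_def w by (simp add: inner_3 cross3_components algebra_simps)
qed

definition euler_2form :: "real^3 \<Rightarrow> real^3 \<Rightarrow> spacetime \<Rightarrow> spacetime \<Rightarrow> real" where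
  "euler_2form \<alpha> w a b = - (\<alpha> \<bullet> snd a * fst b - \<alpha> \<bullet> snd b * fst a) + w \<bullet> cross3 (snd a) (snd b)"

lemma euler_2form_antisym: "euler_2form \<alpha> w a b = - euler_2form \<alpha> w b a"
  by (simp add: euler_2form_def inner_3 cross3_components algebra_simps)

lemma Omega_e_eq: "Omega_e u h = (\<lambda>x v.
    euler_2form (grad h x + cross3 (u x) (curl u x)) (curl u x) (v 0) (v 1))"
  unfolding Omega_e_def dot_dxdx_eq dot_dx_eq dt_eq euler_2form_def
  by (intro ext) (simp only: wedge_1_1[where
      A = "\<lambda>x a. (grad h x + cross3 (u x) (curl u x)) \<bullet> snd a" and B = "\<lambda>x a. fst a"])

lemma volume_form_eq: "volume_form x v =
    snd (v 0) \<bullet> cross3 (snd (v 1)) (snd (v 2)) * fst (v 3) - snd (v 0) \<bullet> cross3 (snd (v 1)) (snd (v 3)) * fst (v 2)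
      + snd (v 0) \<bullet> cross3 (snd (v 2)) (snd (v 3)) * fst (v 1) - snd (v 1) \<bullet> cross3 (snd (v 2)) (snd (v 3)) * fst (v 0)"
proof -
  define T where "T x a b c = snd a \<bullet> cross3 (snd b) (snd c)" for x a b c :: spacetime
  define A where "A x a b = snd a $ 1 * snd b $ 2 - snd b $ 1 * snd a $ 2" for x a b :: spacetime
  have 1: "wedge 1 1 (dx 1) (dx 2) = (\<lambda>x v. A x (v 0) (v 1))"
    unfolding dx_eq A_def by (intro ext) (rule wedge_1_1)
  have A: "A x a b = - A x b a" for x a b by (simp add: A_def)
  have 2: "wedge 2 1 (\<lambda>x v. A x (v 0) (v 1)) (dx 3) = (\<lambda>x v. T x (v 0) (v 1) (v 2))"
    unfolding dx_eq
  proof (intro ext)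
    fix x v
    have "wedge 2 1 (\<lambda>x v. A x (v 0) (v 1)) (\<lambda>x v. snd (v 0) $ 3) x v
      = A x (v 0) (v 1) * snd (v 2) $ 3 - A x (v 0) (v 2) * snd (v 1) $ 3 + A x (v 1) (v 2) * snd (v 0) $ 3"
      by (rule wedge_2_1) (rule A)
    also have "\<dots> = T x (v 0) (v 1) (v 2)"
      unfolding A_def T_def inner_3 cross3_components by (simp add: algebra_simps)
    finally show "wedge 2 1 (\<lambda>x v. A x (v 0) (v 1)) (\<lambda>x v. snd (v 0) $ 3) x v = T x (v 0) (v 1) (v 2)" .
  qed
  have "volume_form x v = T x (v 0) (v 1) (v 2) * fst (v 3) - T x (v 0) (v 1) (v 3) * fst (v 2)
      + T x (v 0) (v 2) (v 3) * fst (v 1) - T x (v 1) (v 2) (v 3) * fst (v 0)"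
    unfolding volume_form_def 1 2 dt_eq
    by (rule wedge_3_1) (simp_all add: T_def inner_3 cross3_components algebra_simps)
  then show ?thesis by (simp only: T_def)
qed

text \<open>The wedge product of a 1-form \<open>\<alpha>\<close> and a 2-form \<open>w\<close> on 3-space, followed by \<open>w \<and> w = 0\<close>.\<close>

lemma inner_wedge_triple:
  "(\<alpha> \<bullet> a) * (w \<bullet> cross3 b c) - (\<alpha> \<bullet> b) * (w \<bullet> cross3 a c) + (\<alpha> \<bullet> c) * (w \<bullet> cross3 a b)
    = (\<alpha> \<bullet> w) * (a \<bullet> cross3 b c)"
  unfolding inner_3 cross3_components by (simp add: algebra_simps)

lemma triple_wedge_triple:
  "(w \<bullet> cross3 a b) * (w \<bullet> cross3 c d) - (w \<bullet> cross3 a c) * (w \<bullet> cross3 b d)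
    + (w \<bullet> cross3 a d) * (w \<bullet> cross3 b c) = 0"
  unfolding inner_3 cross3_components by (simp add: algebra_simps)

lemma pfaffian_split:
  fixes b0 :: real
  shows "(- (b0 * t1 - b1 * t0) + c01) * (- (b2 * t3 - b3 * t2) + c23)
    - (- (b0 * t2 - b2 * t0) + c02) * (- (b1 * t3 - b3 * t1) + c13)
    + (- (b0 * t3 - b3 * t0) + c03) * (- (b1 * t2 - b2 * t1) + c12)
    = (c01 * c23 - c02 * c13 + c03 * c12)
      - ((b0 * c12 - b1 * c02 + b2 * c01) * t3 - (b0 * c13 - b1 * c03 + b3 * c01) * t2
         + (b0 * c23 - b2 * c03 + b3 * c02) * t1 - (b1 * c23 - b2 * c13 + b3 * c12) * t0)"
  by (simp add: algebra_simps)

lemma euler_2form_square: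
  "1/2 * wedge 2 2 (\<lambda>x v. euler_2form (\<alpha> x) (w x) (v 0) (v 1)) (\<lambda>x v. euler_2form (\<alpha> x) (w x) (v 0) (v 1)) x v
    = - (\<alpha> x \<bullet> w x) * volume_form x v"
proof -
  have "wedge 2 2 (\<lambda>x v. euler_2form (\<alpha> x) (w x) (v 0) (v 1)) (\<lambda>x v. euler_2form (\<alpha> x) (w x) (v 0) (v 1)) x v
    = 2 * (euler_2form (\<alpha> x) (w x) (v 0) (v 1) * euler_2form (\<alpha> x) (w x) (v 2) (v 3)
      - euler_2form (\<alpha> x) (w x) (v 0) (v 2) * euler_2form (\<alpha> x) (w x) (v 1) (v 3)
      + euler_2form (\<alpha> x) (w x) (v 0) (v 3) * euler_2form (\<alpha> x) (w x) (v 1) (v 2))"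
    by (rule wedge_2_2) (rule euler_2form_antisym)
  then show ?thesis
    unfolding euler_2form_def pfaffian_split triple_wedge_triple inner_wedge_triple volume_form_eq
    by (simp add: right_diff_distrib distrib_left)
qed

text \<open>Testing a kernel vector \<open>(t, y)\<close> with the time direction gives
  \<open>\<alpha> \<bullet> y = 0\<close>, with spatial directions
  \<open>t *\<^sub>R \<alpha> + cross3 w y = 0\<close>. The inner product with \<open>w\<close>
  isolates \<open>t\<close>, and the double cross product with \<open>\<alpha>\<close> isolates
  \<open>y\<close>, both with coefficient \<open>\<alpha> \<bullet> w\<close> up to sign.\<close>

lemma euler_2form_nondegenerate:
  assumes "\<alpha> \<bullet> w \<noteq> 0" "\<And>b. euler_2form \<alpha> w a b = 0"
  shows "a = 0"
proof -
  obtain t y where a: "a = (t, y)" by (cases a)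
  have 1: "\<alpha> \<bullet> y = 0"
    using assms(2)[of "(1, 0)"] by (simp add: euler_2form_def a inner_3 cross3_components algebra_simps)
  have "t *\<^sub>R \<alpha> + cross3 w y = 0"
  proof -
    have "(t *\<^sub>R \<alpha> + cross3 w y) \<bullet> z = 0" for z
      using assms(2)[of "(0, z)"] by (simp add: euler_2form_def a inner_3 cross3_components algebra_simps)
    then show ?thesis using inner_eq_zero_iff by blast
  qed
  then have 2: "(t *\<^sub>R \<alpha> + cross3 w y) \<bullet> w = 0" "cross3 \<alpha> (t *\<^sub>R \<alpha> + cross3 w y) = 0" by simp_all
  have "(t *\<^sub>R \<alpha> + cross3 w y) \<bullet> w = t * (\<alpha> \<bullet> w)"
    by (simp add: inner_add_left dot_cross_self)
  with 2(1) assms(1) have t: "t = 0" by simp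
  have "cross3 \<alpha> (cross3 w y) = (\<alpha> \<bullet> y) *\<^sub>R w - (\<alpha> \<bullet> w) *\<^sub>R y"
    by (simp add: vec_eq_iff forall_3 inner_3 cross3_components algebra_simps)
  with 1 2(2) t assms(1) have "y = 0" by simp
  with t a show ?thesis by (simp add: zero_prod_def)
qed

section \<open>The exact symplectic form of the Euler flow\<close>

lemma frechet_derivative_eqI: "(f has_derivative D) (at x) \<Longrightarrow> \<D> f x v = D v"
  using frechet_derivative_at by metis

text \<open>The exterior derivative squares to zero: the six second derivatives cancel in pairs by
  symmetry.\<close>

lemma exact_closed_2form:
  fixes T :: "'a::euclidean_space \<Rightarrow> 'a \<Rightarrow> real"
  assumes lin: "\<And>x. linear (T x)" and sm: "\<And>b. smooth_on UNIV (\<lambda>x. T x b)"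
  shows "closed_2form (\<lambda>x a b. \<D> (\<lambda>y. T y b) x a - \<D> (\<lambda>y. T y a) x b)"
proof -
  note dT = smooth_on_has_derivative[OF sm UNIV_I]
  have sd: "smooth_on UNIV (\<lambda>x. \<D> (\<lambda>y. T y b) x a)" for a b
    by (rule smooth_on_frechet_derivative[OF sm])
  note dd = smooth_on_has_derivative[OF sd UNIV_I]
  have la: "linear (\<lambda>b. \<D> (\<lambda>y. T y b) x a)" for x a
  proof (rule linearI)
    fix b c
    show "\<D> (\<lambda>y. T y (b + c)) x a
        = \<D> (\<lambda>y. T y b) x a + \<D> (\<lambda>y. T y c) x a"
      unfolding linear_add[OF lin] by (rule frechet_derivative_eqI[OF has_derivative_add[OF dT dT]])
  next
    fix r :: real and b
    show "\<D> (\<lambda>y. T y (r *\<^sub>R b)) x a = r *\<^sub>R \<D> (\<lambda>y. T y b) x a"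
      unfolding linear_cmul[OF lin] by (rule frechet_derivative_eqI[OF has_derivative_scaleR_right[OF dT]])
  qed
  have lb: "linear (\<D> (\<lambda>y. T y a) x)" for x a
    by (rule has_derivative_linear[OF dT])
  have split: "\<D> (\<lambda>x. \<D> (\<lambda>y. T y c) x b - \<D> (\<lambda>y. T y b) x c) x a
    = \<D> (\<lambda>x. \<D> (\<lambda>y. T y c) x b) x a
      - \<D> (\<lambda>x. \<D> (\<lambda>y. T y b) x c) x a" for x a b c
    by (rule frechet_derivative_eqI[OF has_derivative_diff[OF dd dd]])
  have comm: "\<D> (\<lambda>x. \<D> (\<lambda>y. T y c) x a) x b
      = \<D> (\<lambda>x. \<D> (\<lambda>y. T y c) x b) x a" for x a b c
    by (rule frechet_derivative_commute[OF open_UNIV UNIV_I sm])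
  show ?thesis
    unfolding closed_2form_def
  proof (intro conjI allI)
    show "linear (\<lambda>b. \<D> (\<lambda>y. T y b) x a - \<D> (\<lambda>y. T y a) x b)" for x a
      by (intro linear_compose_sub la lb)
    show "smooth_on UNIV (\<lambda>x. \<D> (\<lambda>y. T y b) x a - \<D> (\<lambda>y. T y a) x b)" for a b
      by (intro smooth_on_diff sd open_UNIV)
    fix x a b c
    show "\<D> (\<lambda>y. \<D> (\<lambda>y. T y c) y b - \<D> (\<lambda>y. T y b) y c) x a
      + \<D> (\<lambda>y. \<D> (\<lambda>y. T y a) y c - \<D> (\<lambda>y. T y c) y a) x b
      + \<D> (\<lambda>y. \<D> (\<lambda>y. T y b) y a - \<D> (\<lambda>y. T y a) y b) x c = 0"
      unfolding split using comm[of c b x a] comm[of b c x a] comm[of a c x b] by simp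
  qed simp
qed

lemma ext_d_1: "ext_d 1 (\<lambda>x v. T x (v 0)) = (\<lambda>x v.
    \<D> (\<lambda>y. T y (v 1)) x (v 0) - \<D> (\<lambda>y. T y (v 0)) x (v 1))"
  by (simp add: ext_d_def)

lemma is_form_1:
  assumes "\<And>x. linear (T x)" "\<And>b. smooth_on UNIV (\<lambda>x. T x b)"
  shows "is_form 1 (\<lambda>x v. T x (v 0))"
  unfolding is_form_def using assms by auto

lemma closed_2form_is_form:
  assumes cl: "closed_2form \<omega>"
  shows "is_form 2 (\<lambda>x v. \<omega> x (v 0) (v 1))" and "ext_d 2 (\<lambda>x v. \<omega> x (v 0) (v 1)) = (\<lambda>x v. 0)"
proof -
  note lin = closed_2form_linear[OF cl] and anti = closed_2form_antisym[OF cl]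
    and sm = closed_2form_smooth[OF cl] and c = closed_2form_closed[OF cl]
    and lin' = closed_2form_linear_left[OF cl]
  have z: "\<omega> x a a = 0" for x a using anti[of x a a] by simp
  have two: "i < (2::nat) \<longleftrightarrow> i = 0 \<or> i = 1" for i by auto
  show "is_form 2 (\<lambda>x v. \<omega> x (v 0) (v 1))"
    unfolding is_form_def using sm lin lin' z by (auto simp: two)
  show "ext_d 2 (\<lambda>x v. \<omega> x (v 0) (v 1)) = (\<lambda>x v. 0)"
  proof (intro ext)
    fix x and v :: "nat \<Rightarrow> 'a"
    have "(\<lambda>y. \<omega> y (v 0) (v 2)) = (\<lambda>y. - \<omega> y (v 2) (v 0))" by (rule ext) (rule anti)
    then have m: "\<D> (\<lambda>y. \<omega> y (v 0) (v 2)) x (v 1)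
        = - \<D> (\<lambda>y. \<omega> y (v 2) (v 0)) x (v 1)"
      using frechet_derivative_eqI[OF has_derivative_minus[OF smooth_on_has_derivative[OF sm UNIV_I]]] by simp
    have "ext_d 2 (\<lambda>x v. \<omega> x (v 0) (v 1)) x v
        = \<D> (\<lambda>y. \<omega> y (v 1) (v 2)) x (v 0)
          - \<D> (\<lambda>y. \<omega> y (v 0) (v 2)) x (v 1)
          + \<D> (\<lambda>y. \<omega> y (v 0) (v 1)) x (v 2)"
      by (simp add: ext_d_def numeral_2_eq_2)
    then show "ext_d 2 (\<lambda>x v. \<omega> x (v 0) (v 1)) x v = 0"
      using c[of "v 1" "v 2" x "v 0"] unfolding m by simp
  qed
qed

lemma frechet_derivative_spacetime:
  fixes f :: "spacetime \<Rightarrow> 'b::real_normed_vector"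
  assumes "(f has_derivative D) (at x)"
  shows "D a = fst a *\<^sub>R partial_t f x + snd a $ 1 *\<^sub>R partial_x 1 f x
      + snd a $ 2 *\<^sub>R partial_x 2 f x + snd a $ 3 *\<^sub>R partial_x 3 f x"
proof -
  have l: "linear D" using assms by (rule has_derivative_linear)
  have D: "\<D> f x = D" using frechet_derivative_at[OF assms] by simp
  have "snd a = (\<Sum>i\<in>UNIV. (snd a $ i) *\<^sub>R axis i 1)"
    using basis_expansion[of "snd a"] by (simp add: scalar_mult_eq_scaleR)
  then have s: "snd a = snd a $ 1 *\<^sub>R axis 1 1 + snd a $ 2 *\<^sub>R axis 2 1 + snd a $ 3 *\<^sub>R axis 3 1"
    by (simp add: sum_3)
  have "a = fst a *\<^sub>R (1, 0) + snd a $ 1 *\<^sub>R (0, axis 1 1) + snd a $ 2 *\<^sub>R (0, axis 2 1) + snd a $ 3 *\<^sub>R (0, axis 3 1)"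
    by (rule prod_eqI) (use s in simp_all)
  then have "D a = D (fst a *\<^sub>R (1, 0) + snd a $ 1 *\<^sub>R (0, axis 1 1) + snd a $ 2 *\<^sub>R (0, axis 2 1) + snd a $ 3 *\<^sub>R (0, axis 3 1))"
    by simp
  then show ?thesis
    by (simp only: partial_t_def partial_x_def D linear_add[OF l] linear_cmul[OF l])
qed

lemma frechet_derivative_spacetime_real:
  fixes f :: "spacetime \<Rightarrow> real"
  assumes "(f has_derivative D) (at x)"
  shows "D a = fst a * partial_t f x + grad f x \<bullet> snd a"
  using frechet_derivative_spacetime[OF assms, of a] by (simp add: inner_3 grad_def algebra_simps)

lemma partial_vec_nth:
  fixes u :: "spacetime \<Rightarrow> real^3"
  assumes "smooth_on UNIV u"
  shows "partial_t (\<lambda>y. u y $ i) x = partial_t u x $ i" "partial_x j (\<lambda>y. u y $ i) x = partial_x j u x $ i"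
  unfolding partial_t_def partial_x_def
  using frechet_derivative_eqI[OF bounded_linear.has_derivative[OF bounded_linear_vec_nth
        smooth_on_has_derivative[OF assms UNIV_I]]] by auto

lemma smooth_on_vec:
  fixes f :: "'a::real_normed_vector \<Rightarrow> real^'n"
  assumes S: "open S" and "\<And>i. smooth_on S (\<lambda>x. f x $ i)"
  shows "smooth_on S f"
proof -
  have "smooth_on S (\<lambda>x. \<Sum>i\<in>UNIV. (f x $ i) *\<^sub>R (axis i 1 :: real^'n))"
    by (intro smooth_on_sum smooth_on_scaleR smooth_on_const S assms(2))
  moreover have "(\<lambda>x. \<Sum>i\<in>UNIV. (f x $ i) *\<^sub>R (axis i 1 :: real^'n)) = f"
    using basis_expansion[where 'a = real and 'n = 'n] by (auto simp: scalar_mult_eq_scaleR)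
  ultimately show ?thesis by simp
qed

lemma smooth_on_partial_x: "smooth_on S f \<Longrightarrow> smooth_on S (partial_x i f)"
  unfolding partial_x_def[abs_def] by (rule smooth_on_frechet_derivative)

lemma smooth_on_curl:
  assumes "smooth_on UNIV u"
  shows "smooth_on UNIV (curl u)"
proof (rule smooth_on_vec[OF open_UNIV])
  have "smooth_on UNIV (\<lambda>x. curl u x $ 1)" "smooth_on UNIV (\<lambda>x. curl u x $ 2)" "smooth_on UNIV (\<lambda>x. curl u x $ 3)"
    unfolding curl_def vector_3
    by (intro smooth_on_diff smooth_on_partial_x smooth_on_vec_nth assms open_UNIV)+
  then have "\<forall>i. smooth_on UNIV (\<lambda>x. curl u x $ i)" unfolding forall_3 by blast
  then show "smooth_on UNIV (\<lambda>x. curl u x $ i)" for i by blast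
qed

text \<open>With \<open>\<nabla>(|u|\<^sup>2/2) = (u \<sqdot> \<nabla>)u + u \<times> w\<close>, the Euler equation turns \<open>\<nabla>\<psi> - \<partial>\<^sub>t u\<close> into
  \<open>- (\<nabla>h + u \<times> w)\<close>; here \<open>U i\<close> is \<open>\<partial>\<^sub>i u\<close> and \<open>q\<close> is the pressure gradient.\<close>

lemma euler_2form_algebra:
  assumes Ut: "Ut = - (u$1 *\<^sub>R U1 + u$2 *\<^sub>R U2 + u$3 *\<^sub>R U3) - q"
    and w: "w = vector [U2$3 - U3$2, U3$1 - U1$3, U1$2 - U2$1]"
  shows "euler_2form (H + cross3 u w) w a b =
    (- (fst a * c + H \<bullet> snd a + q \<bullet> snd a
        + u \<bullet> (fst a *\<^sub>R Ut + snd a $ 1 *\<^sub>R U1 + snd a $ 2 *\<^sub>R U2 + snd a $ 3 *\<^sub>R U3)) * fst b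
      + (fst a *\<^sub>R Ut + snd a $ 1 *\<^sub>R U1 + snd a $ 2 *\<^sub>R U2 + snd a $ 3 *\<^sub>R U3) \<bullet> snd b)
    - (- (fst b * c + H \<bullet> snd b + q \<bullet> snd b
        + u \<bullet> (fst b *\<^sub>R Ut + snd b $ 1 *\<^sub>R U1 + snd b $ 2 *\<^sub>R U2 + snd b $ 3 *\<^sub>R U3)) * fst a
      + (fst b *\<^sub>R Ut + snd b $ 1 *\<^sub>R U1 + snd b $ 2 *\<^sub>R U2 + snd b $ 3 *\<^sub>R U3) \<bullet> snd a)"
  unfolding euler_2form_def inner_3 vector_add_component vector_scaleR_component cross3_components Ut w
    vector_3 vector_minus_component vector_uminus_component
  by (simp add: algebra_simps)

section \<open>Exactness, closedness and Liouville volume for a solution of the Euler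
  equations\<close>

locale euler_flow =
  fixes u :: "spacetime \<Rightarrow> real^3" and P \<rho> h :: "spacetime \<Rightarrow> real"
  assumes u: "smooth_on UNIV u" and P: "smooth_on UNIV P" and \<rho>: "smooth_on UNIV \<rho>" and h: "smooth_on UNIV h"
    and \<rho>_pos: "\<And>x. \<rho> x > 0"
    and euler: "euler_incompressible u P \<rho>"
    and advect: "\<And>x. partial_t h x + convect u h x = 0"
    and transversal: "\<And>x. curl u x \<bullet> grad h x \<noteq> 0"
begin

definition Q where "Q = (\<lambda>y. (1 / \<rho> y) * P y)"
definition \<psi> where "\<psi> = psi_e u P \<rho> h"
text \<open>The one-form \<open>- theta_e\<close> as a function of a single vector; with this sign
  \<open>\<Omega>\<close> is its exterior derivative.\<close>

definition \<beta> where "\<beta> y b = \<psi> y * fst b + u y \<bullet> snd b"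
definition \<Omega> where "\<Omega> x = euler_2form (grad h x + cross3 (u x) (curl u x)) (curl u x)"
text \<open>\<open>\<Omega> + dh \<and> dt\<close>, the part of \<open>\<Omega>\<close> that does not depend on \<open>h\<close>.\<close>

definition \<Omega>' where "\<Omega>' x = euler_2form (cross3 (u x) (curl u x)) (curl u x)"

lemma Q: "smooth_on UNIV Q"
proof -
  have "smooth_on UNIV (\<lambda>y. inverse (\<rho> y) * P y)"
    by (intro smooth_on_mult P open_UNIV smooth_on_compose[OF _ _ smooth_on_inverse \<rho>])
      (use \<rho>_pos in \<open>auto simp: open_Compl less_imp_neq[symmetric]\<close>)
  then show ?thesis by (simp add: Q_def inverse_eq_divide)
qed

lemma \<psi>_eq: "\<psi> = (\<lambda>x. - (h x + Q x + 1/2 * (u x \<bullet> u x)))"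
  by (simp add: \<psi>_def psi_e_def[abs_def] Q_def power2_norm_eq_inner)

lemma \<psi>: "smooth_on UNIV \<psi>"
  unfolding \<psi>_eq by (intro smooth_on_minus smooth_on_add smooth_on_mult smooth_on_inner smooth_on_const h Q u open_UNIV)

lemma \<beta>_smooth: "smooth_on UNIV (\<lambda>y. \<beta> y b)"
  unfolding \<beta>_def by (intro smooth_on_add smooth_on_mult smooth_on_inner smooth_on_const \<psi> u open_UNIV)

lemma \<beta>_linear: "linear (\<beta> y)"
  unfolding \<beta>_def[abs_def] by (rule linearI) (simp_all add: inner_add_right algebra_simps)

lemma theta_e_eq: "theta_e u P \<rho> h = (\<lambda>x v. - \<beta> x (v 0))"
  by (simp add: theta_e_def dt_eq dot_dx_eq \<beta>_def \<psi>_def)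

lemma curl_eq: "curl u x = vector [partial_x 2 u x $ 3 - partial_x 3 u x $ 2,
    partial_x 3 u x $ 1 - partial_x 1 u x $ 3, partial_x 1 u x $ 2 - partial_x 2 u x $ 1]"
  by (simp add: curl_def partial_vec_nth[OF u])

lemma momentum: "partial_t u x = - (u x $ 1 *\<^sub>R partial_x 1 u x + u x $ 2 *\<^sub>R partial_x 2 u x
    + u x $ 3 *\<^sub>R partial_x 3 u x) - grad Q x"
proof -
  have "partial_t u x + convect u u x = - grad Q x"
    using euler unfolding euler_incompressible_def Q_def by blast
  then have "partial_t u x = - convect u u x - grad Q x" by (simp add: algebra_simps eq_neg_iff_add_eq_0)
  then show ?thesis by (simp add: convect_def sum_3)
qed

lemma \<Omega>_exact: "\<Omega> x a b = \<D> (\<lambda>y. \<beta> y b) x a - \<D> (\<lambda>y. \<beta> y a) x b"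
proof -
  note du = smooth_on_has_derivative[OF u UNIV_I] and dh = smooth_on_has_derivative[OF h UNIV_I]
    and dQ = smooth_on_has_derivative[OF Q UNIV_I]
  have "((\<lambda>y. \<beta> y b) has_derivative (\<lambda>a. - (\<D> h x a + \<D> Q x a
      + u x \<bullet> \<D> u x a) * fst b + \<D> u x a \<bullet> snd b)) (at x)" for b
    unfolding \<beta>_def \<psi>_eq
    by (rule has_derivative_eq_rhs[OF has_derivative_add[OF has_derivative_mult_left[OF has_derivative_minus[OF
        has_derivative_add[OF has_derivative_add[OF dh dQ] has_derivative_mult_right[OF has_derivative_inner[OF du du]]]]]
        has_derivative_inner_left[OF du]]])
      (simp add: inner_commute algebra_simps)
  from frechet_derivative_eqI[OF this]
  have "\<D> (\<lambda>y. \<beta> y b) x a = - (\<D> h x a + \<D> Q x a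
      + u x \<bullet> \<D> u x a) * fst b + \<D> u x a \<bullet> snd b" for a b .
  then have "\<D> (\<lambda>y. \<beta> y b) x a =
     (- (fst a * (partial_t h x + partial_t Q x) + grad h x \<bullet> snd a + grad Q x \<bullet> snd a
        + u x \<bullet> (fst a *\<^sub>R partial_t u x + snd a $ 1 *\<^sub>R partial_x 1 u x
            + snd a $ 2 *\<^sub>R partial_x 2 u x + snd a $ 3 *\<^sub>R partial_x 3 u x)) * fst b
      + (fst a *\<^sub>R partial_t u x + snd a $ 1 *\<^sub>R partial_x 1 u x
            + snd a $ 2 *\<^sub>R partial_x 2 u x + snd a $ 3 *\<^sub>R partial_x 3 u x) \<bullet> snd b)" for a b
    by (simp only: frechet_derivative_spacetime_real[OF dh, of x a] frechet_derivative_spacetime_real[OF dQ, of x a]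
        frechet_derivative_spacetime[OF du, of x a]) (simp add: algebra_simps)
  then show ?thesis
    unfolding \<Omega>_def by (simp only:) (rule euler_2form_algebra[OF momentum curl_eq])
qed

lemma \<Omega>_closed: "closed_2form \<Omega>"
  using exact_closed_2form[OF \<beta>_linear \<beta>_smooth] by (simp flip: \<Omega>_exact)

lemma \<Omega>'_eq: "\<Omega>' x a b = \<Omega> x a b
    + (\<D> h x a * fst b - \<D> h x b * fst a)"
  unfolding frechet_derivative_spacetime_real[OF smooth_on_has_derivative[OF h UNIV_I]] \<Omega>_def \<Omega>'_def euler_2form_def
  by (simp add: inner_add_left algebra_simps)

text \<open>Adding \<open>h dt\<close> to the primitive \<open>\<beta>\<close> cancels the
  \<open>h\<close> contained in \<open>\<psi>\<close>, and the form is again exact.\<close>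

lemma \<Omega>'_closed: "closed_2form \<Omega>'"
proof -
  have lin: "linear (\<lambda>b. \<beta> y b + h y * fst b)" for y
    by (intro linear_compose_add \<beta>_linear) (rule linearI, simp_all add: algebra_simps)
  have sm: "smooth_on UNIV (\<lambda>y. \<beta> y b + h y * fst b)" for b
    by (intro smooth_on_add smooth_on_mult smooth_on_const \<beta>_smooth h open_UNIV)
  have "\<D> (\<lambda>y. \<beta> y b + h y * fst b) x a
      = \<D> (\<lambda>y. \<beta> y b) x a + \<D> h x a * fst b" for x a b
    by (intro frechet_derivative_eqI has_derivative_add has_derivative_mult_left
        smooth_on_has_derivative[OF \<beta>_smooth UNIV_I] smooth_on_has_derivative[OF h UNIV_I])
  then have "\<Omega>' = (\<lambda>x a b. \<D> (\<lambda>y. \<beta> y b + h y * fst b) x a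
      - \<D> (\<lambda>y. \<beta> y a + h y * fst a) x b)"
    by (intro ext) (simp add: \<Omega>'_eq \<Omega>_exact)
  then show ?thesis using exact_closed_2form[OF lin sm] by simp
qed

lemma \<Omega>'_kernel: "\<Omega>' x (1, u x) b = 0" "\<Omega>' x (0, curl u x) b = 0"
  unfolding \<Omega>'_def euler_2form_def by (simp_all add: inner_3 cross3_components algebra_simps)

lemma \<Omega>_nondegenerate: "(\<And>b. \<Omega> x a b = 0) \<Longrightarrow> a = 0"
  unfolding \<Omega>_def
proof (rule euler_2form_nondegenerate)
  have "(grad h x + cross3 (u x) (curl u x)) \<bullet> curl u x = curl u x \<bullet> grad h x"
    by (simp add: inner_3 cross3_components algebra_simps)
  then show "(grad h x + cross3 (u x) (curl u x)) \<bullet> curl u x \<noteq> 0" using transversal by simp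
qed

lemma Omega_e_eq': "Omega_e u h = (\<lambda>x v. \<Omega> x (v 0) (v 1))"
  by (simp add: Omega_e_eq \<Omega>_def)

lemma symplectic: "symplectic_form (Omega_e u h)"
  unfolding symplectic_form_def
proof (intro conjI)
  show "is_form 2 (Omega_e u h)" "ext_d 2 (Omega_e u h) = (\<lambda>x v. 0)"
    unfolding Omega_e_eq' by (rule closed_2form_is_form[OF \<Omega>_closed])+
  show "nondegenerate (Omega_e u h)"
    unfolding nondegenerate_def Omega_e_eq'
  proof (intro allI impI)
    fix x a assume "\<forall>v. \<Omega> x (case_nat a v 0) (case_nat a v 1) = 0"
    then have "\<Omega> x a b = 0" for b by (auto dest: spec[of _ "\<lambda>_. b"])
    then show "a = 0" by (rule \<Omega>_nondegenerate)
  qed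
qed

lemma hamiltonian: "hamiltonian_vf (Omega_e u h) (suspension u) h"
  unfolding hamiltonian_vf_def contract_def Omega_e_eq' ext_d_form0
proof (intro ext)
  fix x and v :: "nat \<Rightarrow> spacetime"
  \<comment> \<open>Advection of \<open>h\<close> is what matches the \<open>dt\<close> components
    of the two sides.\<close>
  have "partial_t h x = - (u x \<bullet> grad h x)"
    using advect[of x] by (simp add: convect_def sum_3 grad_def inner_3)
  then have "\<D> h x (v 0) = fst (v 0) * (- (u x \<bullet> grad h x)) + grad h x \<bullet> snd (v 0)"
    by (simp add: frechet_derivative_spacetime_real[OF smooth_on_has_derivative[OF h UNIV_I]])
  then show "\<Omega> x (case_nat (suspension u x) v 0) (case_nat (suspension u x) v 1) = \<D> h x (v 0)"
    unfolding \<Omega>_def euler_2form_def suspension_def by (simp add: inner_3 cross3_components algebra_simps)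
qed

lemma liouville: "(\<lambda>x v. 1/2 * wedge 2 2 (Omega_e u h) (Omega_e u h) x v)
    = (\<lambda>x v. potential_vorticity u h x * volume_form x v)"
proof (intro ext)
  fix x v
  have "(grad h x + cross3 (u x) (curl u x)) \<bullet> curl u x = curl u x \<bullet> grad h x"
    by (simp add: inner_3 cross3_components algebra_simps)
  then show "1/2 * wedge 2 2 (Omega_e u h) (Omega_e u h) x v = potential_vorticity u h x * volume_form x v"
    unfolding Omega_e_eq euler_2form_square potential_vorticity_def by simp
qed

lemma exact: "is_form 1 (theta_e u P \<rho> h)" "Omega_e u h = (\<lambda>x v. - ext_d 1 (theta_e u P \<rho> h) x v)"
proof -
  have lin: "linear (\<lambda>b. - \<beta> x b)" for x by (intro linear_compose_neg \<beta>_linear)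
  have sm: "smooth_on UNIV (\<lambda>x. - \<beta> x b)" for b by (intro smooth_on_minus \<beta>_smooth open_UNIV)
  show "is_form 1 (theta_e u P \<rho> h)" unfolding theta_e_eq by (rule is_form_1[OF lin sm])
  have "\<D> (\<lambda>y. - \<beta> y b) x a = - \<D> (\<lambda>y. \<beta> y b) x a" for x a b
    by (rule frechet_derivative_eqI[OF has_derivative_minus[OF smooth_on_has_derivative[OF \<beta>_smooth UNIV_I]]])
  then show "Omega_e u h = (\<lambda>x v. - ext_d 1 (theta_e u P \<rho> h) x v)"
    unfolding theta_e_eq Omega_e_eq' ext_d_1[of "\<lambda>x b. - \<beta> x b"] by (simp add: \<Omega>_exact)
qed

end

section \<open>Local normal form of a closed two-form with two kernel fields\<close>

lemma has_derivative_inv_into: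
  fixes f :: "'a::euclidean_space \<Rightarrow> 'b::euclidean_space"
  assumes c: "coordinates_on U f" and x: "x \<in> f ` U"
  shows "\<D> f (inv_into U f x) (\<D> (inv_into U f) x v) = v"
proof -
  have U: "open (f ` U)" "smooth_on U f" "smooth_on (f ` U) (inv_into U f)"
    using c by (simp_all add: coordinates_on_def)
  have "((\<lambda>x. f (inv_into U f x)) has_derivative
      (\<lambda>v. \<D> f (inv_into U f x) (\<D> (inv_into U f) x v))) (at x)"
    by (rule has_derivative_compose[OF smooth_on_has_derivative[OF U(3) x]
          smooth_on_has_derivative[OF U(2) inv_into_into[OF x]]])
  then have d: "((\<lambda>x. x) has_derivative
      (\<lambda>v. \<D> f (inv_into U f x) (\<D> (inv_into U f) x v))) (at x)"
    by (rule has_derivative_transform_within_open[OF _ U(1) x]) (rule f_inv_into_f)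
  show ?thesis using has_derivative_unique[OF d has_derivative_ident] by (rule fun_cong)
qed

text \<open>The image of \<open>L\<close> is a plane complementary to the two kernel directions at
  \<open>x0\<close>; with \<open>dim\<close> this makes the composed flow map a local
  diffeomorphism. Pulled back, the form lives on the parameter plane and has a single
  coefficient.\<close>

lemma local_normal_form:
  fixes \<omega> :: "'g::euclidean_space \<Rightarrow> 'g \<Rightarrow> 'g \<Rightarrow> real" and L :: "real \<times> real \<Rightarrow> 'g"
  assumes cl: "closed_2form \<omega>"
    and X: "smooth_on UNIV X" "\<And>x b. \<omega> x (X x) b = 0"
    and W: "smooth_on UNIV W" "\<And>x b. \<omega> x (W x) b = 0"
    and L: "linear L" and dim: "DIM('g) = 4"
    and inj: "\<And>s r y. s *\<^sub>R X x0 + r *\<^sub>R W x0 + L y = 0 \<Longrightarrow> s = 0 \<and> r = 0 \<and> y = 0"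
  obtains V q p where "open V" "x0 \<in> V" "smooth_on V q" "smooth_on V p"
    "\<And>x a b. x \<in> V \<Longrightarrow> \<omega> x a b =
      \<D> p x a * \<D> q x b
      - \<D> p x b * \<D> q x a"
proof -
  obtain S1 \<Phi>1 where S1: "open S1" "(0, x0) \<in> S1" and \<Phi>1: "smooth_on S1 \<Phi>1"
    and \<Phi>1_0: "\<And>x. (0, x) \<in> S1 \<Longrightarrow> \<Phi>1 (0, x) = x"
    and d1: "\<And>v. \<D> \<Phi>1 (0, x0) v = snd v + fst v *\<^sub>R X x0"
    and pull1: "\<And>\<omega> l v w. closed_2form \<omega> \<Longrightarrow> (\<And>x b. \<omega> x (X x) b = 0) \<Longrightarrow> l \<in> S1 \<Longrightarrow>
      \<omega> (\<Phi>1 l) (\<D> \<Phi>1 l v) (\<D> \<Phi>1 l w) = \<omega> (snd l) (snd v) (snd w)"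
    using flow_box[OF X(1), of x0] by blast
  obtain S2 \<Phi>2 where S2: "open S2" "(0, x0) \<in> S2" and \<Phi>2: "smooth_on S2 \<Phi>2"
    and \<Phi>2_0: "\<And>x. (0, x) \<in> S2 \<Longrightarrow> \<Phi>2 (0, x) = x"
    and d2: "\<And>v. \<D> \<Phi>2 (0, x0) v = snd v + fst v *\<^sub>R W x0"
    and pull2: "\<And>\<omega> l v w. closed_2form \<omega> \<Longrightarrow> (\<And>x b. \<omega> x (W x) b = 0) \<Longrightarrow> l \<in> S2 \<Longrightarrow>
      \<omega> (\<Phi>2 l) (\<D> \<Phi>2 l v) (\<D> \<Phi>2 l w) = \<omega> (snd l) (snd v) (snd w)"
    using flow_box[OF W(1), of x0] by blast
  have bL: "bounded_linear L" using L by (simp add: linear_conv_bounded_linear)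
  \<comment> \<open>With \<open>z = (s, r, y)\<close>, \<open>M2\<close> puts \<open>y\<close> on
    the plane through \<open>x0\<close> and \<open>M1\<close> moves it by the \<open>W\<close>-flow
    for time \<open>r\<close>; \<open>\<Phi>\<close> finally applies the \<open>X\<close>-flow for
    time \<open>s\<close>. \<open>T2\<close> and \<open>T\<close> are the domains on which the two
    flow boxes can be applied.\<close>
  define M2 :: "real \<times> real \<times> (real \<times> real) \<Rightarrow> real \<times> 'g" where "M2 z = (fst (snd z), x0 + L (snd (snd z)))" for z
  define M1 :: "real \<times> real \<times> (real \<times> real) \<Rightarrow> real \<times> 'g" where "M1 z = (fst z, \<Phi>2 (M2 z))" for z
  have M2s: "smooth_on S M2" if "open S" for S
    unfolding M2_def
    by (intro smooth_on_Pair smooth_on_fst smooth_on_snd smooth_on_ident smooth_on_add smooth_on_const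
        smooth_on_bounded_linear[OF _ bL] that)
  define T2 where "T2 = M2 -` S2"
  have T2: "open T2"
    unfolding T2_def using M2s[OF open_UNIV] S2(1) smooth_on_continuous open_vimage by blast
  have M1s: "smooth_on T2 M1"
    unfolding M1_def
    by (intro smooth_on_Pair smooth_on_fst smooth_on_ident T2 smooth_on_compose[OF T2 S2(1) \<Phi>2 M2s[OF T2]])
      (simp add: T2_def)
  define T where "T = T2 \<inter> M1 -` S1"
  have T: "open T"
    unfolding T_def using smooth_on_continuous[OF M1s] T2 S1(1) by (rule continuous_open_preimage)
  define \<Phi> where "\<Phi> z = \<Phi>1 (M1 z)" for z
  have \<Phi>s: "smooth_on T \<Phi>"
    unfolding \<Phi>_def
    by (rule smooth_on_compose[OF T S1(1) \<Phi>1 smooth_on_subset[OF M1s]]) (auto simp: T_def)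
  have dM2: "(M2 has_derivative (\<lambda>v. (fst (snd v), L (snd (snd v))))) (at z)" for z
  proof -
    have "((\<lambda>z. x0 + L (snd (snd z))) has_derivative (\<lambda>v. 0 + L (snd (snd v)))) (at z)"
      by (intro has_derivative_add has_derivative_const bounded_linear_imp_has_derivative
          bounded_linear_compose[OF bL bounded_linear_compose[OF bounded_linear_snd bounded_linear_snd]])
    moreover have "((\<lambda>z. fst (snd z)) has_derivative (\<lambda>v. fst (snd v))) (at z)"
      by (intro bounded_linear_imp_has_derivative bounded_linear_compose[OF bounded_linear_fst bounded_linear_snd])
    ultimately show ?thesis unfolding M2_def[abs_def] using has_derivative_Pair by fastforce
  qed
  have d\<Phi>: "\<D> \<Phi> z v = \<D> \<Phi>1 (M1 z)
      (fst v, \<D> \<Phi>2 (M2 z) (fst (snd v), L (snd (snd v))))" if z: "z \<in> T" for z v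
  proof -
    have zS: "M2 z \<in> S2" "M1 z \<in> S1" using z by (auto simp: T_def T2_def)
    have f: "(fst has_derivative fst) (at z)" by (rule bounded_linear_imp_has_derivative[OF bounded_linear_fst])
    have "((\<lambda>z. \<Phi>2 (M2 z)) has_derivative (\<lambda>v. \<D> \<Phi>2 (M2 z) (fst (snd v), L (snd (snd v))))) (at z)"
      by (rule has_derivative_compose[OF dM2 smooth_on_has_derivative[OF \<Phi>2 zS(1)]])
    from has_derivative_Pair[OF f this]
    have "(M1 has_derivative (\<lambda>v. (fst v, \<D> \<Phi>2 (M2 z) (fst (snd v), L (snd (snd v)))))) (at z)"
      unfolding M1_def[abs_def] .
    from has_derivative_compose[OF this smooth_on_has_derivative[OF \<Phi>1 zS(2)]]
    have "(\<Phi> has_derivative (\<lambda>v. \<D> \<Phi>1 (M1 z)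
      (fst v, \<D> \<Phi>2 (M2 z) (fst (snd v), L (snd (snd v)))))) (at z)"
      unfolding \<Phi>_def[abs_def] .
    from fun_cong[OF frechet_derivative_at[OF this], of v, symmetric] show ?thesis .
  qed
  \<comment> \<open>Each flow box discards its own time component, from the base point as well as
    from the vectors, so only \<open>y\<close> survives.\<close>
  have pull: "\<omega> (\<Phi> z) (\<D> \<Phi> z v) (\<D> \<Phi> z w)
      = \<omega> (x0 + L (snd (snd z))) (L (snd (snd v))) (L (snd (snd w)))" if z: "z \<in> T" for z v w
  proof -
    have zS: "M2 z \<in> S2" "M1 z \<in> S1" using z by (auto simp: T_def T2_def)
    show ?thesis
      unfolding d\<Phi>[OF z] \<Phi>_def pull1[where \<omega> = \<omega>, OF cl X(2) zS(2)]
      unfolding M1_def snd_conv pull2[where \<omega> = \<omega>, OF cl W(2) zS(1)]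
      unfolding M2_def snd_conv ..
  qed
  have L0: "L 0 = 0" using L by (rule linear_0)
  have M20: "M2 0 = (0, x0)" by (simp add: M2_def L0)
  have M10: "M1 0 = (0, x0)" using S2(2) by (simp add: M1_def M20 \<Phi>2_0)
  have \<Phi>0: "\<Phi> 0 = x0" using S1(2) by (simp add: \<Phi>_def M10 \<Phi>1_0)
  have T0: "0 \<in> T" using S1(2) S2(2) by (simp add: T_def T2_def M10 M20)
  have dims: "DIM(real \<times> real \<times> (real \<times> real)) = DIM('g)" using dim by simp
  have injd: "v = 0" if "\<D> \<Phi> 0 v = 0" for v
  proof -
    have "fst v *\<^sub>R X x0 + fst (snd v) *\<^sub>R W x0 + L (snd (snd v)) = 0"
      using that unfolding d\<Phi>[OF T0] M10 M20 d1 d2 by (simp add: algebra_simps)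
    from inj[OF this] show ?thesis by (simp add: prod_eq_iff)
  qed
  obtain U where U: "0 \<in> U" "U \<subseteq> T" "coordinates_on U \<Phi>"
    using inverse_function_coordinates[OF T T0 \<Phi>s dims injd] by blast
  note co = U(3)[unfolded coordinates_on_def]
  define V where "V = \<Phi> ` U"
  define \<Upsilon> where "\<Upsilon> = inv_into U \<Phi>"
  have V: "open V" "x0 \<in> V" using co U(1) \<Phi>0 by (auto simp: V_def)
  have \<Upsilon>s: "smooth_on V \<Upsilon>" using co by (simp add: V_def \<Upsilon>_def)
  define Y where "Y x = snd (snd (\<Upsilon> x))" for x
  have Ys: "smooth_on V Y" unfolding Y_def by (intro smooth_on_snd V \<Upsilon>s)
  \<comment> \<open>The coefficient of the pulled-back form with respect to the area form of the
    parameter plane.\<close>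
  define g where "g y = \<omega> (x0 + L y) (L (1, 0)) (L (0, 1))" for y
  have gs: "smooth_on UNIV g"
    unfolding g_def
    by (intro smooth_on_compose[OF _ _ closed_2form_smooth[OF cl]] smooth_on_add smooth_on_const
        smooth_on_bounded_linear[OF _ bL] smooth_on_ident open_UNIV UNIV_I)
  obtain p0 where p0: "smooth_on UNIV p0" "\<And>y. \<D> p0 y (1, 0) = g y"
    using antiderivative_fst[OF gs] by blast
  have norm2: "\<omega> x a b = (fst (\<D> Y x a) * snd (\<D> Y x b)
      - fst (\<D> Y x b) * snd (\<D> Y x a)) * g (Y x)" if x: "x \<in> V" for x a b
  proof -
    note lin = closed_2form_linear[OF cl] and anti = closed_2form_antisym[OF cl]
    have zT: "\<Upsilon> x \<in> T" "\<Phi> (\<Upsilon> x) = x"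
      unfolding \<Upsilon>_def using subsetD[OF U(2) inv_into_into[OF x[unfolded V_def]]] f_inv_into_f[OF x[unfolded V_def]] .
    have dY: "\<D> Y x c = snd (snd (\<D> \<Upsilon> x c))" for c
    proof -
      have "(Y has_derivative (\<lambda>c. snd (snd (\<D> \<Upsilon> x c)))) (at x)"
        unfolding Y_def[abs_def] by (intro has_derivative_snd smooth_on_has_derivative[OF \<Upsilon>s x])
      from fun_cong[OF frechet_derivative_at[OF this], of c, symmetric] show ?thesis .
    qed
    have "\<D> \<Phi> (\<Upsilon> x) (\<D> \<Upsilon> x c) = c" for c
      using has_derivative_inv_into[OF U(3) x[unfolded V_def]] by (simp add: \<Upsilon>_def)
    then have m1: "\<omega> x a b = \<omega> (x0 + L (Y x)) (L (\<D> Y x a)) (L (\<D> Y x b))"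
      using pull[OF zT(1), of "\<D> \<Upsilon> x a" "\<D> \<Upsilon> x b"]
      by (simp add: zT dY Y_def)
    have m2: "\<omega> c (L v) (L w) = (fst v * snd w - fst w * snd v) * \<omega> c (L (1, 0)) (L (0, 1))" for c v w
    proof -
      have e: "L v = fst v *\<^sub>R L (1, 0) + snd v *\<^sub>R L (0, 1)" for v
      proof -
        have "v = fst v *\<^sub>R (1, 0) + snd v *\<^sub>R (0, 1)" by (simp add: prod_eq_iff)
        then have "L v = L (fst v *\<^sub>R (1, 0) + snd v *\<^sub>R (0, 1))" by simp
        then show ?thesis by (simp only: linear_add[OF L] linear_cmul[OF L])
      qed
      have r: "\<omega> c d (L w) = fst w * \<omega> c d (L (1, 0)) + snd w * \<omega> c d (L (0, 1))" for d w
        unfolding e[of w] by (simp add: linear_add[OF lin] linear_cmul[OF lin])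
      have z: "\<omega> c d d = 0" for d using anti[of c d d] by simp
      have a1: "\<omega> c (L v) (L (1, 0)) = - (snd v * \<omega> c (L (1, 0)) (L (0, 1)))"
        using anti[of c "L v" "L (1, 0)"] r[of "L (1, 0)" v] unfolding z mult_zero_right by linarith
      have a2: "\<omega> c (L v) (L (0, 1)) = fst v * \<omega> c (L (1, 0)) (L (0, 1))"
        using anti[of c "L v" "L (0, 1)"] r[of "L (0, 1)" v] anti[of c "L (0, 1)" "L (1, 0)"]
        unfolding z mult_zero_right by simp
      show ?thesis
        using r[of "L v" w] unfolding a1 a2 by algebra
    qed
    show ?thesis unfolding g_def by (rule trans[OF m1 m2])
  qed
  show ?thesis
  proof (rule that[OF V, of "\<lambda>x. snd (Y x)" "\<lambda>x. p0 (Y x)"])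
    show "smooth_on V (\<lambda>x. snd (Y x))" by (intro smooth_on_snd V Ys)
    show "smooth_on V (\<lambda>x. p0 (Y x))" by (rule smooth_on_compose[OF V(1) open_UNIV p0(1) Ys UNIV_I])
    fix x a b assume x: "x \<in> V"
    note dY = smooth_on_has_derivative[OF Ys x]
    have dq: "\<D> (\<lambda>x. snd (Y x)) x c = snd (\<D> Y x c)" for c
      by (rule fun_cong[OF frechet_derivative_at[OF has_derivative_snd[OF dY]], symmetric])
    have dp: "\<D> (\<lambda>x. p0 (Y x)) x c = fst (\<D> Y x c) * g (Y x)
        + snd (\<D> Y x c) * \<D> p0 (Y x) (0, 1)" for c
    proof -
      note d0 = smooth_on_has_derivative[OF p0(1) UNIV_I]
      have l: "linear (\<D> p0 y)" for y by (rule has_derivative_linear[OF d0])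
      have "\<D> (\<lambda>x. p0 (Y x)) x c = \<D> p0 (Y x) (\<D> Y x c)"
        by (rule fun_cong[OF frechet_derivative_at[OF has_derivative_compose[OF dY d0]], symmetric])
      also have "\<D> Y x c
          = fst (\<D> Y x c) *\<^sub>R (1, 0) + snd (\<D> Y x c) *\<^sub>R (0, 1)"
        by (simp add: prod_eq_iff)
      also have "\<D> p0 (Y x) \<dots> = fst (\<D> Y x c) * g (Y x)
        + snd (\<D> Y x c) * \<D> p0 (Y x) (0, 1)"
        by (simp only: linear_add[OF l] linear_cmul[OF l] p0(2) real_scaleR_def)
      finally show ?thesis .
    qed
    show "\<omega> x a b = \<D> (\<lambda>x. p0 (Y x)) x a * \<D> (\<lambda>x. snd (Y x)) x b
      - \<D> (\<lambda>x. p0 (Y x)) x b * \<D> (\<lambda>x. snd (Y x)) x a"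
      unfolding norm2[OF x] dp dq by (simp add: algebra_simps)
  qed
qed

section \<open>Continuity equation, Darboux coordinates and Clebsch representation\<close>

lemma frechet_derivative_add:
  "smooth_on UNIV f \<Longrightarrow> smooth_on UNIV g \<Longrightarrow>
    \<D> (\<lambda>x. f x + g x) x v = \<D> f x v + \<D> g x v"
  by (intro frechet_derivative_eqI has_derivative_add smooth_on_has_derivative[OF _ UNIV_I])

lemma frechet_derivative_diff:
  "smooth_on UNIV f \<Longrightarrow> smooth_on UNIV g \<Longrightarrow>
    \<D> (\<lambda>x. f x - g x) x v = \<D> f x v - \<D> g x v"
  by (intro frechet_derivative_eqI has_derivative_diff smooth_on_has_derivative[OF _ UNIV_I])

lemma frechet_derivative_uminus:
  "smooth_on UNIV f \<Longrightarrow> \<D> (\<lambda>x. - f x) x v = - \<D> f x v"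
  by (intro frechet_derivative_eqI has_derivative_minus smooth_on_has_derivative[OF _ UNIV_I])

lemma frechet_derivative_mult:
  fixes f g :: "'a::real_normed_vector \<Rightarrow> real"
  shows "smooth_on UNIV f \<Longrightarrow> smooth_on UNIV g \<Longrightarrow>
    \<D> (\<lambda>x. f x * g x) x v = f x * \<D> g x v + \<D> f x v * g x"
  by (intro frechet_derivative_eqI has_derivative_mult smooth_on_has_derivative[OF _ UNIV_I])

context euler_flow
begin

text \<open>Ertel's theorem, verified in coordinates: the differentiated momentum and advection
  equations replace all second derivatives involving time. The pressure terms then cancel by
  symmetry and the remaining ones by incompressibility.\<close>

lemma continuity:
  "partial_t (potential_vorticity u h) x + divergence (\<lambda>y. potential_vorticity u h y *\<^sub>R u y) x = 0"
proof -
  define D where "D v f = (\<lambda>x. \<D> f x v)" for v and f :: "spacetime \<Rightarrow> real"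
  define E0 :: spacetime where "E0 = (1, 0)"
  define E1 :: spacetime where "E1 = (0, axis 1 1)"
  define E2 :: spacetime where "E2 = (0, axis 2 1)"
  define E3 :: spacetime where "E3 = (0, axis 3 1)"
  define U1 where "U1 = (\<lambda>y. u y $ 1)"
  define U2 where "U2 = (\<lambda>y. u y $ 2)"
  define U3 where "U3 = (\<lambda>y. u y $ 3)"
  have sU: "smooth_on UNIV U1" "smooth_on UNIV U2" "smooth_on UNIV U3"
    unfolding U1_def U2_def U3_def by (intro smooth_on_vec_nth u open_UNIV)+
  have sD: "smooth_on UNIV (D v f)" if "smooth_on UNIV f" for v f
    unfolding D_def by (rule smooth_on_frechet_derivative[OF that])
  note op = open_UNIV[where ?'a = spacetime]
  note smooth = sU h Q sD smooth_on_add[OF op] smooth_on_diff[OF op] smooth_on_minus[OF op] smooth_on_mult[OF op]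
  have D_rules: "D v (\<lambda>x. f x + g x) x = D v f x + D v g x"
    "D v (\<lambda>x. f x - g x) x = D v f x - D v g x"
    "D v (\<lambda>x. f x * g x) x = f x * D v g x + D v f x * g x"
    if "smooth_on UNIV f" "smooth_on UNIV g" for v f g x
    using that by (simp_all add: D_def frechet_derivative_add frechet_derivative_diff frechet_derivative_mult)
  have D_minus: "D v (\<lambda>x. - f x) x = - D v f x" if "smooth_on UNIV f" for v f x
    using that by (simp add: D_def frechet_derivative_uminus)
  have comm: "D v (D w f) x = D w (D v f) x" if "smooth_on UNIV f" for v w f x
    unfolding D_def by (rule frechet_derivative_commute[OF open_UNIV UNIV_I that])
  have D0: "D v (\<lambda>x. 0) x = 0" for v x
    unfolding D_def by (rule frechet_derivative_eqI[OF has_derivative_const])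
  have px: "partial_x 1 f = D E1 f" "partial_x 2 f = D E2 f" "partial_x 3 f = D E3 f" "partial_t f = D E0 f" for f
    by (auto simp: partial_x_def[abs_def] partial_t_def[abs_def] D_def E0_def E1_def E2_def E3_def)
  have c: "partial_t u x $ i = D E0 (\<lambda>y. u y $ i) x" "partial_x 1 u x $ i = D E1 (\<lambda>y. u y $ i) x"
    "partial_x 2 u x $ i = D E2 (\<lambda>y. u y $ i) x" "partial_x 3 u x $ i = D E3 (\<lambda>y. u y $ i) x" for i x
    by (simp_all only: px[symmetric] partial_vec_nth[OF u])
  have g: "grad f x $ 1 = D E1 f x" "grad f x $ 2 = D E2 f x" "grad f x $ 3 = D E3 f x" for f x
    by (simp_all add: grad_def px)
  have mom: "D E0 (\<lambda>y. u y $ i) x + (u x $ 1 * D E1 (\<lambda>y. u y $ i) x + u x $ 2 * D E2 (\<lambda>y. u y $ i) x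
      + u x $ 3 * D E3 (\<lambda>y. u y $ i) x) + grad Q x $ i = 0" for i x
    using arg_cong[OF momentum[of x], of "\<lambda>v. v $ i"] by (simp add: c)
  have mom1: "(\<lambda>x. D E0 U1 x + (U1 x * D E1 U1 x + U2 x * D E2 U1 x + U3 x * D E3 U1 x) + D E1 Q x) = (\<lambda>x. 0)"
    using mom[of 1] by (simp add: U1_def U2_def U3_def g)
  have mom2: "(\<lambda>x. D E0 U2 x + (U1 x * D E1 U2 x + U2 x * D E2 U2 x + U3 x * D E3 U2 x) + D E2 Q x) = (\<lambda>x. 0)"
    using mom[of 2] by (simp add: U1_def U2_def U3_def g)
  have mom3: "(\<lambda>x. D E0 U3 x + (U1 x * D E1 U3 x + U2 x * D E2 U3 x + U3 x * D E3 U3 x) + D E3 Q x) = (\<lambda>x. 0)"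
    using mom[of 3] by (simp add: U1_def U2_def U3_def g)
  have adv: "(\<lambda>x. D E0 h x + (U1 x * D E1 h x + U2 x * D E2 h x + U3 x * D E3 h x)) = (\<lambda>x. 0)"
    using advect by (simp add: convect_def sum_3 px U1_def U2_def U3_def)
  \<comment> \<open>The equations hold identically, so their left-hand sides may be differentiated
    in any direction; \<open>m1\<close>, \<open>m2\<close>, \<open>m3\<close> and \<open>ma\<close>
    are solved for the time derivative.\<close>
  have dif: "D v f x = 0" if "f = (\<lambda>x. 0)" for v f using D0 that by simp
  have m1: "D v (D E0 U1) x = - (U1 x * D v (D E1 U1) x + D v U1 x * D E1 U1 x + (U2 x * D v (D E2 U1) x + D v U2 x * D E2 U1 x)
     + (U3 x * D v (D E3 U1) x + D v U3 x * D E3 U1 x)) - D v (D E1 Q) x" for v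
    using dif[OF mom1, of v] by (simp add: D_rules smooth)
  have m2: "D v (D E0 U2) x = - (U1 x * D v (D E1 U2) x + D v U1 x * D E1 U2 x + (U2 x * D v (D E2 U2) x + D v U2 x * D E2 U2 x)
     + (U3 x * D v (D E3 U2) x + D v U3 x * D E3 U2 x)) - D v (D E2 Q) x" for v
    using dif[OF mom2, of v] by (simp add: D_rules smooth)
  have m3: "D v (D E0 U3) x = - (U1 x * D v (D E1 U3) x + D v U1 x * D E1 U3 x + (U2 x * D v (D E2 U3) x + D v U2 x * D E2 U3 x)
     + (U3 x * D v (D E3 U3) x + D v U3 x * D E3 U3 x)) - D v (D E3 Q) x" for v
    using dif[OF mom3, of v] by (simp add: D_rules smooth)
  have ma: "D v (D E0 h) x = - (U1 x * D v (D E1 h) x + D v U1 x * D E1 h x + (U2 x * D v (D E2 h) x + D v U2 x * D E2 h x)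
     + (U3 x * D v (D E3 h) x + D v U3 x * D E3 h x))" for v
    using dif[OF adv, of v] by (simp add: D_rules smooth)
  have div: "D E3 U3 x = - (D E1 U1 x + D E2 U2 x)"
  proof -
    have "divergence u x = 0" using euler unfolding euler_incompressible_def by blast
    then show ?thesis by (simp add: divergence_def sum_3 px U1_def U2_def U3_def)
  qed
  have pv: "potential_vorticity u h = (\<lambda>x. - ((D E2 U3 x - D E3 U2 x) * D E1 h x + (D E3 U1 x - D E1 U3 x) * D E2 h x
     + (D E1 U2 x - D E2 U1 x) * D E3 h x))"
    unfolding potential_vorticity_def[abs_def] inner_3 g curl_def vector_3 px U1_def U2_def U3_def ..
  \<comment> \<open>Mixed derivatives are oriented one way only, time innermost and spatial
    directions ordered, so that rewriting ends in a normal form and meets the left-hand sides of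
    \<open>m1\<close> to \<open>ma\<close>.\<close>
  have t: "D E0 (D E1 f) x = D E1 (D E0 f) x" "D E0 (D E2 f) x = D E2 (D E0 f) x" "D E0 (D E3 f) x = D E3 (D E0 f) x"
    "D E2 (D E1 f) x = D E1 (D E2 f) x" "D E3 (D E1 f) x = D E1 (D E3 f) x" "D E3 (D E2 f) x = D E2 (D E3 f) x"
    if "smooth_on UNIV f" for f x
    by (rule comm[OF that])+
  have "divergence (\<lambda>y. potential_vorticity u h y *\<^sub>R u y) x = D E1 (\<lambda>y. potential_vorticity u h y * U1 y) x
     + D E2 (\<lambda>y. potential_vorticity u h y * U2 y) x + D E3 (\<lambda>y. potential_vorticity u h y * U3 y) x"
    by (simp add: divergence_def sum_3 px U1_def U2_def U3_def)
  then show ?thesis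
    unfolding px pv
    by (simp add: D_rules D_minus smooth t m1 m2 m3 ma div) (simp add: algebra_simps)
qed

lemma darboux_exists:
  "\<exists>U q p hcan. x0 \<in> U \<and> darboux_coordinates (Omega_e u h) U q p hcan"
proof -
  define w where "w = curl u x0"
  have w0: "w \<noteq> 0" using transversal[of x0] by (auto simp: w_def)
  obtain a where a: "cross3 w a \<noteq> 0"
  proof (rule ccontr)
    assume "\<not> thesis"
    then have z: "cross3 w a = 0" for a using that by blast
    have "w $ 1 = 0 \<and> w $ 2 = 0 \<and> w $ 3 = 0"
      using arg_cong[OF z[of "axis 1 1"], of "\<lambda>v. v $ 2"] arg_cong[OF z[of "axis 1 1"], of "\<lambda>v. v $ 3"]
        arg_cong[OF z[of "axis 2 1"], of "\<lambda>v. v $ 3"]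
      by (simp add: cross3_components axis_def)
    then show False using w0 by (simp add: vec_eq_iff forall_3)
  qed
  define c where "c = cross3 w a"
  \<comment> \<open>The vectors \<open>w\<close>, \<open>a\<close> and \<open>c\<close> span
    3-space, and \<open>(1, u x0)\<close> supplies the time direction. Orthogonality of
    \<open>c\<close> to the other two lets the coefficients be read off one at a time.\<close>
  define L :: "real \<times> real \<Rightarrow> spacetime" where "L y = (0, fst y *\<^sub>R a + snd y *\<^sub>R c)" for y
  have L: "linear L" unfolding L_def by (rule linearI) (simp_all add: algebra_simps)
  have orth: "w \<bullet> c = 0" "a \<bullet> c = 0" by (simp_all add: c_def inner_3 cross3_components algebra_simps)
  have inj: "s = 0 \<and> r = 0 \<and> y = 0" if "s *\<^sub>R (1, u x0) + r *\<^sub>R (0, curl u x0) + L y = 0" for s r y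
  proof -
    have s: "s = 0" using arg_cong[OF that, of fst] by (simp add: L_def)
    have v: "r *\<^sub>R w + fst y *\<^sub>R a + snd y *\<^sub>R c = 0"
      using arg_cong[OF that, of snd] s by (simp add: L_def w_def add.assoc)
    have "(r *\<^sub>R w + fst y *\<^sub>R a + snd y *\<^sub>R c) \<bullet> c = snd y * (c \<bullet> c)"
      by (simp add: inner_add_left orth)
    then have y2: "snd y = 0" using v a by (simp add: c_def)
    have "cross3 w (r *\<^sub>R w + fst y *\<^sub>R a) = fst y *\<^sub>R c"
      by (simp add: c_def cross_add_right cross_mult_right)
    then have y1: "fst y = 0" using v y2 a by (simp add: c_def)
    have "r = 0" using v y1 y2 w0 by simp
    with s y1 y2 show ?thesis by (simp add: prod_eq_iff)
  qed
  have Xs: "smooth_on UNIV (\<lambda>x. (1, u x))" by (intro smooth_on_Pair smooth_on_const u open_UNIV)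
  have Ws: "smooth_on UNIV (\<lambda>x. (0, curl u x))" by (intro smooth_on_Pair smooth_on_const smooth_on_curl u open_UNIV)
  have dim: "DIM(spacetime) = 4" by simp
  obtain V q p where V: "open V" "x0 \<in> V" and q: "smooth_on V q" and p: "smooth_on V p"
    and nf: "\<And>x a b. x \<in> V \<Longrightarrow> \<Omega>' x a b =
      \<D> p x a * \<D> q x b
      - \<D> p x b * \<D> q x a"
    using local_normal_form[where X = "\<lambda>x. (1, u x)" and W = "\<lambda>x. (0, curl u x)",
        OF \<Omega>'_closed Xs \<Omega>'_kernel(1) Ws \<Omega>'_kernel(2) L dim inj] by blast
  note dh = smooth_on_has_derivative[OF h UNIV_I]
  have \<Omega>_eq: "\<Omega> x a b = \<D> p x a * \<D> q x b
      - \<D> p x b * \<D> q x a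
      - (\<D> h x a * fst b - \<D> h x b * fst a)" if "x \<in> V" for x a b
    using nf[OF that, of a b] \<Omega>'_eq[of x a b] by simp
  define hcan where "hcan x = - h x" for x
  define \<Psi> where "\<Psi> x = (q x, p x, fst x, hcan x)" for x
  have \<Psi>s: "smooth_on V \<Psi>"
    unfolding \<Psi>_def hcan_def
    by (intro smooth_on_Pair q p smooth_on_fst smooth_on_ident smooth_on_minus V smooth_on_subset[OF h subset_UNIV])
  \<comment> \<open>A vector killed by the differentials of all four coordinates annihilates
    \<open>\<Omega>\<close> in its Darboux expression, and nondegeneracy makes it zero.\<close>
  have injd: "v = 0" if "\<D> \<Psi> x0 v = 0" for v
  proof (rule \<Omega>_nondegenerate)
    have "(\<Psi> has_derivative (\<lambda>v. (\<D> q x0 v, \<D> p x0 v, fst v,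
        - \<D> h x0 v))) (at x0)"
      unfolding \<Psi>_def[abs_def] hcan_def
      by (intro has_derivative_Pair has_derivative_minus dh smooth_on_has_derivative[OF q V(2)]
          smooth_on_has_derivative[OF p V(2)] bounded_linear_imp_has_derivative bounded_linear_fst)
    from frechet_derivative_eqI[OF this, of v]
    have "\<D> q x0 v = 0" "\<D> p x0 v = 0" "fst v = 0" "\<D> h x0 v = 0"
      using that by (simp_all add: zero_prod_def)
    then show "\<Omega> x0 v b = 0" for b by (simp add: \<Omega>_eq[OF V(2)])
  qed
  have dims: "DIM(spacetime) = DIM(real \<times> real \<times> real \<times> real)" by simp
  obtain U where U: "x0 \<in> U" "U \<subseteq> V" "coordinates_on U \<Psi>"
    using inverse_function_coordinates[OF V \<Psi>s dims injd] by blast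
  have "darboux_coordinates (Omega_e u h) U q p hcan"
    unfolding darboux_coordinates_def
  proof (intro conjI ballI allI)
    show "coordinates_on U (\<lambda>x. (q x, p x, fst x, hcan x))" using U(3) by (simp add: \<Psi>_def[abs_def])
    fix x v assume "x \<in> U"
    then have x: "x \<in> V" using U(2) by blast
    have dhc: "\<D> hcan x a = - \<D> h x a" for a
      unfolding hcan_def[abs_def] by (rule frechet_derivative_uminus[OF h])
    show "Omega_e u h x v = wedge 1 1 (ext_d 0 (form0 p)) (ext_d 0 (form0 q)) x v
        + wedge 1 1 (ext_d 0 (form0 hcan)) dt x v"
      unfolding wedge_d_d wedge_d_dt Omega_e_eq' dhc \<Omega>_eq[OF x] by simp
  qed
  with U(1) show ?thesis by blast
qed

text \<open>Both \<open>theta_can\<close> and \<open>theta_e\<close> are primitives of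
  \<open>- Omega_e\<close> on \<open>U\<close>, so their difference \<open>\<theta>\<close> is
  closed and has a potential on a simply connected set.\<close>

lemma clebsch:
  assumes sc: "simply_connected U" and D: "darboux_coordinates (Omega_e u h) U q p hcan"
  shows "\<exists>s. generating_function U (theta_can q p hcan) (theta_e u P \<rho> h) s"
    and "generating_function U (theta_can q p hcan) (theta_e u P \<rho> h) s \<Longrightarrow> x \<in> U \<Longrightarrow>
      u x = grad s x + p x *\<^sub>R grad q x"
proof -
  have co: "coordinates_on U (\<lambda>x. (q x, p x, fst x, hcan x))"
    and dar: "\<And>x v. x \<in> U \<Longrightarrow> Omega_e u h x v = wedge 1 1 (ext_d 0 (form0 p)) (ext_d 0 (form0 q)) x v
        + wedge 1 1 (ext_d 0 (form0 hcan)) dt x v"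
    using D unfolding darboux_coordinates_def by blast+
  have U: "open U" and sm: "smooth_on U (\<lambda>x. (q x, p x, fst x, hcan x))"
    using co by (simp_all add: coordinates_on_def)
  have q: "smooth_on U q" using smooth_on_fst[OF U sm] by simp
  have p: "smooth_on U p" using smooth_on_fst[OF U smooth_on_snd[OF U sm]] by simp
  have hc: "smooth_on U hcan" using smooth_on_snd[OF U smooth_on_snd[OF U smooth_on_snd[OF U sm]]] by simp
  define \<theta> where "\<theta> x b = - (p x * \<D> q x b + hcan x * fst b) + \<beta> x b" for x b
  have diff_eq: "theta_can q p hcan x v - theta_e u P \<rho> h x v = \<theta> x (v 0)" for x v
    by (simp add: theta_can_def theta_e_eq \<theta>_def ext_d_form0 dt_eq)
  have lin: "linear (\<theta> x)" if "x \<in> U" for x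
  proof -
    have lq: "linear (\<D> q x)"
      by (rule has_derivative_linear[OF smooth_on_has_derivative[OF q that]])
    show ?thesis
      by (rule linearI) (simp_all add: \<theta>_def linear_add[OF lq] linear_cmul[OF lq] linear_add[OF \<beta>_linear]
          linear_cmul[OF \<beta>_linear] algebra_simps)
  qed
  have \<beta>U: "smooth_on U (\<lambda>y. \<beta> y b)" for b by (rule smooth_on_subset[OF \<beta>_smooth subset_UNIV])
  have sm\<theta>: "smooth_on U (\<lambda>x. \<theta> x b)" for b
    unfolding \<theta>_def
    by (intro smooth_on_add smooth_on_minus smooth_on_mult smooth_on_const p hc \<beta>U smooth_on_frechet_derivative[OF q] U)
  have \<Omega>_dar: "\<Omega> x a b = \<D> p x a * \<D> q x b
      - \<D> p x b * \<D> q x a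
      + (\<D> hcan x a * fst b - \<D> hcan x b * fst a)" if x: "x \<in> U" for x a b
    using dar[OF x, of "case_nat a (\<lambda>_. b)"] unfolding wedge_d_d wedge_d_dt Omega_e_eq' by simp
  \<comment> \<open>The second derivatives of \<open>q\<close> cancel by symmetry; what remains is
    the Darboux expression compared with \<open>\<Omega>_exact\<close>.\<close>
  have cl: "\<D> (\<lambda>y. \<theta> y a) x b = \<D> (\<lambda>y. \<theta> y b) x a" if x: "x \<in> U" for x a b
  proof -
    have d: "\<D> (\<lambda>y. \<theta> y a) x b =
      - ((p x * \<D> (\<lambda>y. \<D> q y a) x b
          + \<D> p x b * \<D> q x a)
         + \<D> hcan x b * fst a) + \<D> (\<lambda>y. \<beta> y a) x b" for a b
      unfolding \<theta>_def
      by (intro frechet_derivative_eqI has_derivative_add has_derivative_minus has_derivative_mult has_derivative_mult_left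
          smooth_on_has_derivative[OF p x] smooth_on_has_derivative[OF hc x] smooth_on_has_derivative[OF \<beta>U x]
          smooth_on_has_derivative[OF smooth_on_frechet_derivative[OF q] x])
    show ?thesis
      unfolding d using frechet_derivative_commute[OF U x q, of a b] \<Omega>_dar[OF x, of a b] \<Omega>_exact[of x a b] by simp
  qed
  show "\<exists>s. generating_function U (theta_can q p hcan) (theta_e u P \<rho> h) s"
  proof -
    obtain s where s: "smooth_on U s" "\<And>x. x \<in> U \<Longrightarrow> (s has_derivative \<theta> x) (at x)"
      using simply_connected_potential[OF U sc lin sm\<theta> cl] by blast
    have "generating_function U (theta_can q p hcan) (theta_e u P \<rho> h) s"
      unfolding generating_function_def diff_eq ext_d_form0
      using s(1) frechet_derivative_eqI[OF s(2)] by simp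
    then show ?thesis by blast
  qed
  show "u x = grad s x + p x *\<^sub>R grad q x"
    if s: "generating_function U (theta_can q p hcan) (theta_e u P \<rho> h) s" and x: "x \<in> U"
  proof -
    have ds: "\<D> s x b = \<theta> x b" for b
      using s x unfolding generating_function_def diff_eq ext_d_form0 by (auto dest: bspec[of _ _ x] spec[of _ "\<lambda>_. b"])
    \<comment> \<open>On spatial unit vectors the \<open>dt\<close> components vanish, which removes
      \<open>hcan\<close> and \<open>\<psi>\<close> and leaves only \<open>p\<close>,
      \<open>q\<close> and \<open>u\<close>.\<close>
    have "grad s x $ i = - (p x * grad q x $ i) + u x $ i" for i
      by (simp add: grad_def partial_x_def ds \<theta>_def \<beta>_def inner_axis)
    then show ?thesis by (simp add: vec_eq_iff)
  qed
qed

end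

theorem proposition1:
  fixes u :: "real \<times> (real^3) \<Rightarrow> real^3"
    and P \<rho> h :: "real \<times> (real^3) \<Rightarrow> real"
  assumes "smooth_on UNIV u" and "smooth_on UNIV P" and "smooth_on UNIV \<rho>" and "smooth_on UNIV h"
    and "\<forall>x. \<rho> x > 0"
    and "euler_incompressible u P \<rho>"
    and "\<forall>x. partial_t h x + convect u h x = 0"
    and "\<forall>x. curl u x \<bullet> grad h x \<noteq> 0"
  shows
    "(symplectic_form (Omega_e u h) \<and> hamiltonian_vf (Omega_e u h) (suspension u) h) \<and>
     ((\<lambda>x v. 1/2 * wedge 2 2 (Omega_e u h) (Omega_e u h) x v)
         = (\<lambda>x v. potential_vorticity u h x * volume_form x v) \<and>
      (\<forall>x. partial_t (potential_vorticity u h) x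
           + divergence (\<lambda>y. potential_vorticity u h y *\<^sub>R u y) x = 0)) \<and>
     (is_form 1 (theta_e u P \<rho> h) \<and>
      Omega_e u h = (\<lambda>x v. - ext_d 1 (theta_e u P \<rho> h) x v)) \<and>
     ((\<forall>x0. \<exists>U q p hcan. x0 \<in> U \<and> darboux_coordinates (Omega_e u h) U q p hcan) \<and>
      (\<forall>U q p hcan. simply_connected U \<and> darboux_coordinates (Omega_e u h) U q p hcan \<longrightarrow>
         (\<exists>s. generating_function U (theta_can q p hcan) (theta_e u P \<rho> h) s) \<and>
         (\<forall>s. generating_function U (theta_can q p hcan) (theta_e u P \<rho> h) s \<longrightarrow>
              (\<forall>x\<in>U. u x = grad s x + p x *\<^sub>R grad q x))))"
proof -
  interpret euler_flow u P \<rho> h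
    using assms by unfold_locales auto
  show ?thesis
    by (intro conjI allI impI ballI symplectic hamiltonian liouville continuity exact darboux_exists)
      (auto intro: clebsch)
qed

end
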